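(* Let $k\in\mathbb{N}$ and let $(\mathbb{R}^n,dx^2,e^{-\phi}\mathrm{dvol})$ be a shrinking Gaussian with $\operatorname{Ric}_\phi:=\operatorname{Ric}+\nabla^2\phi=\frac{1}{2\tau}dx^2$, i.e. $\phi(x)=\frac{|x-x_0|^2}{4\tau}$ for some $\tau>0$, $x_0\in\mathbb{R}^n$. Let $(\phi_t,\tau_t)\in\mathcal{C}_1(dx^2)$ be a smooth variation of $(\phi,\tau)$. Then $$(-1)^k\left.\frac{d^2}{dt^2}\widehat{\mathcal{W}}_k(dx^2,\phi_t,\tau_t)\right|_{t=0}\leq0 .$$ Moreover, equality holds if and only if $(\phi_t,\tau_t)$ is tangent to a curve in $\mathcal{C}_1(dx^2)$ through shrinking Gaussians.
   Context: The weighted elementary symmetric polynomials $\sigma_k^\infty\colon\mathbb{R}\times\mathbb{R}^n\to\mathbb{R}$ are defined recursively by $\sigma_0^\infty=1$ and, for $k\ge1$, $$k\,\sigma_k^\infty(\mu_0;\mu)=\sigma_{k-1}^\infty(\mu_0;\mu)\sum_{j=0}^n\mu_j+\sum_{i=1}^{k-1}\sum_{j=1}^n(-1)^i\sigma_{k-1-i}^\infty(\mu_0;\mu)\,\mu_j^{i+1};$$ for a self-adjoint endomorphism $P$ with eigenvalues $\mu$, $\sigma_k^\infty(\mu_0;P):=\sigma_k^\infty(\mu_0;\mu)$. On $(\mathbb{R}^n,dx^2)$, for $\phi\in C^\infty(\mathbb{R}^n)$, $\tau>0$ and $\lambda=\frac1{2\tau}$: $\widetilde{\operatorname{Ric}}_\phi:=\nabla^2\phi-\lambda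 dx^2$, $\widetilde{Y}_\phi:=-\frac12(|\nabla\phi|^2-2\lambda\phi)$, $\widetilde{\sigma}_{j,\phi}:=\sigma_j^\infty(\widetilde{Y}_\phi;\widetilde{\operatorname{Ric}}_\phi)$, $\widehat{\sigma}_{j,\phi}:=\sigma_j^\infty(\widetilde{Y}_\phi-\lambda;\widetilde{\operatorname{Ric}}_\phi)$, and $$\mathcal{W}_j(dx^2,\phi,\tau):=\int_{\mathbb{R}^n}\tau^j\,\widetilde{\sigma}_{j,\phi}\,(4\pi\tau)^{-n/2}e^{-\phi}\,\mathrm{dvol}.$$ $\mathcal{C}_1(dx^2):=\{(\phi,\tau)\in C^\infty(\mathbb{R}^n)\times\mathbb{R}_+:\int_{\mathbb{R}^n}(4\pi\tau)^{-n/2}e^{-\phi}\mathrm{dvol}=1\}$. $\widehat{\mathcal{W}}_k$ is the linear combination of $\mathcal{W}_1,\dots,\mathcal{W}_k$ whose derivative under variations $\psi$ of $\phi$ ($\tau$ fixed) within $\mathcal{C}_1(dx^2)$ is $-\int\tau^k\,\widehat{\sigma}_{k,\phi}\,\psi\,(4\pi\tau)^{-n/2}e^{-\phi}\mathrm{dvol}$; explicitly $$\widehat{\mathcal{W}}_k=\sum_{i=0}^{k-1}\left(2^{-i}\sum_{l=0}^{i}\frac{(-1)^l}{l!}\right)\mathcal{W}_{k-i}\qquad(\text{so }\widehat{\mathcal{W}}_1=\mathcal{W}_1,\ \widehat{\mathcal{W}}_2=\mathcal{W}_2).$$ A smooth variation of $(\phi,\tau)$ in $\mathcal{C}_1(dx^2)$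 is a smooth family $(\phi_t,\tau_t)\in\mathcal{C}_1(dx^2)$, $t\in(-\varepsilon,\varepsilon)$, with $(\phi_0,\tau_0)=(\phi,\tau)$. It is tangent to a curve through shrinking Gaussians if its first $t$-derivative at $t=0$ agrees with that of some smooth curve $\left(\frac{|x-x_t|^2}{4s_t},s_t\right)$ with $x_t\in\mathbb{R}^n$, $s_t>0$, passing through $(\phi,\tau)$ at $t=0$.
   Formalization: The variation is also assumed dominated: t-derivatives of φ_t up to order 2, with their gradients and Hessians, have all moments against e^{-φ_t}, bounded by an integrable function uniformly for t near 0; for a general smooth variation in C_1 the second derivative may not exist. *)

theory Defs
  imports "HOL-Analysis.Analysis"
begin

section \<open>Smooth functions\<close>

text \<open>Both definitions are meant for open sets in finite-dimensional spaces, where they agree with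
  the usual notions of \<open>C\<^sup>m\<close> and \<open>C\<^sup>\<infinity>\<close>.\<close>

fun Cm_on :: "nat \<Rightarrow> 'a::real_normed_vector set \<Rightarrow> ('a \<Rightarrow> 'b::real_normed_vector) \<Rightarrow> bool" where
  "Cm_on 0 S f \<longleftrightarrow> continuous_on S f"
| "Cm_on (Suc m) S f \<longleftrightarrow>
     (\<forall>x\<in>S. f differentiable (at x)) \<and> (\<forall>v. Cm_on m S (\<lambda>x. frechet_derivative f (at x) v))"

definition smooth_on :: "'a::real_normed_vector set \<Rightarrow> ('a \<Rightarrow> 'b::real_normed_vector) \<Rightarrow> bool" where
  "smooth_on S f \<longleftrightarrow> (\<forall>m. Cm_on m S f)"

definition partial :: "'n::finite \<Rightarrow> (real^'n \<Rightarrow> real) \<Rightarrow> real^'n \<Rightarrow> real" where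
  "partial i f x = frechet_derivative f (at x) (axis i 1)"

definition grad :: "(real^'n::finite \<Rightarrow> real) \<Rightarrow> real^'n \<Rightarrow> real^'n" where
  "grad f x = (\<chi> i. partial i f x)"

definition hess :: "(real^'n::finite \<Rightarrow> real) \<Rightarrow> real^'n \<Rightarrow> real^'n^'n" where
  "hess f x = (\<chi> i j. partial i (partial j f) x)"

section \<open>Weighted elementary symmetric polynomials\<close>

fun wsigma :: "nat \<Rightarrow> real \<Rightarrow> real^'n::finite \<Rightarrow> real" where
  "wsigma 0 \<mu>0 \<mu> = 1"
| "wsigma (Suc m) \<mu>0 \<mu> =
     (wsigma m \<mu>0 \<mu> * (\<mu>0 + (\<Sum>j\<in>UNIV. \<mu> $ j))
      + (\<Sum>i=1..m. \<Sum>j\<in>UNIV. (-1) ^ i * wsigma (m - i) \<mu>0 \<mu> * (\<mu> $ j) ^ (i + 1))) / real (Suc m)"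

text \<open>\<open>\<mu>\<close> lists the eigenvalues of the symmetric matrix \<open>P\<close> with multiplicity: there is an
  orthonormal basis \<open>v\<close> with \<open>P (v i) = \<mu> i \<sqdot> v i\<close>. The order is irrelevant
  because \<^const>\<open>wsigma\<close> is symmetric in \<open>\<mu>\<close>.\<close>

definition is_eigenvalues :: "real^'n^'n::finite \<Rightarrow> real^'n \<Rightarrow> bool" where
  "is_eigenvalues P \<mu> \<longleftrightarrow>
     (\<exists>v :: 'n \<Rightarrow> real^'n. (\<forall>i j. v i \<bullet> v j = (if i = j then 1 else 0))
                      \<and> (\<forall>i. P *v v i = (\<mu> $ i) *\<^sub>R v i))"

definition wsigma_endo :: "nat \<Rightarrow> real \<Rightarrow> real^'n^'n::finite \<Rightarrow> real" where
  "wsigma_endo j \<mu>0 P = wsigma j \<mu>0 (SOME \<mu>. is_eigenvalues P \<mu>)"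

section \<open>The functionals on flat space\<close>

definition Ric_t :: "(real^'n::finite \<Rightarrow> real) \<Rightarrow> real \<Rightarrow> real^'n \<Rightarrow> real^'n^'n" where
  "Ric_t \<phi> \<tau> x = hess \<phi> x - mat (1 / (2 * \<tau>))"

definition Y_t :: "(real^'n::finite \<Rightarrow> real) \<Rightarrow> real \<Rightarrow> real^'n \<Rightarrow> real" where
  "Y_t \<phi> \<tau> x = - (1 / 2) * ((norm (grad \<phi> x))\<^sup>2 - 2 * (1 / (2 * \<tau>)) * \<phi> x)"

definition sigma_t :: "nat \<Rightarrow> (real^'n::finite \<Rightarrow> real) \<Rightarrow> real \<Rightarrow> real^'n \<Rightarrow> real" where
  "sigma_t j \<phi> \<tau> x = wsigma_endo j (Y_t \<phi> \<tau> x) (Ric_t \<phi> \<tau> x)"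

definition weight :: "(real^'n::finite \<Rightarrow> real) \<Rightarrow> real \<Rightarrow> real^'n \<Rightarrow> real" where
  "weight \<phi> \<tau> x = (4 * pi * \<tau>) powr (- real CARD('n) / 2) * exp (- \<phi> x)"

definition W_fun :: "nat \<Rightarrow> (real^'n::finite \<Rightarrow> real) \<Rightarrow> real \<Rightarrow> real" where
  "W_fun j \<phi> \<tau> = (LINT x|lborel. \<tau> ^ j * sigma_t j \<phi> \<tau> x * weight \<phi> \<tau> x)"

definition W_hat :: "nat \<Rightarrow> (real^'n::finite \<Rightarrow> real) \<Rightarrow> real \<Rightarrow> real" where
  "W_hat k \<phi> \<tau> =
     (\<Sum>i<k. ((1 / 2) ^ i * (\<Sum>l\<le>i. (-1) ^ l / fact l)) * W_fun (k - i) \<phi> \<tau>)"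

definition C1 :: "((real^'n::finite \<Rightarrow> real) \<times> real) set" where
  "C1 = {(\<phi>, \<tau>). smooth_on UNIV \<phi> \<and> \<tau> > 0 \<and> (LINT x|lborel. weight \<phi> \<tau> x) = 1}"

section \<open>Variations\<close>

definition gaussian :: "real^'n::finite \<Rightarrow> real \<Rightarrow> real^'n \<Rightarrow> real" where
  "gaussian x0 \<tau> x = (norm (x - x0))\<^sup>2 / (4 * \<tau>)"

definition smooth_variation ::
  "(real^'n::finite \<Rightarrow> real) \<Rightarrow> real \<Rightarrow> real \<Rightarrow> (real \<Rightarrow> real^'n \<Rightarrow> real) \<Rightarrow> (real \<Rightarrow> real) \<Rightarrow> bool" where
  "smooth_variation \<phi> \<tau> \<epsilon> \<phi>t \<tau>t \<longleftrightarrow>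
     smooth_on ({-\<epsilon><..<\<epsilon>} \<times> UNIV) (\<lambda>(t, x). \<phi>t t x) \<and>
     smooth_on {-\<epsilon><..<\<epsilon>} \<tau>t \<and>
     (\<forall>t\<in>{-\<epsilon><..<\<epsilon>}. (\<phi>t t, \<tau>t t) \<in> C1) \<and>
     \<phi>t 0 = \<phi> \<and> \<tau>t 0 = \<tau>"

definition tangent_to_gaussians ::
  "(real^'n::finite \<Rightarrow> real) \<Rightarrow> real \<Rightarrow> (real \<Rightarrow> real^'n \<Rightarrow> real) \<Rightarrow> (real \<Rightarrow> real) \<Rightarrow> bool" where
  "tangent_to_gaussians \<phi> \<tau> \<phi>t \<tau>t \<longleftrightarrow>
     (\<exists>\<delta>>0. \<exists>(xt :: real \<Rightarrow> real^'n) (st :: real \<Rightarrow> real).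
        smooth_on {-\<delta><..<\<delta>} xt \<and> smooth_on {-\<delta><..<\<delta>} st \<and>
        (\<forall>t\<in>{-\<delta><..<\<delta>}. st t > 0 \<and> (gaussian (xt t) (st t), st t) \<in> C1) \<and>
        gaussian (xt 0) (st 0) = \<phi> \<and> st 0 = \<tau> \<and>
        (\<forall>x. deriv (\<lambda>t. \<phi>t t x) 0 = deriv (\<lambda>t. gaussian (xt t) (st t) x) 0) \<and>
        deriv \<tau>t 0 = deriv st 0)"

text \<open>Space is noncompact, so smoothness of a variation in \<open>C1\<close> alone does not make the
  integrals \<^const>\<open>W_fun\<close> twice differentiable in \<open>t\<close>: for
  \<open>\<tau>\<^sub>t = \<tau>\<close> and \<open>weight (\<phi>t t) \<tau> x = (1 - t\<^sup>2) G(x) + t\<^sup>2 G(x - e / t)\<close> with \<open>G\<close> the weight of a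
  centred Gaussian and \<open>e\<close> a unit vector (extended smoothly to \<open>t = 0\<close>), \<open>W_fun 1\<close> behaves like
  \<open>- t\<^sup>2 ln \<bar>t\<bar>\<close> near 0. The
  following predicate is the domination needed to differentiate under the integral sign:
  locally uniformly in \<open>t\<close>, the partial derivatives of \<open>\<phi>t\<close> that occur in the first two
  \<open>t\<close>-derivatives of the integrands have all moments with respect to \<open>exp (- \<phi>t)\<close>.\<close>

definition dominated_moments ::
  "(real \<Rightarrow> real^'n::finite \<Rightarrow> real) \<Rightarrow> (real \<Rightarrow> real^'n \<Rightarrow> 'b::real_normed_vector) \<Rightarrow> bool" where
  "dominated_moments \<phi>t Q \<longleftrightarrow>
     (\<forall>p::nat. \<exists>\<delta>>0. \<exists>g. integrable lborel g \<and>
        (\<forall>t x. \<bar>t\<bar> < \<delta> \<longrightarrow> norm (Q t x) ^ p * exp (- \<phi>t t x) \<le> g x))"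

definition t_deriv :: "nat \<Rightarrow> (real \<Rightarrow> real^'n::finite \<Rightarrow> real) \<Rightarrow> real \<Rightarrow> real^'n \<Rightarrow> real" where
  "t_deriv i \<phi>t t x = (deriv ^^ i) (\<lambda>s. \<phi>t s x) t"

definition dominated_variation :: "(real \<Rightarrow> real^'n::finite \<Rightarrow> real) \<Rightarrow> bool" where
  "dominated_variation \<phi>t \<longleftrightarrow>
     (\<forall>i\<le>2. dominated_moments \<phi>t (t_deriv i \<phi>t) \<and>
            dominated_moments \<phi>t (\<lambda>t. grad (t_deriv i \<phi>t t)) \<and>
            dominated_moments \<phi>t (\<lambda>t. hess (t_deriv i \<phi>t t)))"

end

theory Submission
  imports Defs
begin

text \<open>
  \<open>\<sigma>\<^sub>j\<^sup>\<infinity>(Y; P)\<close> is a polynomial in \<open>Y\<close> and the traces of the powers of \<open>P\<close>, homogeneous of degree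
  \<open>j\<close>. At a shrinking Gaussian both \<open>Y\<close> and \<open>P\<close> vanish identically, hence only \<open>\<W>\<^sub>1\<close> and \<open>\<W>\<^sub>2\<close> contribute to the second variation. Let \<open>v\<close> be the first variation of \<open>\<phi>\<close> relative to
  the Gaussian that follows \<open>\<tau>\<^sub>t\<close>; the mass constraint says that \<open>v\<close> has mean zero. With
  \<open>\<delta> = \<integral> \<bar>\<nabla>v\<bar>\<^sup>2 - \<integral> v\<^sup>2 / (2\<tau>)\<close> for the Gaussian weight, integration by parts gives \<open>\<W>\<^sub>1'' = \<tau> \<delta>\<close>, and Bochner's
  formula gives \<open>\<W>\<^sub>2'' = - \<W>\<^sub>1'' / 2\<close>. The coefficients of \<open>\<W>\<^sub>1\<close> and \<open>\<W>\<^sub>2\<close> then combine to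
  \<open>(-1/2)\<^sup>k\<^sup>-\<^sup>1 / (k - 1)!\<close>. Finally \<open>\<delta> \<ge> 0\<close> is the Gaussian Poincare inequality; equality forces \<open>v\<close> to be
  linear, which is a translation of the Gaussian.
\<close>
section \<open>Integration by parts on Euclidean space\<close>

text \<open>The obstacle is noncompactness: growth is controlled only for two
  \<open>t\<close>-derivatives of \<open>\<phi>t\<close> and two space derivatives of each. This
  shapes four choices. Eigenvalues of a varying matrix need not depend differentiably on it, so
  \<open>sigma_t\<close> is rewritten through traces of powers. Bochner's formula usually passes
  through third derivatives, so integration by parts is stated for a whole divergence, in which they
  cancel. The Poincare inequality is proved by rotating two independent copies of the Gaussian: this
  uses first derivatives only and leaves an explicit remainder whose vanishing settles equality. The
  second variation of \<open>\<phi>\<close> enters the first functional only through its mean, which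
  the mass constraint, differentiated twice, expresses by first-order data. The factor -1/2 between
  the two functionals is the additional power of \<tau> times the factor -1/(2 \<tau>) from Bochner.
  The factorial arises because the two coefficients that survive in \<open>W_hat\<close> involve
  consecutive partial sums of an alternating series.\<close>

lemma integrable_lborel_translate:
  fixes h :: "'a::euclidean_space \<Rightarrow> real"
  assumes h: "integrable lborel h"
  shows "integrable lborel (\<lambda>x. h (x + v))"
proof -
  have [measurable]: "h \<in> borel_measurable borel"
    using borel_measurable_integrable[OF h] by simp
  have "integrable (distr lborel borel ((+) v)) h"
    unfolding lborel_distr_plus by (rule h)
  then show ?thesis
    by (subst (asm) integrable_distr_eq) (auto simp: add.commute)
qed

lemma integral_lborel_translate:
  fixes h :: "'a::euclidean_space \<Rightarrow> real"
  assumes [measurable]: "h \<in> borel_measurable borel"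
  shows "(LINT x|lborel. h (x + v)) = (LINT x|lborel. h x)"
proof -
  have "(LINT x|lborel. h x) = (LINT x|distr lborel borel ((+) v). h x)"
    unfolding lborel_distr_plus ..
  also have "\<dots> = (LINT x|lborel. h (x + v))"
    by (subst integral_distr) (auto simp: add.commute)
  finally show ?thesis by simp
qed

text \<open>The fundamental theorem of calculus writes \<open>h (x + v) - h x\<close> as an integral
  of \<open>d\<close> over the segment. Integrated over \<open>x\<close>, the left side vanishes by
  translation invariance and the right side is the integral of \<open>d\<close> by Fubini.
  Integrability of \<open>h\<close> takes the place of decay at infinity.\<close>

lemma integral_directional_derivative_eq_0:
  fixes h d :: "'a::euclidean_space \<Rightarrow> real" and v :: 'a
  assumes deriv: "\<And>x. ((\<lambda>s. h (x + s *\<^sub>R v)) has_real_derivative d x) (at 0)"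
    and cont: "continuous_on UNIV d"
    and h: "integrable lborel h" and d: "integrable lborel d"
  shows "(LINT x|lborel. d x) = 0"
proof -
  have [measurable]: "d \<in> borel_measurable borel"
    by (rule borel_measurable_continuous_onI[OF cont])
  have [measurable]: "h \<in> borel_measurable borel"
    using borel_measurable_integrable[OF h] by simp
  have deriv': "((\<lambda>s. h (x + s *\<^sub>R v)) has_real_derivative d (x + r *\<^sub>R v)) (at r)" for x r
  proof -
    have "((\<lambda>s. h ((x + r *\<^sub>R v) + s *\<^sub>R v)) has_real_derivative d (x + r *\<^sub>R v)) (at 0)"
      by (rule deriv)
    then have "((\<lambda>s. h (x + (s + r) *\<^sub>R v)) has_real_derivative d (x + r *\<^sub>R v)) (at 0)"
      by (simp add: algebra_simps)
    then show ?thesis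
      using DERIV_at_within_shift[of "\<lambda>s. h (x + s *\<^sub>R v)" "d (x + r *\<^sub>R v)" r 0 UNIV]
      by (simp add: add.commute)
  qed
  have ftc: "(LINT s|lborel. d (x + s *\<^sub>R v) * indicator {0..1} s) = h (x + v) - h x" for x
  proof -
    have "isCont (\<lambda>s. d (x + s *\<^sub>R v)) r" for r
      by (rule continuous_at_compose[unfolded o_def, where f = "\<lambda>s. x + s *\<^sub>R v"])
         (use cont in \<open>auto intro!: continuous_intros simp: continuous_on_eq_continuous_at\<close>)
    then show ?thesis
      using integral_FTC_Icc_real[of 0 1 "\<lambda>s. h (x + s *\<^sub>R v)" "\<lambda>s. d (x + s *\<^sub>R v)"] deriv'
      by auto
  qed
  let ?k = "\<lambda>(s, x). d (x + s *\<^sub>R v) * indicator {0..1} (s::real)"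
  have int: "integrable (lborel \<Otimes>\<^sub>M lborel) ?k"
  proof (rule lborel_pair.Fubini_integrable)
    have "(\<lambda>s::real. \<integral>x. norm (?k (s, x)) \<partial>lborel)
        = (\<lambda>s. (LINT x|lborel. norm (d x)) * indicator {0..1} s)"
    proof
      fix s :: real
      have "(\<integral>x. norm (?k (s, x)) \<partial>lborel) = (\<integral>x. norm (d (x + s *\<^sub>R v)) * indicator {0..1} s \<partial>lborel)"
        by (auto simp: abs_mult)
      also have "\<dots> = (LINT x|lborel. norm (d x)) * indicator {0..1} s"
        using integral_lborel_translate[of "\<lambda>x. norm (d x)" "s *\<^sub>R v"] by (subst integral_mult_left_zero) simp
      finally show "(\<integral>x. norm (?k (s, x)) \<partial>lborel) = (LINT x|lborel. norm (d x)) * indicator {0..1} s" .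
    qed
    then show "integrable lborel (\<lambda>s. \<integral>x. norm (?k (s, x)) \<partial>lborel)" by simp
    show "AE s in lborel. integrable lborel (\<lambda>x. ?k (s, x))"
      using integrable_lborel_translate[OF d] by auto
  qed measurable
  have "(LINT s|lborel. (LINT x|lborel. ?k (s, x))) = (LINT s|lborel. (LINT x|lborel. d x) * indicator {0..1::real} s)"
    by (intro Bochner_Integration.integral_cong refl)
       (simp add: integral_lborel_translate)
  also have "\<dots> = (LINT x|lborel. d x)"
    by simp
  also have "(LINT s|lborel. (LINT x|lborel. ?k (s, x))) = (LINT x|lborel. (LINT s|lborel. ?k (s, x)))"
    using lborel_pair.Fubini_integral[of "\<lambda>s x. ?k (s, x)"] int by simp
  also have "\<dots> = (LINT x|lborel. h (x + v) - h x)"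
    using ftc by simp
  also have "\<dots> = 0"
    by (subst Bochner_Integration.integral_diff)
       (auto intro!: h integrable_lborel_translate simp: integral_lborel_translate)
  finally show ?thesis by simp
qed

lemma integrable_compact_support:
  fixes f :: "'a::euclidean_space \<Rightarrow> real"
  assumes "continuous_on UNIV f" "\<And>x. norm x > R \<Longrightarrow> f x = 0"
  shows "integrable lborel f"
proof -
  have "set_integrable lborel (cball 0 R) f"
    unfolding set_integrable_def
    by (rule borel_integrable_compact) (auto intro: continuous_on_subset[OF assms(1)])
  moreover have "(\<lambda>x. indicator (cball 0 R) x *\<^sub>R f x) = f"
    using assms(2) by (auto simp: indicator_def fun_eq_iff not_le)
  ultimately show ?thesis by (simp add: set_integrable_def)
qed

text \<open>A cutoff that vanishes outside the ball of radius \<open>R\<close>. Squaring the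
  positive part makes it continuously differentiable, enough for one integration by parts, and its
  derivative is of size 1/R.\<close>

definition bump :: "real \<Rightarrow> 'a::real_inner \<Rightarrow> real" where
  "bump R x = (max 0 (1 - (x \<bullet> x) / R\<^sup>2))\<^sup>2"

text \<open>The error of the difference quotient is at most |h| for every \<open>u\<close>, so the
  kink at 0 is covered by the same estimate.\<close>

lemma DERIV_max0_square:
  "((\<lambda>u::real. (max 0 u)\<^sup>2) has_real_derivative 2 * max 0 u) (at u)"
proof -
  have bound: "\<bar>((max 0 (u + h))\<^sup>2 - (max 0 u)\<^sup>2) / h - 2 * max 0 u\<bar> \<le> \<bar>h\<bar>" if "h \<noteq> 0" for h :: real
  proof -
    have "\<bar>(max 0 (u + h))\<^sup>2 - (max 0 u)\<^sup>2 - 2 * max 0 u * h\<bar> \<le> h\<^sup>2"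
    proof (cases "u + h \<ge> 0")
      case True
      then show ?thesis
      proof (cases "u \<ge> 0")
        case False
        then have "(u + h)\<^sup>2 \<le> h\<^sup>2" using True by (intro power_mono) auto
        then show ?thesis using True False by simp
      qed (simp add: power2_eq_square algebra_simps)
    next
      case False
      then show ?thesis
      proof (cases "u \<ge> 0")
        case True
        have "h\<^sup>2 - (- (u\<^sup>2) - 2 * u * h) = (u + h)\<^sup>2" by (simp add: power2_eq_square algebra_simps)
        moreover have "u * (- u - h) \<ge> 0" using True False by (intro mult_nonneg_nonneg) auto
        moreover have "u * (- h) \<ge> 0" using True False by (intro mult_nonneg_nonneg) auto
        ultimately have "\<bar>- (u\<^sup>2) - 2 * u * h\<bar> \<le> h\<^sup>2"
          using zero_le_power2[of "u + h"] by (auto simp: power2_eq_square algebra_simps abs_if)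
        then show ?thesis using True False by simp
      qed simp
    qed
    moreover have "((max 0 (u + h))\<^sup>2 - (max 0 u)\<^sup>2) / h - 2 * max 0 u
        = ((max 0 (u + h))\<^sup>2 - (max 0 u)\<^sup>2 - 2 * max 0 u * h) / h"
      using that by (simp add: field_simps)
    ultimately show ?thesis
      using that by (simp only: abs_divide) (simp add: divide_le_eq power2_eq_square)
  qed
  have "((\<lambda>h. ((max 0 (u + h))\<^sup>2 - (max 0 u)\<^sup>2) / h - 2 * max 0 u) \<longlongrightarrow> 0) (at 0)"
    by (rule Lim_null_comparison[where g = abs])
       (use bound in \<open>auto simp: eventually_at_filter intro!: tendsto_rabs_zero tendsto_ident_at\<close>)
  then show ?thesis
    unfolding DERIV_def by (subst (asm) LIM_zero_iff)
qed

lemma bump_bounds: "0 \<le> bump R x" "bump R x \<le> 1"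
  by (auto simp: bump_def intro!: power_le_one)

lemma bump_eq_0: "norm x \<ge> R \<Longrightarrow> R > 0 \<Longrightarrow> bump R x = 0"
  by (simp add: bump_def dot_square_norm)

lemma continuous_on_bump: "continuous_on S (bump R)"
  unfolding bump_def by (cases "R = 0") (auto intro!: continuous_intros)

definition bump_deriv :: "real \<Rightarrow> 'a::real_inner \<Rightarrow> 'a \<Rightarrow> real" where
  "bump_deriv R v x = 2 * max 0 (1 - (x \<bullet> x) / R\<^sup>2) * (- 2 * (x \<bullet> v) / R\<^sup>2)"

lemma DERIV_bump: "((\<lambda>s. bump R (x + s *\<^sub>R v)) has_real_derivative bump_deriv R v x) (at 0)"
proof -
  have "((\<lambda>s. 1 - ((x + s *\<^sub>R v) \<bullet> (x + s *\<^sub>R v)) / R\<^sup>2) has_real_derivative - 2 * (x \<bullet> v) / R\<^sup>2) (at 0)"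
    by (cases "R = 0") (auto intro!: derivative_eq_intros simp: algebra_simps inner_simps inner_commute divide_simps)
  from DERIV_chain2[OF DERIV_max0_square this]
  show ?thesis by (simp add: bump_def bump_deriv_def)
qed

lemma continuous_on_bump_deriv: "continuous_on S (bump_deriv R v)"
  unfolding bump_deriv_def by (cases "R = 0") (auto intro!: continuous_intros)

lemma bump_deriv_bound:
  assumes R: "R > 0" shows "\<bar>bump_deriv R v x\<bar> \<le> 4 * norm v / R"
proof (cases "norm x \<ge> R")
  case True
  then show ?thesis using R by (simp add: bump_deriv_def dot_square_norm)
next
  case False
  have "\<bar>bump_deriv R v x\<bar> = \<bar>2 * max 0 (1 - (x \<bullet> x) / R\<^sup>2)\<bar> * \<bar>- 2 * (x \<bullet> v) / R\<^sup>2\<bar>"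
    by (simp only: bump_deriv_def abs_mult)
  also have "\<dots> \<le> 2 * (2 * (R * norm v) / R\<^sup>2)"
  proof (intro mult_mono)
    show "\<bar>- 2 * (x \<bullet> v) / R\<^sup>2\<bar> \<le> 2 * (R * norm v) / R\<^sup>2"
    proof -
      have "\<bar>x \<bullet> v\<bar> \<le> R * norm v"
        using Cauchy_Schwarz_ineq2[of x v] False mult_right_mono[of "norm x" R "norm v"] by auto
      then show ?thesis by (simp add: abs_mult divide_right_mono)
    qed
  qed auto
  also have "\<dots> = 4 * norm v / R" using R by (simp add: power2_eq_square)
  finally show ?thesis .
qed

text \<open>Only the divergence, not its individual terms, has to be integrable.\<close>

lemma integral_divergence_eq_0:
  fixes V d :: "'i::finite \<Rightarrow> 'a::euclidean_space \<Rightarrow> real" and e :: "'i \<Rightarrow> 'a"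
  assumes deriv: "\<And>i x. ((\<lambda>s. V i (x + s *\<^sub>R e i)) has_real_derivative d i x) (at 0)"
    and contV: "\<And>i. continuous_on UNIV (V i)" and contd: "\<And>i. continuous_on UNIV (d i)"
    and intV: "\<And>i. integrable lborel (V i)"
    and intd: "integrable lborel (\<lambda>x. \<Sum>i\<in>UNIV. d i x)"
  shows "(LINT x|lborel. (\<Sum>i\<in>UNIV. d i x)) = 0"
proof -
  define R where "R k = real (Suc k)" for k
  have Rpos[simp]: "R k > 0" "R k \<noteq> 0" for k by (auto simp: R_def)
  have Rlim: "filterlim R at_top sequentially"
    unfolding R_def by (rule filterlim_compose[OF filterlim_real_sequentially filterlim_Suc])
  have [measurable]: "V i \<in> borel_measurable borel" "d i \<in> borel_measurable borel" for i
    using contV contd borel_measurable_continuous_onI by blast+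
  have [measurable]: "bump R \<in> borel_measurable borel" "bump_deriv R v \<in> borel_measurable borel" for R and v :: 'a
    using continuous_on_bump continuous_on_bump_deriv borel_measurable_continuous_onI by blast+
  have int1: "integrable lborel (\<lambda>x. bump (R k) x * d i x)" for k i
    by (rule integrable_compact_support[where R = "R k"])
       (auto intro!: continuous_intros contd continuous_on_bump simp: bump_eq_0)
  have bd0: "bump_deriv (R k) v x = 0" if "R k < norm x" for k and v x :: 'a
  proof -
    have "(R k)\<^sup>2 \<le> (norm x)\<^sup>2" using that less_imp_le[OF Rpos(1)[of k]] by (intro power_mono) auto
    then show ?thesis by (simp add: bump_deriv_def dot_square_norm max_def divide_simps)
  qed
  have int2: "integrable lborel (\<lambda>x. bump_deriv (R k) (e i) x * V i x)" for k i
    by (rule integrable_compact_support[where R = "R k"])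
       (auto intro!: continuous_intros contV continuous_on_bump_deriv simp: bd0)
  have int3: "integrable lborel (\<lambda>x. bump (R k) x * V i x)" for k i
    by (rule integrable_compact_support[where R = "R k"])
       (auto intro!: continuous_intros contV continuous_on_bump simp: bump_eq_0)
  \<comment> \<open>The cutoff makes every term compactly supported, hence integrable, even when
    \<open>d i\<close> alone is not.\<close>
  have "(LINT x|lborel. bump (R k) x * d i x + bump_deriv (R k) (e i) x * V i x) = 0" for k i
  proof (rule integral_directional_derivative_eq_0[where h = "\<lambda>x. bump (R k) x * V i x" and v = "e i"])
    show "((\<lambda>s. bump (R k) (x + s *\<^sub>R e i) * V i (x + s *\<^sub>R e i)) has_real_derivative
        bump (R k) x * d i x + bump_deriv (R k) (e i) x * V i x) (at 0)" for x
      using DERIV_mult[OF DERIV_bump[of "R k" x "e i"] deriv[of i x]] by (simp add: algebra_simps)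
  qed (auto intro!: continuous_intros contV contd continuous_on_bump continuous_on_bump_deriv
      Bochner_Integration.integrable_add int1 int2 int3)
  then have sum0: "(\<Sum>i\<in>UNIV. (LINT x|lborel. bump (R k) x * d i x) + (LINT x|lborel. bump_deriv (R k) (e i) x * V i x)) = 0" for k
    by (subst (asm) Bochner_Integration.integral_add[OF int1 int2]) simp
  have eq: "(LINT x|lborel. bump (R k) x * (\<Sum>i\<in>UNIV. d i x))
      = - (\<Sum>i\<in>UNIV. (LINT x|lborel. bump_deriv (R k) (e i) x * V i x))" for k
    unfolding sum_distrib_left
    using sum0[of k] by (subst Bochner_Integration.integral_sum[OF int1]) (simp add: sum.distrib eq_neg_iff_add_eq_0)
  \<comment> \<open>After summation over \<open>i\<close> the cutoff multiplies the whole
    divergence, which serves as its own majorant.\<close>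
  have lim1: "(\<lambda>k. LINT x|lborel. bump (R k) x * (\<Sum>i\<in>UNIV. d i x)) \<longlonglongrightarrow> (LINT x|lborel. (\<Sum>i\<in>UNIV. d i x))"
  proof (rule integral_dominated_convergence[where w = "\<lambda>x. \<bar>\<Sum>i\<in>UNIV. d i x\<bar>"])
    show "AE x in lborel. (\<lambda>k. bump (R k) x * (\<Sum>i\<in>UNIV. d i x)) \<longlonglongrightarrow> (\<Sum>i\<in>UNIV. d i x)"
    proof (intro AE_I2)
      fix x :: 'a
      have "filterlim (\<lambda>k. (R k)\<^sup>2) at_top sequentially"
        by (intro filterlim_pow_at_top Rlim) auto
      then have "(\<lambda>k. (max 0 (1 - (x \<bullet> x) / (R k)\<^sup>2))\<^sup>2) \<longlonglongrightarrow> (max 0 (1 - 0))\<^sup>2"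
        by (intro tendsto_intros tendsto_divide_0[OF tendsto_const filterlim_at_top_imp_at_infinity])
      then have "(\<lambda>k. bump (R k) x) \<longlonglongrightarrow> 1" by (simp add: bump_def)
      then have "(\<lambda>k. bump (R k) x * (\<Sum>i\<in>UNIV. d i x)) \<longlonglongrightarrow> 1 * (\<Sum>i\<in>UNIV. d i x)"
        by (intro tendsto_intros)
      then show "(\<lambda>k. bump (R k) x * (\<Sum>i\<in>UNIV. d i x)) \<longlonglongrightarrow> (\<Sum>i\<in>UNIV. d i x)" by simp
    qed
    show "AE x in lborel. norm (bump (R k) x * (\<Sum>i\<in>UNIV. d i x)) \<le> \<bar>\<Sum>i\<in>UNIV. d i x\<bar>" for k
      by (intro AE_I2) (auto simp: abs_mult bump_bounds abs_of_nonneg intro!: mult_left_le_one_le)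
  qed (use intd integrable_abs[OF intd] in auto)
  \<comment> \<open>The error made by the cutoff is O(1/R) times the L1 norm of
    \<open>V i\<close>.\<close>
  have "(\<lambda>k. LINT x|lborel. bump_deriv (R k) (e i) x * V i x) \<longlonglongrightarrow> 0" for i
  proof (rule Lim_null_comparison[where g = "\<lambda>k. (4 * norm (e i)) * (LINT x|lborel. \<bar>V i x\<bar>) * (1 / R k)"])
    show "(\<lambda>k. (4 * norm (e i)) * (LINT x|lborel. \<bar>V i x\<bar>) * (1 / R k)) \<longlonglongrightarrow> 0"
      by (intro tendsto_mult_right_zero tendsto_divide_0[OF tendsto_const] filterlim_at_top_imp_at_infinity Rlim)
    have "norm (LINT x|lborel. bump_deriv (R k) (e i) x * V i x) \<le> (4 * norm (e i)) * (LINT x|lborel. \<bar>V i x\<bar>) * (1 / R k)" for k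
    proof -
      have "norm (LINT x|lborel. bump_deriv (R k) (e i) x * V i x) \<le> (LINT x|lborel. norm (bump_deriv (R k) (e i) x * V i x))"
        by (rule integral_norm_bound)
      also have "\<dots> \<le> (LINT x|lborel. (4 * norm (e i) / R k) * \<bar>V i x\<bar>)"
      proof (rule integral_mono)
        show "norm (bump_deriv (R k) (e i) x * V i x) \<le> (4 * norm (e i) / R k) * \<bar>V i x\<bar>" for x
          unfolding real_norm_def abs_mult by (intro mult_right_mono bump_deriv_bound) auto
      qed (use integrable_norm[OF int2] intV in auto)
      finally show ?thesis by simp
    qed
    then show "\<forall>\<^sub>F k in sequentially. norm (LINT x|lborel. bump_deriv (R k) (e i) x * V i x)
        \<le> (4 * norm (e i)) * (LINT x|lborel. \<bar>V i x\<bar>) * (1 / R k)" by simp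
  qed
  then have "(\<lambda>k. - (\<Sum>i\<in>UNIV. (LINT x|lborel. bump_deriv (R k) (e i) x * V i x))) \<longlonglongrightarrow> - (\<Sum>i\<in>(UNIV::'i set). 0)"
    by (intro tendsto_intros)
  then show ?thesis
    using LIMSEQ_unique[OF lim1] unfolding eq by simp
qed

text \<open>On the convex set \<open>S\<close> the mean value inequality turns the bound
  \<open>g\<close> on the derivative into the same bound on difference quotients; dominated
  convergence along an arbitrary sequence then applies.\<close>

lemma has_real_derivative_integral_dominated:
  fixes f f' :: "real \<Rightarrow> 'a \<Rightarrow> real"
  assumes S: "open S" "t \<in> S" "convex S"
    and int: "\<And>s. s \<in> S \<Longrightarrow> integrable M (f s)"
    and deriv: "\<And>s x. s \<in> S \<Longrightarrow> ((\<lambda>s. f s x) has_real_derivative f' s x) (at s)"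
    and meas: "f' t \<in> borel_measurable M"
    and g: "integrable M g" and bound: "\<And>s x. s \<in> S \<Longrightarrow> \<bar>f' s x\<bar> \<le> g x"
  shows "((\<lambda>s. integral\<^sup>L M (f s)) has_real_derivative integral\<^sup>L M (f' t)) (at t)"
  unfolding has_field_derivative_iff tendsto_at_iff_sequentially
proof (intro allI impI)
  fix X :: "nat \<Rightarrow> real"
  assume X: "\<forall>n. X n \<in> UNIV - {t}" "X \<longlonglongrightarrow> t"
  \<comment> \<open>Only a tail of the sequence lies in \<open>S\<close>; it is shifted by
    \<open>N\<close> and the shift is undone at the end.\<close>
  from topological_tendstoD[OF X(2) S(1,2)]
  obtain N where N: "\<And>n. n \<ge> N \<Longrightarrow> X n \<in> S" by (auto simp: eventually_sequentially)
  have "(\<lambda>n. integral\<^sup>L M (\<lambda>x. (f (X (n + N)) x - f t x) / (X (n + N) - t))) \<longlonglongrightarrow> integral\<^sup>L M (f' t)"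
  proof (rule integral_dominated_convergence[where w = g])
    show "f' t \<in> borel_measurable M" by (rule meas)
    show "(\<lambda>x. (f (X (n + N)) x - f t x) / (X (n + N) - t)) \<in> borel_measurable M" for n
      using int[OF N[of "n + N"]] int[OF S(2)] by (auto intro!: borel_measurable_divide borel_measurable_diff)
    show "integrable M g" by (rule g)
    show "AE x in M. (\<lambda>n. (f (X (n + N)) x - f t x) / (X (n + N) - t)) \<longlonglongrightarrow> f' t x"
    proof (intro AE_I2)
      fix x
      have "((\<lambda>y. (f y x - f t x) / (y - t)) \<longlongrightarrow> f' t x) (at t)"
        using deriv[OF S(2)] unfolding has_field_derivative_iff .
      then have "(\<lambda>n. (f (X n) x - f t x) / (X n - t)) \<longlonglongrightarrow> f' t x"
        using X(1) filterlim_compose[of "\<lambda>y. (f y x - f t x) / (y - t)" "nhds (f' t x)" "at t" X sequentially] X(2)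
        by (auto simp: filterlim_at)
      then show "(\<lambda>n. (f (X (n + N)) x - f t x) / (X (n + N) - t)) \<longlonglongrightarrow> f' t x"
        by (rule LIMSEQ_ignore_initial_segment)
    qed
    show "AE x in M. norm ((f (X (n + N)) x - f t x) / (X (n + N) - t)) \<le> g x" for n
    proof (intro AE_I2)
      fix x
      have XN: "X (n + N) \<in> S" "X (n + N) \<noteq> t" using N X(1) by auto
      have "norm (f (X (n + N)) x - f t x) \<le> g x * norm (X (n + N) - t)"
        by (rule field_differentiable_bound[OF S(3), where f' = "\<lambda>s. f' s x"])
           (auto intro!: has_field_derivative_at_within deriv bound XN S)
      then show "norm ((f (X (n + N)) x - f t x) / (X (n + N) - t)) \<le> g x"
        using XN by (simp add: field_simps)
    qed
  qed
  moreover have "integral\<^sup>L M (\<lambda>x. (f (X (n + N)) x - f t x) / (X (n + N) - t))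
      = ((\<lambda>y. (integral\<^sup>L M (f y) - integral\<^sup>L M (f t)) / (y - t)) \<circ> X) (n + N)" for n
    using int[OF N[of "n + N"]] int[OF S(2)] by simp
  ultimately have "(\<lambda>n. ((\<lambda>y. (integral\<^sup>L M (f y) - integral\<^sup>L M (f t)) / (y - t)) \<circ> X) (n + N)) \<longlonglongrightarrow> integral\<^sup>L M (f' t)"
    by (simp only:)
  then show "((\<lambda>y. (integral\<^sup>L M (f y) - integral\<^sup>L M (f t)) / (y - t)) \<circ> X) \<longlonglongrightarrow> integral\<^sup>L M (f' t)"
    by (rule LIMSEQ_offset)
qed

section \<open>Eigenvalues of symmetric matrices\<close>

lemma symmetric_matrix_inner:
  fixes P :: "real^'n^'n"
  assumes "transpose P = P" shows "(P *v x) \<bullet> y = x \<bullet> (P *v y)"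
proof -
  have "P *v x = transpose P *v x" by (simp only: assms)
  also have "\<dots> = x v* P" by (rule transpose_matrix_vector)
  finally show ?thesis by (simp only: dot_lmul_matrix)
qed

text \<open>Lagrange multipliers by hand: with \<open>w = P *v v - m *\<^sub>R v\<close> in
  \<open>U\<close>, the Rayleigh inequality along \<open>v + s *\<^sub>R w\<close> reads
  \<open>2 * s * (w \<bullet> w) + s\<^sup>2 * q \<le> 0\<close>, which fails for small positive
  \<open>s\<close> unless \<open>w\<close> is 0.\<close>

lemma sphere_maximizer_eigenvector:
  fixes P :: "real^'n^'n"
  assumes P: "transpose P = P" and U: "subspace U" and inv: "\<And>x. x \<in> U \<Longrightarrow> P *v x \<in> U"
    and v: "v \<in> U" "norm v = 1" and max: "\<And>x. x \<in> U \<Longrightarrow> norm x = 1 \<Longrightarrow> x \<bullet> (P *v x) \<le> v \<bullet> (P *v v)"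
  shows "P *v v = (v \<bullet> (P *v v)) *\<^sub>R v"
proof -
  define m where "m = v \<bullet> (P *v v)"
  have max': "x \<bullet> (P *v x) \<le> m * (x \<bullet> x)" if "x \<in> U" for x
  proof (cases "x = 0")
    case False
    have "((1 / norm x) *\<^sub>R x) \<bullet> (P *v ((1 / norm x) *\<^sub>R x)) \<le> m"
      unfolding m_def using False that by (intro max) (auto intro: subspace_mul[OF U])
    then have "(x \<bullet> (P *v x)) / (norm x)\<^sup>2 \<le> m"
      by (simp add: matrix_vector_mult_scaleR power2_eq_square)
    then show ?thesis using False by (simp add: divide_le_eq dot_square_norm)
  qed (simp add: matrix_vector_mult_0_right)
  define w where "w = P *v v - m *\<^sub>R v"
  have w: "w \<in> U" unfolding w_def by (intro subspace_diff[OF U] subspace_mul[OF U] inv v)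
  define q where "q = w \<bullet> (P *v w) - m * (w \<bullet> w)"
  have main: "2 * s * (w \<bullet> w) + s\<^sup>2 * q \<le> 0" for s
  proof -
    have "(v + s *\<^sub>R w) \<bullet> (P *v (v + s *\<^sub>R w)) \<le> m * ((v + s *\<^sub>R w) \<bullet> (v + s *\<^sub>R w))"
      by (intro max' subspace_add[OF U] subspace_mul[OF U] v w)
    moreover have swap: "v \<bullet> (P *v w) = w \<bullet> (P *v v)"
      using symmetric_matrix_inner[OF P, of v w] by (simp add: inner_commute)
    moreover have "(v + s *\<^sub>R w) \<bullet> (P *v (v + s *\<^sub>R w)) = m + 2 * s * (w \<bullet> (P *v v)) + s\<^sup>2 * (w \<bullet> (P *v w))"
      by (simp add: inner_simps matrix_vector_right_distrib matrix_vector_mult_scaleR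
          power2_eq_square m_def swap algebra_simps)
    moreover have "w \<bullet> (P *v v) = w \<bullet> w + m * (w \<bullet> v)" by (simp add: w_def inner_diff_right)
    moreover have "v \<bullet> v = 1" using v(2) by (simp add: dot_square_norm)
    ultimately show ?thesis
      by (simp add: q_def inner_simps power2_eq_square algebra_simps inner_commute[of v w])
  qed
  have "w \<bullet> w = 0"
  proof (rule ccontr)
    assume "w \<bullet> w \<noteq> 0"
    then have pos: "w \<bullet> w > 0" by (simp add: less_le)
    \<comment> \<open>Small enough that the quadratic term cannot outweigh the linear one:
      \<open>s * \<bar>q\<bar> \<le> w \<bullet> w\<close>. The summand 1 avoids division by
      0.\<close>
    define s where "s = (w \<bullet> w) / (\<bar>q\<bar> + 1)"
    have s: "s > 0" using pos by (simp add: s_def divide_pos_pos)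
    have "s * \<bar>q\<bar> \<le> w \<bullet> w" using pos by (simp add: s_def divide_le_eq algebra_simps)
    moreover have "s * - \<bar>q\<bar> \<le> s * q" using s by (intro mult_left_mono) auto
    ultimately have "2 * (w \<bullet> w) + s * q > 0" using pos unfolding mult_minus_right by linarith
    then have "s * (2 * (w \<bullet> w) + s * q) > 0" using s by simp
    moreover have "s * (2 * (w \<bullet> w) + s * q) = 2 * s * (w \<bullet> w) + s\<^sup>2 * q"
      by (simp add: power2_eq_square algebra_simps)
    ultimately show False using main[of s] by linarith
  qed
  then have "w = 0" by simp
  then show ?thesis unfolding w_def m_def by simp
qed

text \<open>The spectral theorem by induction on the dimension: a maximizer of the Rayleigh quotient
  is split off, and by symmetry its orthogonal complement in \<open>U\<close> is again
  invariant.\<close>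

lemma symmetric_matrix_orthonormal_eigenvectors:
  fixes P :: "real^'n^'n"
  assumes P: "transpose P = P"
  shows "subspace U \<Longrightarrow> (\<And>x. x \<in> U \<Longrightarrow> P *v x \<in> U) \<Longrightarrow>
    \<exists>B. B \<subseteq> U \<and> card B = dim U \<and> finite B \<and> pairwise orthogonal B \<and>
      (\<forall>b\<in>B. norm b = 1 \<and> (\<exists>m. P *v b = m *\<^sub>R b))"
proof (induction "dim U" arbitrary: U)
  case 0
  then show ?case by (intro exI[of _ "{}"]) auto
next
  case (Suc d)
  have cont: "continuous_on (U \<inter> sphere 0 1) (\<lambda>x. x \<bullet> (P *v x))"
    by (intro continuous_intros linear_continuous_on) (simp add: matrix_vector_mul_bounded_linear)
  obtain y where y: "y \<in> U" "y \<noteq> 0"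
    using Suc.hyps(2) dim_eq_0[of U] by (metis (no_types, lifting) Zero_not_Suc singletonI subset_iff)
  have "(1 / norm y) *\<^sub>R y \<in> U \<inter> sphere 0 1"
    using y by (auto intro: subspace_mul[OF Suc.prems(1)])
  then have "U \<inter> sphere 0 1 \<noteq> {}" by blast
  then obtain v where v': "v \<in> U \<inter> sphere 0 1" "\<And>x. x \<in> U \<inter> sphere 0 1 \<Longrightarrow> x \<bullet> (P *v x) \<le> v \<bullet> (P *v v)"
    using continuous_attains_sup[OF closed_Int_compact[OF closed_subspace[OF Suc.prems(1)] compact_sphere[of 0 1]] _ cont]
    by blast
  have v: "v \<in> U" "norm v = 1" "\<And>x. x \<in> U \<Longrightarrow> norm x = 1 \<Longrightarrow> x \<bullet> (P *v x) \<le> v \<bullet> (P *v v)"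
    using v' by auto
  have ev: "P *v v = (v \<bullet> (P *v v)) *\<^sub>R v"
    using sphere_maximizer_eigenvector[OF P Suc.prems v] .
  define W where "W = U \<inter> {x. v \<bullet> x = 0}"
  have subW: "subspace W" unfolding W_def by (intro subspace_inter Suc.prems subspace_hyperplane)
  have "P *v x \<in> W" if "x \<in> W" for x
  proof -
    have "v \<bullet> (P *v x) = (P *v v) \<bullet> x" by (simp add: symmetric_matrix_inner[OF P])
    also have "\<dots> = 0" using that by (subst ev) (simp add: W_def)
    finally show ?thesis using that Suc.prems(2) by (simp add: W_def)
  qed
  moreover have dimW: "dim W = d"
  proof -
    have "span U = span (insert v W)"
    proof
      show "span (insert v W) \<subseteq> span U"
        using v(1) by (intro span_mono) (auto simp: W_def)
      have "x \<in> span (insert v W)" if "x \<in> U" for x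
      proof -
        have "x - (v \<bullet> x) *\<^sub>R v \<in> W"
          unfolding W_def using that v(1,2) Suc.prems(1)
          by (auto intro!: subspace_diff subspace_mul simp: inner_simps dot_square_norm)
        then have "(x - (v \<bullet> x) *\<^sub>R v) + (v \<bullet> x) *\<^sub>R v \<in> span (insert v W)"
          by (intro span_add span_mul) (auto intro: span_base)
        then show ?thesis by simp
      qed
      then show "span U \<subseteq> span (insert v W)" by (simp add: span_minimal subsetI)
    qed
    then have "dim U = dim (insert v W)" by (metis dim_span)
    also have "\<dots> = Suc (dim W)"
    proof -
      have "v \<notin> W" using v(2) by (auto simp: W_def dot_square_norm)
      then show ?thesis using subW by (simp add: dim_insert span_eq_iff[THEN iffD2])
    qed
    finally show ?thesis using Suc.hyps(2) by simp
  qed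
  ultimately obtain B where B: "B \<subseteq> W" "card B = dim W" "finite B" "pairwise orthogonal B"
      "\<forall>b\<in>B. norm b = 1 \<and> (\<exists>m. P *v b = m *\<^sub>R b)"
    using Suc.hyps(1)[of W] subW by metis
  have "v \<notin> B" using B(1) v(2) by (auto simp: W_def dot_square_norm)
  then show ?case
    using B v ev Suc.hyps(2) dimW
    by (intro exI[of _ "insert v B"])
       (auto simp: W_def pairwise_insert orthogonal_def inner_commute)
qed

lemma symmetric_matrix_has_eigenvalues:
  fixes P :: "real^'n^'n"
  assumes P: "transpose P = P"
  shows "\<exists>\<mu>. is_eigenvalues P \<mu>"
proof -
  obtain B where B: "card B = CARD('n)" "finite B" "pairwise orthogonal B"
      "\<And>b. b \<in> B \<Longrightarrow> norm b = 1 \<and> (\<exists>m. P *v b = m *\<^sub>R b)"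
    using symmetric_matrix_orthonormal_eigenvectors[OF P, of UNIV] by auto
  obtain v :: "'n \<Rightarrow> real^'n" where v: "bij_betw v UNIV B"
    using finite_same_card_bij[of "UNIV :: 'n set" B] B by auto
  have vB: "v i \<in> B" for i using v by (auto simp: bij_betw_def)
  then have "\<forall>i. \<exists>m. P *v v i = m *\<^sub>R v i" using B(4) by blast
  then obtain m where m: "\<And>i. P *v v i = m i *\<^sub>R v i" by metis
  have "v i \<bullet> v j = (if i = j then 1 else 0)" for i j
  proof (cases "i = j")
    case False
    then have "v i \<noteq> v j" using v by (auto simp: bij_betw_def inj_on_def)
    then show ?thesis using B(3) vB False by (auto simp: pairwise_def orthogonal_def)
  qed (use B(4) vB in \<open>auto simp: dot_square_norm\<close>)
  then show ?thesis
    unfolding is_eigenvalues_def by (intro exI[of _ "\<chi> i. m i"] exI[of _ v]) (auto simp: m)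
qed

section \<open>Symmetric functions of eigenvalues as polynomials in traces of powers\<close>

primrec mat_pow :: "real^'n^'n \<Rightarrow> nat \<Rightarrow> real^'n^'n" where
  "mat_pow P 0 = mat 1"
| "mat_pow P (Suc m) = P ** mat_pow P m"

text \<open>With the vectors as rows of an orthogonal \<open>V\<close>, the sum is the trace of the
  conjugate of \<open>M\<close> by \<open>V\<close>, and the trace is cyclic.\<close>

lemma trace_orthonormal:
  fixes v :: "'n \<Rightarrow> real^'n" and M :: "real^'n^'n"
  assumes v: "\<And>i j. v i \<bullet> v j = (if i = j then 1 else 0)"
  shows "(\<Sum>i\<in>UNIV. v i \<bullet> (M *v v i)) = trace M"
proof -
  define V where "V = (\<chi> i. v i)"
  have "V ** transpose V = mat 1"
    by (simp add: V_def matrix_matrix_mult_def transpose_def mat_def vec_eq_iff v[unfolded inner_vec_def, simplified])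
  then have V: "transpose V ** V = mat 1" by (simp add: matrix_left_right_inverse)
  have "v i \<bullet> (M *v v i) = ((V ** M) ** transpose V) $ i $ i" for i
    by (simp add: V_def inner_vec_def matrix_vector_mult_def matrix_matrix_mult_def transpose_def
        sum_distrib_left sum_distrib_right mult.assoc) (rule sum.swap)
  then have "(\<Sum>i\<in>UNIV. v i \<bullet> (M *v v i)) = trace ((V ** M) ** transpose V)"
    by (simp add: trace_def)
  also have "\<dots> = trace M"
    by (simp add: trace_mul_sym[of "V ** M"] matrix_mul_assoc V)
  finally show ?thesis .
qed

lemma trace_mat_pow_eigenvalues:
  assumes "is_eigenvalues P \<mu>"
  shows "trace (mat_pow P m) = (\<Sum>j\<in>UNIV. (\<mu> $ j) ^ m)"
proof -
  obtain v where v: "\<And>i j. v i \<bullet> v j = (if i = j then 1 else 0)" "\<And>i. P *v v i = (\<mu> $ i) *\<^sub>R v i"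
    using assms unfolding is_eigenvalues_def by blast
  have "mat_pow P m *v v i = (\<mu> $ i) ^ m *\<^sub>R v i" for i
    by (induction m)
       (simp_all add: matrix_vector_mul_assoc[symmetric] matrix_vector_mult_scaleR v(2))
  then show ?thesis
    by (subst trace_orthonormal[OF v(1), symmetric]) (simp add: v(1))
qed

text \<open>The recursion for \<open>wsigma\<close> with the power sums as formal variables. The
  power sums of the eigenvalues are traces of matrix powers, which are polynomial in the matrix
  entries and can therefore be differentiated in \<open>t\<close>.\<close>

fun wsigma_ps :: "nat \<Rightarrow> real \<Rightarrow> (nat \<Rightarrow> real) \<Rightarrow> real" where
  "wsigma_ps 0 y p = 1"
| "wsigma_ps (Suc m) y p =
     (wsigma_ps m y p * (y + p 1) + (\<Sum>i=1..m. (-1) ^ i * wsigma_ps (m - i) y p * p (i + 1))) / real (Suc m)"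

lemma wsigma_eq_wsigma_ps: "wsigma m y \<mu> = wsigma_ps m y (\<lambda>r. \<Sum>j\<in>UNIV. (\<mu> $ j) ^ r)"
proof (induction m rule: less_induct)
  case (less m)
  show ?case
  proof (cases m)
    case (Suc k)
    have eq: "(\<Sum>i=1..k. \<Sum>j\<in>UNIV. (-1) ^ i * wsigma (k - i) y \<mu> * (\<mu> $ j) ^ (i + 1))
        = (\<Sum>i=1..k. (-1) ^ i * wsigma_ps (k - i) y (\<lambda>r. \<Sum>j\<in>UNIV. (\<mu> $ j) ^ r) * (\<Sum>j\<in>UNIV. (\<mu> $ j) ^ (i + 1)))"
      using less Suc by (intro sum.cong refl) (simp add: sum_distrib_left)
    have "wsigma k y \<mu> = wsigma_ps k y (\<lambda>r. \<Sum>j\<in>UNIV. (\<mu> $ j) ^ r)"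
      using less Suc by simp
    then show ?thesis
      unfolding Suc wsigma.simps wsigma_ps.simps eq by simp
  qed simp
qed

text \<open>Symmetry guarantees that \<open>SOME\<close> has a witness to pick; the traces do not
  depend on which one it picks.\<close>

lemma wsigma_endo_eq_wsigma_ps:
  assumes "transpose P = P"
  shows "wsigma_endo m y P = wsigma_ps m y (\<lambda>r. trace (mat_pow P r))"
proof -
  have "is_eigenvalues P (SOME \<mu>. is_eigenvalues P \<mu>)"
    using symmetric_matrix_has_eigenvalues[OF assms] by (rule someI_ex)
  then show ?thesis
    by (simp add: wsigma_endo_def wsigma_eq_wsigma_ps trace_mat_pow_eigenvalues)
qed

section \<open>Smooth functions and symmetry of second derivatives\<close>

abbreviation fdrv :: "('a::real_normed_vector \<Rightarrow> 'b::real_normed_vector) \<Rightarrow> 'a \<Rightarrow> 'a \<Rightarrow> 'b" where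
  "fdrv f v x \<equiv> frechet_derivative f (at x) v"

lemma smooth_on_differentiable: "smooth_on S f \<Longrightarrow> x \<in> S \<Longrightarrow> f differentiable (at x)"
  unfolding smooth_on_def by (metis Cm_on.simps(2))

lemma smooth_on_fdrv: "smooth_on S f \<Longrightarrow> smooth_on S (fdrv f v)"
  unfolding smooth_on_def by (metis Cm_on.simps(2))

lemma smooth_on_continuous: "smooth_on S f \<Longrightarrow> continuous_on S f"
  unfolding smooth_on_def by (metis Cm_on.simps(1))

lemma has_derivative_fdrv:
  "f differentiable (at x) \<Longrightarrow> (f has_derivative (\<lambda>h. fdrv f h x)) (at x)"
  by (simp add: frechet_derivative_works)

lemma DERIV_fdrv_line:
  fixes f :: "'a::real_normed_vector \<Rightarrow> real"
  assumes "f differentiable (at (x + r *\<^sub>R u))"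
  shows "((\<lambda>s. f (x + s *\<^sub>R u)) has_real_derivative fdrv f u (x + r *\<^sub>R u)) (at r)"
proof -
  have *: "(f has_derivative (\<lambda>h. fdrv f h (x + r *\<^sub>R u))) (at (x + r *\<^sub>R u))"
    using assms by (rule has_derivative_fdrv)
  interpret linear "\<lambda>h. fdrv f h (x + r *\<^sub>R u)"
    using has_derivative_linear[OF *] .
  have "((\<lambda>s. f (x + s *\<^sub>R u)) has_derivative (\<lambda>h. fdrv f (h *\<^sub>R u) (x + r *\<^sub>R u))) (at r)"
    by (rule has_derivative_compose[where f = "\<lambda>s. x + s *\<^sub>R u" and g = f, OF _ *])
      (auto intro!: derivative_eq_intros)
  then show ?thesis
    by (rule has_derivative_imp_has_field_derivative) (simp add: scale mult.commute)
qed

text \<open>The mean value theorem in direction \<open>u\<close>, applied to the difference in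
  direction \<open>v\<close>, followed by the mean value theorem in direction
  \<open>v\<close>.\<close>

lemma second_difference_mvt:
  fixes f :: "'a::real_normed_vector \<Rightarrow> real"
  assumes s: "s > 0"
    and S: "\<And>a b. 0 \<le> a \<Longrightarrow> a \<le> s \<Longrightarrow> 0 \<le> b \<Longrightarrow> b \<le> s \<Longrightarrow> x + a *\<^sub>R u + b *\<^sub>R v \<in> S"
    and f: "\<And>y. y \<in> S \<Longrightarrow> f differentiable (at y)"
    and df: "\<And>y. y \<in> S \<Longrightarrow> fdrv f u differentiable (at y)"
  shows "\<exists>a b. 0 \<le> a \<and> a \<le> s \<and> 0 \<le> b \<and> b \<le> s \<and>
    f (x + s *\<^sub>R u + s *\<^sub>R v) - f (x + s *\<^sub>R u) - f (x + s *\<^sub>R v) + f x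
      = s\<^sup>2 * fdrv (fdrv f u) v (x + a *\<^sub>R u + b *\<^sub>R v)"
proof -
  define g where "g r = f ((x + s *\<^sub>R v) + r *\<^sub>R u) - f (x + r *\<^sub>R u)" for r
  have "(g has_real_derivative fdrv f u ((x + s *\<^sub>R v) + r *\<^sub>R u) - fdrv f u (x + r *\<^sub>R u)) (at r)"
    if "0 \<le> r" "r \<le> s" for r
    unfolding g_def
    using S[of r s] S[of r 0] that s by (intro DERIV_diff DERIV_fdrv_line f) (auto simp: algebra_simps)
  from MVT2[OF s this] obtain a where a: "0 < a" "a < s"
    "g s - g 0 = s * (fdrv f u ((x + s *\<^sub>R v) + a *\<^sub>R u) - fdrv f u (x + a *\<^sub>R u))" by auto
  have "((\<lambda>r. fdrv f u ((x + a *\<^sub>R u) + r *\<^sub>R v)) has_real_derivative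
      fdrv (fdrv f u) v ((x + a *\<^sub>R u) + r *\<^sub>R v)) (at r)" if "0 \<le> r" "r \<le> s" for r
    using S[of a r] that a by (intro DERIV_fdrv_line df) auto
  from MVT2[OF s this] obtain b where b: "0 < b" "b < s"
    "fdrv f u ((x + a *\<^sub>R u) + s *\<^sub>R v) - fdrv f u ((x + a *\<^sub>R u) + 0 *\<^sub>R v)
      = s * fdrv (fdrv f u) v ((x + a *\<^sub>R u) + b *\<^sub>R v)" by auto
  show ?thesis
    by (intro exI[of _ a] exI[of _ b])
       (use a b in \<open>auto simp: g_def power2_eq_square algebra_simps\<close>)
qed

text \<open>The second difference is symmetric in \<open>u\<close> and \<open>v\<close>, so both
  mixed derivatives take a common value at points arbitrarily close to \<open>x\<close>; continuity
  forces them to agree at \<open>x\<close>.\<close>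

lemma fdrv_commute:
  fixes f :: "'a::real_normed_vector \<Rightarrow> real"
  assumes f: "smooth_on S f" and S: "open S" "x \<in> S"
  shows "fdrv (fdrv f u) v x = fdrv (fdrv f v) u x"
proof (rule ccontr)
  let ?A = "fdrv (fdrv f u) v" and ?B = "fdrv (fdrv f v) u"
  assume neq: "?A x \<noteq> ?B x"
  define e where "e = \<bar>?A x - ?B x\<bar> / 2"
  have e: "e > 0" using neq by (simp add: e_def)
  have "(?A \<longlongrightarrow> ?A x) (nhds x)" "(?B \<longlongrightarrow> ?B x) (nhds x)"
    using smooth_on_continuous[OF smooth_on_fdrv[OF smooth_on_fdrv[OF f]]] S
    unfolding tendsto_at_iff_tendsto_nhds[of ?A x, symmetric] tendsto_at_iff_tendsto_nhds[of ?B x, symmetric]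
    by (auto simp: continuous_on_eq_continuous_at isCont_def)
  then have "\<forall>\<^sub>F y in nhds x. dist (?A y) (?A x) < e \<and> dist (?B y) (?B x) < e \<and> y \<in> S"
    using e S by (intro eventually_conj eventually_nhds_in_open) (auto dest: tendstoD)
  then obtain d where d: "d > 0"
    "\<And>y. dist y x < d \<Longrightarrow> dist (?A y) (?A x) < e \<and> dist (?B y) (?B x) < e \<and> y \<in> S"
    by (auto simp: eventually_nhds_metric)
  \<comment> \<open>Keeps the parallelogram spanned by \<open>s *\<^sub>R u\<close> and
    \<open>s *\<^sub>R v\<close> inside the ball of radius \<open>d\<close> around
    \<open>x\<close>.\<close>
  define s where "s = d / (2 * (norm u + norm v + 1))"
  have s: "s > 0" using d(1) by (auto simp: s_def intro!: divide_pos_pos add_nonneg_pos)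
  have near: "dist (x + a *\<^sub>R u + b *\<^sub>R v) x < d" if "0 \<le> a" "a \<le> s" "0 \<le> b" "b \<le> s" for a b
  proof -
    have "dist (x + a *\<^sub>R u + b *\<^sub>R v) x \<le> a * norm u + b * norm v"
      using norm_triangle_ineq[of "a *\<^sub>R u" "b *\<^sub>R v"] that by (simp add: dist_norm add.assoc)
    also have "\<dots> \<le> s * norm u + s * norm v" using that by (intro add_mono mult_right_mono) auto
    also have "\<dots> < s * (2 * (norm u + norm v + 1))"
      using s by (simp add: algebra_simps) (smt (verit) mult_nonneg_nonneg norm_ge_zero)
    also have "\<dots> = d" by (simp add: s_def add_nonneg_pos[THEN less_imp_neq, symmetric])
    finally show ?thesis .
  qed
  have inS: "x + a *\<^sub>R u + b *\<^sub>R v \<in> S" if "0 \<le> a" "a \<le> s" "0 \<le> b" "b \<le> s" for a b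
    using d(2) near[OF that] by blast
  have inS': "x + a *\<^sub>R v + b *\<^sub>R u \<in> S" if "0 \<le> a" "a \<le> s" "0 \<le> b" "b \<le> s" for a b
    using inS[of b a] that by (simp add: add_ac)
  note diff = smooth_on_differentiable[OF f] smooth_on_differentiable[OF smooth_on_fdrv[OF f]]
  obtain a b where ab: "0 \<le> a" "a \<le> s" "0 \<le> b" "b \<le> s"
    "f (x + s *\<^sub>R u + s *\<^sub>R v) - f (x + s *\<^sub>R u) - f (x + s *\<^sub>R v) + f x = s\<^sup>2 * ?A (x + a *\<^sub>R u + b *\<^sub>R v)"
    using second_difference_mvt[of s x u v S f, OF s _ diff] inS by blast
  obtain a' b' where ab': "0 \<le> a'" "a' \<le> s" "0 \<le> b'" "b' \<le> s"
    "f (x + s *\<^sub>R v + s *\<^sub>R u) - f (x + s *\<^sub>R v) - f (x + s *\<^sub>R u) + f x = s\<^sup>2 * ?B (x + a' *\<^sub>R v + b' *\<^sub>R u)"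
    using second_difference_mvt[of s x v u S f, OF s _ diff] inS' by blast
  have "s\<^sup>2 * ?A (x + a *\<^sub>R u + b *\<^sub>R v) = s\<^sup>2 * ?B (x + b' *\<^sub>R u + a' *\<^sub>R v)"
    unfolding ab(5)[symmetric] using ab'(5) by (simp add: algebra_simps)
  then have "?A (x + a *\<^sub>R u + b *\<^sub>R v) = ?B (x + b' *\<^sub>R u + a' *\<^sub>R v)" using s by simp
  moreover have "dist (?A (x + a *\<^sub>R u + b *\<^sub>R v)) (?A x) < e" using d(2) near ab by blast
  moreover have "dist (?B (x + b' *\<^sub>R u + a' *\<^sub>R v)) (?B x) < e" using d(2) near ab' by blast
  ultimately have "\<bar>?A x - ?B x\<bar> < e + e" unfolding dist_real_def by linarith
  then show False by (simp add: e_def)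
qed

section \<open>Space and time derivatives of a smooth family on space-time\<close>

locale smooth_family =
  fixes \<phi>t :: "real \<Rightarrow> real^'n::finite \<Rightarrow> real" and \<epsilon> :: real
  assumes \<epsilon>: "\<epsilon> > 0" and smooth: "smooth_on ({-\<epsilon><..<\<epsilon>} \<times> UNIV) (\<lambda>(t, x). \<phi>t t x)"
begin

abbreviation S :: "(real \<times> (real^'n)) set" where "S \<equiv> {-\<epsilon><..<\<epsilon>} \<times> UNIV"

abbreviation dt :: "(real \<times> (real^'n) \<Rightarrow> real) \<Rightarrow> real \<times> (real^'n) \<Rightarrow> real" where
  "dt \<Psi> \<equiv> fdrv \<Psi> (1, 0)"

abbreviation dx :: "'n \<Rightarrow> (real \<times> (real^'n) \<Rightarrow> real) \<Rightarrow> real \<times> (real^'n) \<Rightarrow> real" where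
  "dx i \<Psi> \<equiv> fdrv \<Psi> (0, axis i 1)"

text \<open>Iterated \<open>t\<close>-derivatives, formed as Frechet derivatives on the open
  space-time domain, so that time and space derivatives commute by
  \<open>fdrv_commute\<close>.\<close>

primrec \<Phi> :: "nat \<Rightarrow> real \<times> (real^'n) \<Rightarrow> real" where
  "\<Phi> 0 = (\<lambda>(t, x). \<phi>t t x)"
| "\<Phi> (Suc m) = dt (\<Phi> m)"

declare \<Phi>.simps(2) [simp del]

lemmas \<Phi>_Suc = \<Phi>.simps(2)

lemma open_S: "open S" by (intro open_Times open_greaterThanLessThan open_UNIV)

lemma smooth_\<Phi>: "smooth_on S (\<Phi> m)"
proof (induction m)
  case 0
  show ?case using smooth by simp
next
  case (Suc m)
  then show ?case unfolding \<Phi>_Suc by (rule smooth_on_fdrv)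
qed

lemma slice_in_S: "\<bar>t\<bar> < \<epsilon> \<Longrightarrow> (t, x) \<in> S"
  by (simp add: abs_less_iff)

lemma DERIV_dt:
  assumes \<Psi>: "smooth_on S \<Psi>" and t: "\<bar>t\<bar> < \<epsilon>"
  shows "((\<lambda>s. \<Psi> (s, x)) has_real_derivative dt \<Psi> (t, x)) (at t)"
proof -
  have eq: "(0, x) + s *\<^sub>R (1, 0) = (s, x)" for s :: real by simp
  have "\<Psi> differentiable (at ((0, x) + t *\<^sub>R (1, 0)))"
    unfolding eq by (rule smooth_on_differentiable[OF \<Psi> slice_in_S[OF t]])
  from DERIV_fdrv_line[OF this] show ?thesis unfolding eq .
qed

lemma DERIV_dx:
  assumes \<Psi>: "smooth_on S \<Psi>" and t: "\<bar>t\<bar> < \<epsilon>"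
  shows "((\<lambda>s. \<Psi> (t, x + s *\<^sub>R axis i 1)) has_real_derivative dx i \<Psi> (t, x)) (at 0)"
proof -
  have eq: "(t, x) + s *\<^sub>R (0, axis i 1) = (t, x + s *\<^sub>R axis i 1)" for s by simp
  have "\<Psi> differentiable (at ((t, x) + 0 *\<^sub>R (0, axis i 1)))"
    unfolding eq using smooth_on_differentiable[OF \<Psi> slice_in_S[OF t]] by simp
  from DERIV_fdrv_line[OF this] show ?thesis unfolding eq by simp
qed

lemma has_derivative_slice:
  assumes "smooth_on S \<Psi>" "\<bar>t\<bar> < \<epsilon>"
  shows "((\<lambda>x. \<Psi> (t, x)) has_derivative (\<lambda>h. (\<chi> i. dx i \<Psi> (t, x)) \<bullet> h)) (at x)"
proof -
  have D: "(\<Psi> has_derivative (\<lambda>h. fdrv \<Psi> h (t, x))) (at (t, x))"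
    by (rule has_derivative_fdrv[OF smooth_on_differentiable[OF assms(1) slice_in_S[OF assms(2)]]])
  interpret linear "\<lambda>h. fdrv \<Psi> h (t, x)" using has_derivative_linear[OF D] .
  have eq: "fdrv \<Psi> (0, h) (t, x) = (\<chi> i. dx i \<Psi> (t, x)) \<bullet> h" for h
  proof -
    have "(0, h) = (\<Sum>i\<in>UNIV. (h $ i) *\<^sub>R (0 :: real, axis i 1 :: real^'n))"
      using basis_expansion[of h] by (simp add: prod_eq_iff fst_sum snd_sum scalar_mult_eq_scaleR)
    then have "fdrv \<Psi> (0, h) (t, x) = (\<Sum>i\<in>UNIV. (h $ i) * dx i \<Psi> (t, x))"
      by (simp only: sum scale real_scaleR_def)
    then show ?thesis by (simp add: inner_vec_def mult.commute)
  qed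
  have "((\<lambda>x. \<Psi> (t, x)) has_derivative (\<lambda>h. fdrv \<Psi> (0, h) (t, x))) (at x)"
    by (rule has_derivative_compose[where f = "\<lambda>x. (t, x)" and g = \<Psi>, OF _ D])
       (auto intro!: derivative_eq_intros)
  from has_derivative_eq_rhs[OF this ext[OF eq]] show ?thesis .
qed

lemma partial_slice:
  assumes "smooth_on S \<Psi>" "\<bar>t\<bar> < \<epsilon>"
  shows "partial i (\<lambda>x. \<Psi> (t, x)) = (\<lambda>x. dx i \<Psi> (t, x))"
proof
  fix x
  show "partial i (\<lambda>x. \<Psi> (t, x)) x = dx i \<Psi> (t, x)"
    unfolding partial_def frechet_derivative_at[OF has_derivative_slice[OF assms, of x], symmetric]
    by (simp add: inner_axis)
qed

lemma continuous_slice: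
  assumes "smooth_on S \<Psi>" "\<bar>t\<bar> < \<epsilon>"
  shows "continuous_on UNIV (\<lambda>x. \<Psi> (t, x))"
  by (rule continuous_on_compose2[OF smooth_on_continuous[OF assms(1)]])
     (use assms(2) in \<open>auto intro!: continuous_intros\<close>)

text \<open>The two iterated derivatives are compared only for |t| < \<epsilon>, so the induction
  step works with equality on a neighbourhood of \<open>t\<close>.\<close>

lemma t_deriv_eq: "\<bar>t\<bar> < \<epsilon> \<Longrightarrow> t_deriv m \<phi>t t x = \<Phi> m (t, x)"
  unfolding t_deriv_def
proof (induction m arbitrary: t)
  case 0
  show ?case by simp
next
  case (Suc m)
  have "\<forall>\<^sub>F s in nhds t. s \<in> {-\<epsilon><..<\<epsilon>}"
    using Suc.prems by (intro eventually_nhds_in_open) (simp_all add: abs_less_iff)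
  then have "\<forall>\<^sub>F s in nhds t. (deriv ^^ m) (\<lambda>s. \<phi>t s x) s = \<Phi> m (s, x)"
    by eventually_elim (auto intro!: Suc.IH)
  then have "deriv ((deriv ^^ m) (\<lambda>s. \<phi>t s x)) t = deriv (\<lambda>s. \<Phi> m (s, x)) t"
    by (rule deriv_cong_ev) simp
  also have "\<dots> = \<Phi> (Suc m) (t, x)"
    unfolding \<Phi>_Suc by (intro DERIV_imp_deriv DERIV_dt smooth_\<Phi> Suc.prems)
  finally show ?case by simp
qed

lemma t_deriv_slice: "\<bar>t\<bar> < \<epsilon> \<Longrightarrow> t_deriv m \<phi>t t = (\<lambda>x. \<Phi> m (t, x))"
  by (rule ext) (rule t_deriv_eq)

lemma grad_slice:
  assumes t: "\<bar>t\<bar> < \<epsilon>"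
  shows "grad (t_deriv m \<phi>t t) x $ i = dx i (\<Phi> m) (t, x)"
  unfolding grad_def t_deriv_slice[OF t] partial_slice[OF smooth_\<Phi> t] by (rule vec_lambda_beta)

lemma hess_slice:
  assumes t: "\<bar>t\<bar> < \<epsilon>"
  shows "hess (t_deriv m \<phi>t t) x $ i $ j = dx i (dx j (\<Phi> m)) (t, x)"
  unfolding hess_def t_deriv_slice[OF t] partial_slice[OF smooth_\<Phi> t]
    partial_slice[OF smooth_on_fdrv[OF smooth_\<Phi>] t] vec_lambda_beta by (rule refl)

lemma commute:
  fixes \<Psi> :: "real \<times> (real^'n) \<Rightarrow> real"
  assumes "smooth_on S \<Psi>" "\<bar>t\<bar> < \<epsilon>"
  shows "fdrv (fdrv \<Psi> u) v (t, x) = fdrv (fdrv \<Psi> v) u (t, x)"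
proof (rule fdrv_commute[OF assms(1) open_S])
  show "(t, x) \<in> S" by (rule slice_in_S[OF assms(2)])
qed

lemma t_deriv_0: "t_deriv 0 \<phi>t = \<phi>t"
  unfolding t_deriv_def by (intro ext) simp

end

section \<open>The Gaussian Poincare inequality with equality case\<close>

lemma lborel_prod_integrable:
  fixes u :: "'a::euclidean_space \<Rightarrow> real" and v :: "'b::euclidean_space \<Rightarrow> real"
  assumes u: "integrable lborel u" and v: "integrable lborel v"
  shows "integrable lborel (\<lambda>z. u (fst z) * v (snd z))"
    and "(LINT z|lborel. u (fst z) * v (snd z)) = (LINT x|lborel. u x) * (LINT y|lborel. v y)"
proof -
  have [measurable]: "u \<in> borel_measurable borel" "v \<in> borel_measurable borel"
    using borel_measurable_integrable[OF u] borel_measurable_integrable[OF v] by simp_all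
  have *: "integrable (lborel \<Otimes>\<^sub>M lborel) (\<lambda>z. u (fst z) * v (snd z))"
  proof (rule lborel_pair.Fubini_integrable)
    have "(\<lambda>x. LINT y|lborel. norm (u (fst (x, y)) * v (snd (x, y)))) = (\<lambda>x. \<bar>u x\<bar> * (LINT y|lborel. \<bar>v y\<bar>))"
      by (auto simp: abs_mult)
    then show "integrable lborel (\<lambda>x. LINT y|lborel. norm (u (fst (x, y)) * v (snd (x, y))))"
      using u by simp
  qed (use v in auto)
  then show "integrable lborel (\<lambda>z. u (fst z) * v (snd z))" by (simp add: lborel_prod)
  show "(LINT z|lborel. u (fst z) * v (snd z)) = (LINT x|lborel. u x) * (LINT y|lborel. v y)"
    using lborel_pair.integral_fst'[OF *] by (simp add: lborel_prod)
qed

text \<open>With \<open>c = cos t\<close> and \<open>s = sin t\<close> this mixes two independent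
  copies of the variable. Averaging a function of the first component over the second copy is
  Mehler's formula for the Ornstein-Uhlenbeck semigroup, with cos t as the decay factor.\<close>

definition rot :: "real \<Rightarrow> real \<Rightarrow> 'a \<times> 'a \<Rightarrow> 'a \<times> 'a::real_vector" where
  "rot c s z = (c *\<^sub>R fst z + s *\<^sub>R snd z, c *\<^sub>R snd z - s *\<^sub>R fst z)"

lemma measurable_shear [measurable]:
  "(\<lambda>z. (fst z + a *\<^sub>R snd z, snd z)) \<in> borel \<rightarrow>\<^sub>M (borel :: ('a::euclidean_space \<times> 'a) measure)"
  "(\<lambda>z. (fst z, snd z + a *\<^sub>R fst z)) \<in> borel \<rightarrow>\<^sub>M (borel :: ('a::euclidean_space \<times> 'a) measure)"
  by (intro borel_measurable_continuous_onI continuous_intros)+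

lemma nn_integral_lborel_translate:
  fixes c :: "'a::euclidean_space"
  assumes [measurable]: "h \<in> borel_measurable borel"
  shows "(\<integral>\<^sup>+x. h (x + c) \<partial>lborel) = (\<integral>\<^sup>+x. h x \<partial>lborel)"
proof -
  have "(\<integral>\<^sup>+x. h x \<partial>lborel) = (\<integral>\<^sup>+x. h x \<partial>distr lborel borel ((+) c))"
    unfolding lborel_distr_plus ..
  also have "\<dots> = (\<integral>\<^sup>+x. h (x + c) \<partial>lborel)"
    by (subst nn_integral_distr) (auto simp: add.commute)
  finally show ?thesis by simp
qed

lemma nn_integral_shear:
  fixes h :: "'a::euclidean_space \<times> 'a \<Rightarrow> ennreal"
  assumes [measurable]: "h \<in> borel_measurable borel"
  shows "(\<integral>\<^sup>+z. h (fst z + a *\<^sub>R snd z, snd z) \<partial>lborel) = (\<integral>\<^sup>+z. h z \<partial>lborel)"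
    and "(\<integral>\<^sup>+z. h (fst z, snd z + a *\<^sub>R fst z) \<partial>lborel) = (\<integral>\<^sup>+z. h z \<partial>lborel)"
proof -
  have [measurable]: "h \<in> borel_measurable (borel \<Otimes>\<^sub>M borel)" by (simp add: borel_prod)
  have hx: "(\<lambda>x. h (x, y)) \<in> borel_measurable borel" "(\<lambda>x. h (y, x)) \<in> borel_measurable borel" for y
    by measurable
  have "(\<integral>\<^sup>+z. h (fst z + a *\<^sub>R snd z, snd z) \<partial>(lborel \<Otimes>\<^sub>M lborel))
      = (\<integral>\<^sup>+y. \<integral>\<^sup>+x. h (x + a *\<^sub>R y, y) \<partial>lborel \<partial>lborel)"
    by (subst lborel_pair.nn_integral_snd[symmetric]) (auto simp: case_prod_beta')
  also have "\<dots> = (\<integral>\<^sup>+y. \<integral>\<^sup>+x. h (x, y) \<partial>lborel \<partial>lborel)"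
    by (simp add: nn_integral_lborel_translate[OF hx(1)])
  also have "\<dots> = (\<integral>\<^sup>+z. h z \<partial>(lborel \<Otimes>\<^sub>M lborel))"
    by (subst lborel_pair.nn_integral_snd) auto
  finally show "(\<integral>\<^sup>+z. h (fst z + a *\<^sub>R snd z, snd z) \<partial>lborel) = (\<integral>\<^sup>+z. h z \<partial>lborel)"
    by (simp add: lborel_prod)
  have "(\<integral>\<^sup>+z. h (fst z, snd z + a *\<^sub>R fst z) \<partial>(lborel \<Otimes>\<^sub>M lborel))
      = (\<integral>\<^sup>+x. \<integral>\<^sup>+y. h (x, y + a *\<^sub>R x) \<partial>lborel \<partial>lborel)"
    by (subst lborel.nn_integral_fst[symmetric]) (auto simp: case_prod_beta')
  also have "\<dots> = (\<integral>\<^sup>+x. \<integral>\<^sup>+y. h (x, y) \<partial>lborel \<partial>lborel)"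
    by (simp add: nn_integral_lborel_translate[OF hx(2)])
  also have "\<dots> = (\<integral>\<^sup>+z. h z \<partial>(lborel \<Otimes>\<^sub>M lborel))"
    by (subst lborel.nn_integral_fst) auto
  finally show "(\<integral>\<^sup>+z. h (fst z, snd z + a *\<^sub>R fst z) \<partial>lborel) = (\<integral>\<^sup>+z. h z \<partial>lborel)"
    by (simp add: lborel_prod)
qed

lemma measurable_rot [measurable]: "rot c s \<in> borel \<rightarrow>\<^sub>M (borel :: ('a::euclidean_space \<times> 'a) measure)"
  unfolding rot_def by (intro borel_measurable_continuous_onI continuous_intros)

text \<open>A rotation is a product of three shears, each of which preserves Lebesgue measure by Fubini.\<close>

lemma distr_rot:
  fixes c s :: real
  assumes cs: "c\<^sup>2 + s\<^sup>2 = 1" "s \<noteq> 0"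
  shows "distr lborel borel (rot c s) = (lborel :: ('a::euclidean_space \<times> 'a) measure)"
proof (rule measure_eqI)
  fix A :: "('a \<times> 'a) set" assume "A \<in> sets (distr lborel borel (rot c s))"
  then have [measurable]: "A \<in> sets borel" by simp
  \<comment> \<open>The tangent of half the angle: the rotation is the shear by \<open>a\<close>,
    then by \<open>- s\<close>, then by \<open>a\<close> again. The division by \<open>s\<close>
    excludes the angle 0.\<close>
  define a where "a = (1 - c) / s"
  define S1 :: "'a \<times> 'a \<Rightarrow> 'a \<times> 'a" where "S1 z = (fst z + a *\<^sub>R snd z, snd z)" for z
  define S2 :: "'a \<times> 'a \<Rightarrow> 'a \<times> 'a" where "S2 z = (fst z, snd z + (- s) *\<^sub>R fst z)" for z
  have [measurable]: "S1 \<in> borel \<rightarrow>\<^sub>M borel" "S2 \<in> borel \<rightarrow>\<^sub>M borel"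
    unfolding S1_def S2_def by measurable
  have 1: "1 - a * s = c" using cs by (simp add: a_def)
  have "a * (1 + c) = s"
  proof -
    have "(1 - c) * (1 + c) = s * s" using cs by (simp add: power2_eq_square algebra_simps)
    then show ?thesis using cs(2) by (simp add: a_def field_simps)
  qed
  then have 2: "a + a * c = s" by (simp add: algebra_simps)
  have rot: "rot c s z = S1 (S2 (S1 z))" for z
  proof -
    have A: "snd z - s *\<^sub>R (fst z + a *\<^sub>R snd z) = c *\<^sub>R snd z - s *\<^sub>R fst z"
      unfolding 1[symmetric] by (simp add: algebra_simps)
    have "fst z + a *\<^sub>R snd z + a *\<^sub>R (c *\<^sub>R snd z - s *\<^sub>R fst z) = (1 - a * s) *\<^sub>R fst z + (a + a * c) *\<^sub>R snd z"
      by (simp add: algebra_simps)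
    then have B: "fst z + a *\<^sub>R snd z + a *\<^sub>R (c *\<^sub>R snd z - s *\<^sub>R fst z) = c *\<^sub>R fst z + s *\<^sub>R snd z"
      unfolding 1 2 .
    show ?thesis using A B by (simp add: rot_def S1_def S2_def)
  qed
  have "emeasure (distr lborel borel (rot c s)) A = (\<integral>\<^sup>+z. indicator A (rot c s z) \<partial>lborel)"
    by (subst nn_integral_indicator[symmetric], simp, subst nn_integral_distr) auto
  also have "\<dots> = (\<integral>\<^sup>+z. indicator A (S1 (S2 (S1 z))) \<partial>lborel)" by (simp add: rot)
  also have "\<dots> = (\<integral>\<^sup>+z. indicator A (S1 (S2 z)) \<partial>lborel)"
    using nn_integral_shear(1)[of "\<lambda>z. indicator A (S1 (S2 z))" a] by (simp add: S1_def[symmetric])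
  also have "\<dots> = (\<integral>\<^sup>+z. indicator A (S1 z) \<partial>lborel)"
    using nn_integral_shear(2)[of "\<lambda>z. indicator A (S1 z)" "- s"] by (simp add: S2_def)
  also have "\<dots> = (\<integral>\<^sup>+z. indicator A z \<partial>lborel)"
    using nn_integral_shear(1)[of "\<lambda>z. indicator A z" a] by (simp add: S1_def)
  finally show "emeasure (distr lborel borel (rot c s)) A = emeasure lborel A" by simp
qed simp

lemma integral_rot:
  fixes h :: "'a::euclidean_space \<times> 'a \<Rightarrow> real"
  assumes cs: "c\<^sup>2 + s\<^sup>2 = 1" "s \<noteq> 0" and [measurable]: "h \<in> borel_measurable borel"
  shows "(LINT z|lborel. h (rot c s z)) = (LINT z|lborel. h z)"
    and "integrable lborel (\<lambda>z. h (rot c s z)) \<longleftrightarrow> integrable lborel h"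
proof -
  show "(LINT z|lborel. h (rot c s z)) = (LINT z|lborel. h z)"
    using integral_distr[of "rot c s" lborel borel h] by (simp add: distr_rot[OF cs])
  show "integrable lborel (\<lambda>z. h (rot c s z)) \<longleftrightarrow> integrable lborel h"
    using integrable_distr_eq[of "rot c s" lborel borel h] by (simp add: distr_rot[OF cs])
qed

section \<open>Interpolation between two independent Gaussian copies\<close>

definition gker :: "real \<Rightarrow> 'a::real_inner \<Rightarrow> real" where
  "gker \<tau> x = exp (- (x \<bullet> x) / (4 * \<tau>))"

lemma abs_mult_le_sum_squares: "\<bar>a * b\<bar> \<le> a\<^sup>2 + b\<^sup>2" for a b :: real
proof -
  have "\<bar>a\<bar> * \<bar>b\<bar> \<le> 2 * \<bar>a\<bar> * \<bar>b\<bar>" by simp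
  also have "\<dots> \<le> \<bar>a\<bar>\<^sup>2 + \<bar>b\<bar>\<^sup>2" by (rule sum_squares_bound)
  finally show ?thesis by (simp add: abs_mult)
qed

lemma gker_pos: "gker \<tau> x > 0"
  by (simp add: gker_def)

lemma continuous_on_gker [continuous_intros]:
  "continuous_on S f \<Longrightarrow> continuous_on S (\<lambda>x. gker \<tau> (f x))"
  unfolding gker_def by (cases "\<tau> = 0") (auto intro!: continuous_intros)

text \<open>The weight is centred but not normalised, so the total mass appears as a factor
  throughout. The second moment \<open>iw_x\<close> and \<open>iw_g\<close> together make the
  product of |g(x)| and |y| square integrable for the product weight.\<close>

locale gaussian_poincare =
  fixes f :: "'a::euclidean_space \<Rightarrow> real" and g :: "'a \<Rightarrow> 'a" and \<tau> :: real
  assumes \<tau>: "\<tau> > 0"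
    and df: "\<And>x. (f has_derivative (\<lambda>h. g x \<bullet> h)) (at x)"
    and cg: "continuous_on UNIV g"
    and iw: "integrable lborel (gker \<tau> :: 'a \<Rightarrow> real)"
    and iw_f: "integrable lborel (\<lambda>x. (f x)\<^sup>2 * gker \<tau> x)"
    and iw_g: "integrable lborel (\<lambda>x. (norm (g x))\<^sup>2 * gker \<tau> x)"
    and iw_x: "integrable lborel (\<lambda>x::'a. (norm x)\<^sup>2 * gker \<tau> x)"
begin

definition W :: "'a \<times> 'a \<Rightarrow> real" where "W z = gker \<tau> (fst z) * gker \<tau> (snd z)"

lemma W_pos: "W z > 0" by (simp add: W_def gker_pos)

lemma continuous_on_fg [continuous_intros]:
  "continuous_on S h \<Longrightarrow> continuous_on S (\<lambda>x. f (h x))"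
  "continuous_on S h \<Longrightarrow> continuous_on S (\<lambda>x. g (h x))"
  for S :: "'b::topological_space set"
proof -
  have "continuous_on UNIV f"
    using has_derivative_continuous[OF df] by (simp add: continuous_on_eq_continuous_at)
  then show "continuous_on S h \<Longrightarrow> continuous_on S (\<lambda>x. f (h x))"
    by (rule continuous_on_compose2) auto
  show "continuous_on S h \<Longrightarrow> continuous_on S (\<lambda>x. g (h x))"
    by (rule continuous_on_compose2[OF cg]) auto
qed

lemma continuous_on_W [continuous_intros]:
  "continuous_on S h \<Longrightarrow> continuous_on S (\<lambda>x. W (h x))" for S :: "'b::topological_space set"
  unfolding W_def by (intro continuous_intros)

lemma continuous_on_rot [continuous_intros]:
  "continuous_on S c \<Longrightarrow> continuous_on S s \<Longrightarrow> continuous_on S h \<Longrightarrow> continuous_on S (\<lambda>x. rot (c x) (s x) (h x :: 'a \<times> 'a))"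
  for S :: "'b::topological_space set"
  unfolding rot_def by (intro continuous_intros)

lemma W_rot: "c\<^sup>2 + s\<^sup>2 = 1 \<Longrightarrow> W (rot c s z) = W z"
proof -
  assume cs: "c\<^sup>2 + s\<^sup>2 = 1"
  have "fst (rot c s z) \<bullet> fst (rot c s z) + snd (rot c s z) \<bullet> snd (rot c s z)
      = (c\<^sup>2 + s\<^sup>2) * (fst z \<bullet> fst z + snd z \<bullet> snd z)"
    by (simp add: rot_def inner_simps power2_eq_square algebra_simps inner_commute)
  moreover have "W y = exp (- (fst y \<bullet> fst y + snd y \<bullet> snd y) / (4 * \<tau>))" for y
    by (simp add: W_def gker_def mult_exp_exp add_divide_distrib diff_divide_distrib)
  ultimately show ?thesis by (simp add: cs)
qed

lemma measI: "continuous_on UNIV h \<Longrightarrow> h \<in> borel_measurable lborel" for h :: "'b::euclidean_space \<Rightarrow> real"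
  using borel_measurable_continuous_onI by simp

lemma integrable_W:
  "integrable lborel W"
  "integrable lborel (\<lambda>z. (f (fst z))\<^sup>2 * W z)"
  "integrable lborel (\<lambda>z. (norm (g (fst z)))\<^sup>2 * W z)"
  "integrable lborel (\<lambda>z. (norm (g (fst z)))\<^sup>2 * (norm (snd z))\<^sup>2 * W z)"
  "(LINT z|lborel. (f (fst z))\<^sup>2 * W z) = (LINT x|lborel. (f x)\<^sup>2 * gker \<tau> x) * (LINT x|lborel. gker \<tau> (x::'a))"
  "(LINT z|lborel. (norm (g (fst z)))\<^sup>2 * W z) = (LINT x|lborel. (norm (g x))\<^sup>2 * gker \<tau> x) * (LINT x|lborel. gker \<tau> (x::'a))"
  using lborel_prod_integrable[OF iw iw] lborel_prod_integrable[OF iw_f iw]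
    lborel_prod_integrable[OF iw_g iw] lborel_prod_integrable[OF iw_g iw_x]
  by (simp_all add: W_def[abs_def] mult_ac)

lemma integrable_rot_W:
  assumes cs: "c\<^sup>2 + s\<^sup>2 = 1" "s \<noteq> 0" and h: "continuous_on UNIV h"
  shows "integrable lborel (\<lambda>z. h (rot c s z) * W z) \<longleftrightarrow> integrable lborel (\<lambda>z. h z * W z)"
    and "(LINT z|lborel. h (rot c s z) * W z) = (LINT z|lborel. h z * W z)"
proof -
  have "continuous_on UNIV (\<lambda>z. h z * W z)" by (intro continuous_intros h)
  from integral_rot[OF cs borel_measurable_continuous_onI[OF this]]
  show "integrable lborel (\<lambda>z. h (rot c s z) * W z) \<longleftrightarrow> integrable lborel (\<lambda>z. h z * W z)"
    and "(LINT z|lborel. h (rot c s z) * W z) = (LINT z|lborel. h z * W z)"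
    by (simp_all only: W_rot[OF cs(1)])
qed

text \<open>For \<open>E(t) = \<integral>\<integral> f(x) f(x cos t + y sin t)\<close> with Gaussian weights, \<open>E(0) = (\<integral> 1) (\<integral> f\<^sup>2)\<close> and
  \<open>E(\<pi>/2) = (\<integral> f)\<^sup>2\<close>. The integrand of \<open>E'(t)\<close> is \<open>K t\<close>; rotating back and integrating by parts in
  the second variable turns \<open>E'(t)\<close> into \<open>- 2\<tau> sin t \<integral>\<integral> \<nabla>f(x cos t - y sin t) \<bullet> \<nabla>f(x)\<close>.\<close>

definition K :: "real \<Rightarrow> 'a \<times> 'a \<Rightarrow> real" where
  "K t z = f (fst z) * (g (fst (rot (cos t) (sin t) z)) \<bullet> snd (rot (cos t) (sin t) z)) * W z"

lemma continuous_K: "continuous_on UNIV (\<lambda>p. K (fst p) (snd p))"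
  unfolding K_def by (intro continuous_intros)

lemma abs_inner_le: "\<bar>a * (x \<bullet> y)\<bar> \<le> a\<^sup>2 + (norm x)\<^sup>2 * (norm y)\<^sup>2" for x y :: 'a
proof -
  have "\<bar>a * (x \<bullet> y)\<bar> \<le> \<bar>a\<bar> * (norm x * norm y)"
    unfolding abs_mult by (intro mult_left_mono Cauchy_Schwarz_ineq2) auto
  also have "\<dots> \<le> \<bar>a\<bar>\<^sup>2 + (norm x * norm y)\<^sup>2"
    using abs_mult_le_sum_squares[of "\<bar>a\<bar>" "norm x * norm y"] by (simp add: abs_mult)
  finally show ?thesis by (simp add: power_mult_distrib)
qed

lemma K_bound: "\<bar>K t z\<bar> \<le> ((f (fst z))\<^sup>2 + (norm (g (fst (rot (cos t) (sin t) z))))\<^sup>2 * (norm (snd (rot (cos t) (sin t) z)))\<^sup>2) * W z"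
  unfolding K_def abs_mult[of _ "W z"] abs_of_pos[OF W_pos]
  by (intro mult_right_mono abs_inner_le) (simp add: less_imp_le W_pos)

text \<open>The second conclusion bounds the L1 norm uniformly in \<open>t\<close>, because
  rotations preserve the product weight. Fubini over the compact interval of angles relies on
  this.\<close>

lemma integrable_K:
  assumes s: "sin t \<noteq> 0"
  shows "integrable lborel (K t)"
    and "(LINT z|lborel. \<bar>K t z\<bar>) \<le> (LINT z|lborel. (f (fst z))\<^sup>2 * W z) + (LINT z|lborel. (norm (g (fst z)))\<^sup>2 * (norm (snd z))\<^sup>2 * W z)"
proof -
  have cs: "(cos t)\<^sup>2 + (sin t)\<^sup>2 = 1" by simp
  let ?b = "\<lambda>z. (norm (g (fst z)))\<^sup>2 * (norm (snd z))\<^sup>2"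
  have cb: "continuous_on UNIV ?b" by (intro continuous_intros)
  have i2: "integrable lborel (\<lambda>z. ?b (rot (cos t) (sin t) z) * W z)"
    using integrable_rot_W(1)[OF cs s cb] integrable_W(4) by simp
  have i12: "integrable lborel (\<lambda>z. (f (fst z))\<^sup>2 * W z + ?b (rot (cos t) (sin t) z) * W z)"
    by (intro Bochner_Integration.integrable_add integrable_W i2)
  have K: "\<bar>K t z\<bar> \<le> (f (fst z))\<^sup>2 * W z + ?b (rot (cos t) (sin t) z) * W z" for z
    using K_bound[of t z] by (simp add: algebra_simps)
  have "continuous_on UNIV (K t)"
    unfolding K_def by (intro continuous_intros)
  then show KI: "integrable lborel (K t)"
    using K order_trans[OF K abs_ge_self]
    by (intro Bochner_Integration.integrable_bound[OF i12] measI) auto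
  have "(LINT z|lborel. \<bar>K t z\<bar>) \<le> (LINT z|lborel. (f (fst z))\<^sup>2 * W z + ?b (rot (cos t) (sin t) z) * W z)"
    using KI i12 K by (intro integral_mono) auto
  also have "\<dots> = (LINT z|lborel. (f (fst z))\<^sup>2 * W z) + (LINT z|lborel. ?b (rot (cos t) (sin t) z) * W z)"
    by (intro Bochner_Integration.integral_add integrable_W i2)
  also have "(LINT z|lborel. ?b (rot (cos t) (sin t) z) * W z) = (LINT z|lborel. ?b z * W z)"
    by (rule integrable_rot_W(2)[OF cs s cb])
  finally show "(LINT z|lborel. \<bar>K t z\<bar>) \<le> (LINT z|lborel. (f (fst z))\<^sup>2 * W z) + (LINT z|lborel. ?b z * W z)" .
qed

text \<open>The polarisation remainder: replacing the product of the gradient at two correlated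
  points by the squared gradient at one point costs \<open>B t / 2\<close>. Its sign gives the
  inequality and its vanishing the equality case.\<close>

definition B :: "real \<Rightarrow> real" where
  "B t = (LINT z|lborel. (norm (g (cos t *\<^sub>R fst z - sin t *\<^sub>R snd z) - g (fst z)))\<^sup>2 * W z)"

lemma gker_DERIV:
  "((\<lambda>r. gker \<tau> (y + r *\<^sub>R i)) has_real_derivative - (y \<bullet> i) / (2 * \<tau>) * gker \<tau> y) (at 0)" for y i :: 'a
  unfolding gker_def using \<tau>
  by (auto intro!: derivative_eq_intros simp: inner_simps field_simps inner_commute)

lemma f_DERIV_line: "((\<lambda>r. f (x + r *\<^sub>R i)) has_real_derivative g x \<bullet> i) (at 0)"
proof -
  have "((\<lambda>r. f (x + r *\<^sub>R i)) has_derivative (\<lambda>h. g x \<bullet> (h *\<^sub>R i))) (at 0)"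
    by (rule has_derivative_compose[where f = "\<lambda>r. x + r *\<^sub>R i" and g = f])
       (auto intro!: derivative_eq_intros simp: df)
  then show ?thesis
    by (rule has_derivative_imp_has_field_derivative) simp
qed

text \<open>With u = x cos t - y sin t, the function f(u) g_i(x) W is differentiated in y_i. The
  factor g_i(x) is constant in y, so the derivative falls on f(u), with factor - sin t, and on the
  weight, with factor - y_i / (2 \<tau>): no second derivative of \<open>f\<close> appears.
  Polarisation introduces \<open>B t\<close>.\<close>

lemma integral_K:
  assumes s: "sin t \<noteq> 0"
  shows "(LINT z|lborel. K t z) = - 2 * \<tau> * sin t *
     ((LINT x|lborel. (norm (g x))\<^sup>2 * gker \<tau> x) * (LINT x|lborel. gker \<tau> (x::'a)) - B t / 2)"
proof -
  define c' s' where "c' = cos t" and "s' = sin t"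
  have cs: "c'\<^sup>2 + s'\<^sup>2 = 1" "s' \<noteq> 0" and cs': "c'\<^sup>2 + (- s')\<^sup>2 = 1" "- s' \<noteq> 0" using s by (auto simp: c'_def s'_def)
  define u where "u z = c' *\<^sub>R fst z - s' *\<^sub>R snd z" for z :: "'a \<times> 'a"
  have u_rot: "u z = fst (rot c' (- s') z)" for z by (simp add: u_def rot_def)
  have cu [continuous_intros]: "continuous_on UNIV u" unfolding u_def by (intro continuous_intros)
  have u_inv: "u (rot c' s' z) = fst z" for z
  proof -
    have "u (rot c' s' z) = (c'\<^sup>2 + s'\<^sup>2) *\<^sub>R fst z"
      by (simp add: u_def rot_def algebra_simps power2_eq_square)
    then show ?thesis using cs by simp
  qed
  define H where "H z = f (u z) * (g (fst z) \<bullet> snd z) * W z" for z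
  have KH: "K t z = H (rot c' s' z)" for z
    unfolding K_def H_def u_inv W_rot[OF cs(1)] by (simp add: c'_def s'_def)
  have cH: "continuous_on UNIV H" unfolding H_def by (intro continuous_intros)
  have "(LINT z|lborel. K t z) = (LINT z|lborel. H z)"
    using integral_rot(1)[OF cs borel_measurable_continuous_onI[OF cH]] by (simp add: KH)
  have cf2: "continuous_on UNIV (\<lambda>z :: 'a \<times> 'a. (f (fst z))\<^sup>2)"
    and cg2: "continuous_on UNIV (\<lambda>z :: 'a \<times> 'a. (norm (g (fst z)))\<^sup>2)"
    by (intro continuous_intros)+
  have fu2: "integrable lborel (\<lambda>z. (f (u z))\<^sup>2 * W z)"
    using integrable_rot_W(1)[OF cs' cf2] integrable_W(2) by (simp add: u_rot)
  have gu2: "integrable lborel (\<lambda>z. (norm (g (u z)))\<^sup>2 * W z)"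
    and gu2_eq: "(LINT z|lborel. (norm (g (u z)))\<^sup>2 * W z) = (LINT z|lborel. (norm (g (fst z)))\<^sup>2 * W z)"
    using integrable_rot_W[OF cs' cg2] integrable_W(3) by (simp_all add: u_rot)
  let ?gg = "\<lambda>z. (g (u z) \<bullet> g (fst z)) * W z"
  have Hi: "integrable lborel (\<lambda>z. f (u z) * (g (fst z) \<bullet> i) * (snd z \<bullet> i) * W z)"
    and gi: "integrable lborel (\<lambda>z. (g (u z) \<bullet> i) * (g (fst z) \<bullet> i) * W z)"
    and fi: "integrable lborel (\<lambda>z. f (u z) * (g (fst z) \<bullet> i) * W z)"
    if i: "i \<in> Basis" for i
  proof -
    note ab = abs_mult_le_sum_squares
    have ni: "\<bar>x \<bullet> i\<bar> \<le> norm x" for x :: 'a using Basis_le_norm[OF i] .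
    then have ni2: "(x \<bullet> i)\<^sup>2 \<le> (norm x)\<^sup>2" for x :: 'a
      by (metis abs_le_square_iff abs_norm_cancel)
    show "integrable lborel (\<lambda>z. f (u z) * (g (fst z) \<bullet> i) * (snd z \<bullet> i) * W z)"
    proof (rule Bochner_Integration.integrable_bound[OF Bochner_Integration.integrable_add[OF fu2 integrable_W(4)] measI])
      show "AE z in lborel. norm (f (u z) * (g (fst z) \<bullet> i) * (snd z \<bullet> i) * W z)
        \<le> norm ((f (u z))\<^sup>2 * W z + (norm (g (fst z)))\<^sup>2 * (norm (snd z))\<^sup>2 * W z)"
      proof (intro AE_I2)
        fix z :: "'a \<times> 'a"
        have "\<bar>f (u z) * ((g (fst z) \<bullet> i) * (snd z \<bullet> i))\<bar> \<le> (f (u z))\<^sup>2 + ((g (fst z) \<bullet> i) * (snd z \<bullet> i))\<^sup>2" by (rule ab)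
        also have "\<dots> \<le> (f (u z))\<^sup>2 + (norm (g (fst z)))\<^sup>2 * (norm (snd z))\<^sup>2"
          unfolding power_mult_distrib by (intro add_mono mult_mono ni2) auto
        finally have "\<bar>f (u z) * ((g (fst z) \<bullet> i) * (snd z \<bullet> i))\<bar> * W z \<le> ((f (u z))\<^sup>2 + (norm (g (fst z)))\<^sup>2 * (norm (snd z))\<^sup>2) * W z"
          by (intro mult_right_mono) (auto simp: less_imp_le W_pos)
        then show "norm (f (u z) * (g (fst z) \<bullet> i) * (snd z \<bullet> i) * W z)
          \<le> norm ((f (u z))\<^sup>2 * W z + (norm (g (fst z)))\<^sup>2 * (norm (snd z))\<^sup>2 * W z)"
          using abs_of_pos[OF W_pos[of z]] by (simp add: abs_mult distrib_right mult.assoc)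
      qed
    qed (intro continuous_intros)
    have bnd: "integrable lborel (\<lambda>z. a z * (g (fst z) \<bullet> i) * W z)"
      if a: "integrable lborel (\<lambda>z. (a z)\<^sup>2 * W z)" "continuous_on UNIV a" for a
    proof (rule Bochner_Integration.integrable_bound[OF Bochner_Integration.integrable_add[OF a(1) integrable_W(3)] measI])
      show "AE z in lborel. norm (a z * (g (fst z) \<bullet> i) * W z)
        \<le> norm ((a z)\<^sup>2 * W z + (norm (g (fst z)))\<^sup>2 * W z)"
      proof (intro AE_I2)
        fix z :: "'a \<times> 'a"
        have "\<bar>a z * (g (fst z) \<bullet> i)\<bar> \<le> (a z)\<^sup>2 + (norm (g (fst z)))\<^sup>2"
          using ab[of "a z" "g (fst z) \<bullet> i"] ni2[of "g (fst z)"] by linarith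
        then have "\<bar>a z * (g (fst z) \<bullet> i)\<bar> * W z \<le> ((a z)\<^sup>2 + (norm (g (fst z)))\<^sup>2) * W z"
          by (intro mult_right_mono) (auto simp: less_imp_le W_pos)
        then show "norm (a z * (g (fst z) \<bullet> i) * W z) \<le> norm ((a z)\<^sup>2 * W z + (norm (g (fst z)))\<^sup>2 * W z)"
          using abs_of_pos[OF W_pos[of z]] by (simp add: abs_mult distrib_right)
      qed
    qed (intro continuous_intros a)
    show "integrable lborel (\<lambda>z. f (u z) * (g (fst z) \<bullet> i) * W z)"
      by (rule bnd[OF fu2]) (intro continuous_intros)
    have "integrable lborel (\<lambda>z. (g (u z) \<bullet> i)\<^sup>2 * W z)"
    proof (rule Bochner_Integration.integrable_bound[OF gu2 measI])
      show "AE z in lborel. norm ((g (u z) \<bullet> i)\<^sup>2 * W z) \<le> norm ((norm (g (u z)))\<^sup>2 * W z)"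
        using mult_right_mono[OF ni2 less_imp_le[OF W_pos]] abs_of_pos[OF W_pos] by (intro AE_I2) (simp add: abs_mult)
    qed (intro continuous_intros)
    then show "integrable lborel (\<lambda>z. (g (u z) \<bullet> i) * (g (fst z) \<bullet> i) * W z)"
      by (rule bnd) (intro continuous_intros)
  qed
  have gg: "?gg z = (\<Sum>i\<in>Basis. (g (u z) \<bullet> i) * (g (fst z) \<bullet> i) * W z)" for z
    by (simp only: euclidean_inner[of "g (u z)" "g (fst z)"] sum_distrib_right)
  have ibp: "(LINT z|lborel. f (u z) * (g (fst z) \<bullet> i) * (snd z \<bullet> i) * W z)
      = - 2 * \<tau> * s' * (LINT z|lborel. (g (u z) \<bullet> i) * (g (fst z) \<bullet> i) * W z)" if i: "i \<in> Basis" for i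
  proof -
    let ?d = "\<lambda>z. - s' * ((g (u z) \<bullet> i) * (g (fst z) \<bullet> i) * W z)
        + (- 1 / (2 * \<tau>)) * (f (u z) * (g (fst z) \<bullet> i) * (snd z \<bullet> i) * W z)"
    have "(LINT z|lborel. ?d z) = 0"
    proof (rule integral_directional_derivative_eq_0[where v = "(0, i)"])
      show "((\<lambda>r. f (u (z + r *\<^sub>R (0, i))) * (g (fst (z + r *\<^sub>R (0, i))) \<bullet> i) * W (z + r *\<^sub>R (0, i)))
          has_real_derivative ?d z) (at 0)" for z
      proof -
        have u0: "u (z + r *\<^sub>R (0, i)) = u z + r *\<^sub>R (- s' *\<^sub>R i)" for r
          by (simp add: u_def algebra_simps)
        have 1: "((\<lambda>r. f (u z + r *\<^sub>R (- s' *\<^sub>R i))) has_real_derivative g (u z) \<bullet> (- s' *\<^sub>R i)) (at 0)"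
          by (rule f_DERIV_line)
        have 2: "((\<lambda>r. gker \<tau> (snd z + r *\<^sub>R i)) has_real_derivative - (snd z \<bullet> i) / (2 * \<tau>) * gker \<tau> (snd z)) (at 0)"
          by (rule gker_DERIV)
        have "((\<lambda>r. ((g (fst z) \<bullet> i) * gker \<tau> (fst z)) * (f (u z + r *\<^sub>R (- s' *\<^sub>R i)) * gker \<tau> (snd z + r *\<^sub>R i)))
            has_real_derivative ?d z) (at 0)"
          by (rule DERIV_cong[OF DERIV_cmult[OF DERIV_mult[OF 1 2]]])
             (simp add: W_def algebra_simps)
        then show ?thesis
          unfolding u0 W_def by (simp add: mult_ac)
      qed
      show "continuous_on UNIV ?d" by (intro continuous_intros) (use \<tau> in auto)
      show "integrable lborel (\<lambda>z. f (u z) * (g (fst z) \<bullet> i) * W z)" using fi[OF i] .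
      show "integrable lborel ?d"
        by (intro Bochner_Integration.integrable_add integrable_mult_right Hi gi i)
    qed
    moreover have "(LINT z|lborel. ?d z) = - s' * (LINT z|lborel. (g (u z) \<bullet> i) * (g (fst z) \<bullet> i) * W z)
        + (- 1 / (2 * \<tau>)) * (LINT z|lborel. f (u z) * (g (fst z) \<bullet> i) * (snd z \<bullet> i) * W z)"
      by (subst Bochner_Integration.integral_add) (auto simp only: integral_mult_right_zero intro!: integrable_mult_right Hi gi i)
    ultimately show ?thesis using \<tau> by (simp add: field_simps)
  qed
  have "(LINT z|lborel. H z) = (LINT z|lborel. (\<Sum>i\<in>Basis. f (u z) * (g (fst z) \<bullet> i) * (snd z \<bullet> i) * W z))"
    by (rule arg_cong[where f = "integral\<^sup>L lborel"], rule ext)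
       (simp only: H_def euclidean_inner[of "g (fst z)" "snd z" for z] sum_distrib_left sum_distrib_right mult.assoc)
  also have "\<dots> = (\<Sum>i\<in>Basis. (LINT z|lborel. f (u z) * (g (fst z) \<bullet> i) * (snd z \<bullet> i) * W z))"
    by (rule Bochner_Integration.integral_sum) (rule Hi)
  also have "\<dots> = - 2 * \<tau> * s' * (\<Sum>i\<in>Basis. (LINT z|lborel. (g (u z) \<bullet> i) * (g (fst z) \<bullet> i) * W z))"
    by (simp add: ibp sum_distrib_left)
  also have "(\<Sum>i\<in>Basis. (LINT z|lborel. (g (u z) \<bullet> i) * (g (fst z) \<bullet> i) * W z))
      = (LINT z|lborel. (\<Sum>i\<in>Basis. (g (u z) \<bullet> i) * (g (fst z) \<bullet> i) * W z))"
    by (rule Bochner_Integration.integral_sum[symmetric]) (rule gi)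
  also have "\<dots> = (LINT z|lborel. ?gg z)"
    by (simp only: gg)
  finally have KA: "(LINT z|lborel. K t z) = - 2 * \<tau> * s' * (LINT z|lborel. ?gg z)"
    using \<open>(LINT z|lborel. K t z) = (LINT z|lborel. H z)\<close> by simp
  have ggi: "integrable lborel ?gg"
  proof -
    have "integrable lborel (\<lambda>z. \<Sum>i\<in>Basis. (g (u z) \<bullet> i) * (g (fst z) \<bullet> i) * W z)"
      by (rule Bochner_Integration.integrable_sum) (rule gi)
    then show ?thesis by (simp only: gg)
  qed
  have "B t = (LINT z|lborel. (norm (g (u z)))\<^sup>2 * W z + (norm (g (fst z)))\<^sup>2 * W z - 2 * ?gg z)"
    unfolding B_def c'_def[symmetric] s'_def[symmetric] u_def[symmetric]
    by (intro Bochner_Integration.integral_cong refl)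
       (simp add: power2_norm_eq_inner inner_simps inner_commute algebra_simps)
  also have "\<dots> = 2 * (LINT z|lborel. (norm (g (fst z)))\<^sup>2 * W z) - 2 * (LINT z|lborel. ?gg z)"
    using gu2 gu2_eq ggi integrable_W(3) by simp
  finally have "(LINT z|lborel. ?gg z) = (LINT z|lborel. (norm (g (fst z)))\<^sup>2 * W z) - B t / 2" by (simp add: field_simps)
  then show ?thesis unfolding KA integrable_W(6) s'_def by simp
qed

end

context gaussian_poincare begin

lemma integrable_f: "integrable lborel (\<lambda>x. f x * gker \<tau> x)"
proof (rule Bochner_Integration.integrable_bound[OF Bochner_Integration.integrable_add[OF iw_f iw]])
  show "(\<lambda>x. f x * gker \<tau> x) \<in> borel_measurable lborel"
    by (intro measI continuous_intros)
  show "AE x in lborel. norm (f x * gker \<tau> x) \<le> norm ((f x)\<^sup>2 * gker \<tau> x + gker \<tau> x)"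
  proof (intro AE_I2)
    fix x :: 'a
    have "\<bar>f x\<bar> * gker \<tau> x \<le> ((f x)\<^sup>2 + 1) * gker \<tau> x"
      using abs_mult_le_sum_squares[of "f x" 1] by (intro mult_right_mono) (auto simp: less_imp_le gker_pos)
    then show "norm (f x * gker \<tau> x) \<le> norm ((f x)\<^sup>2 * gker \<tau> x + gker \<tau> x)"
      using gker_pos[of \<tau> x] by (simp add: abs_mult distrib_right)
  qed
qed

lemma DERIV_f_rot:
  "((\<lambda>t. f (fst (rot (cos t) (sin t) z))) has_real_derivative
     g (fst (rot (cos t) (sin t) z)) \<bullet> snd (rot (cos t) (sin t) z)) (at t)"
proof -
  have "((\<lambda>t. fst (rot (cos t) (sin t) z)) has_derivative (\<lambda>h. h *\<^sub>R snd (rot (cos t) (sin t) z))) (at t)"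
    unfolding rot_def by (auto intro!: derivative_eq_intros simp: algebra_simps)
  from has_derivative_compose[OF this df]
  show ?thesis
    by (rule has_derivative_imp_has_field_derivative) simp
qed

text \<open>\<open>q\<close> is the derivative of the interpolating double integral plus
  \<open>sin t\<close> times the constant that \<open>integral_K\<close> produces without its
  remainder. The derivative integrates to the difference of the endpoint values, and
  \<open>sin\<close> integrates to 1 over a quarter period.\<close>

lemma variance_identity:
  obtains q where "integrable lborel q"
    and "\<And>t. t \<noteq> 0 \<Longrightarrow> q t = indicator {0..pi / 2} t * (\<tau> * sin t * B t)"
    and "(LINT t|lborel. q t) =
      (LINT x|lborel. gker \<tau> (x::'a)) * (2 * \<tau> * (LINT x|lborel. (norm (g x))\<^sup>2 * gker \<tau> x) - (LINT x|lborel. (f x)\<^sup>2 * gker \<tau> x))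
      + (LINT x|lborel. f x * gker \<tau> x)\<^sup>2"
proof -
  let ?I = "indicator {0..pi / 2} :: real \<Rightarrow> real"
  define C where "C = (LINT z|lborel. (f (fst z))\<^sup>2 * W z) + (LINT z|lborel. (norm (g (fst z)))\<^sup>2 * (norm (snd z))\<^sup>2 * W z)"
  \<comment> \<open>This constant, the Dirichlet integral times the mass, is not the interpolation
    E(t) described before \<open>K\<close>.\<close>
  define E where "E = (LINT x|lborel. (norm (g x))\<^sup>2 * gker \<tau> x) * (LINT x|lborel. gker \<tau> (x::'a))"
  let ?k = "\<lambda>p. ?I (fst p) * K (fst p) (snd p)"
  \<comment> \<open>The only angle in the interval at which \<open>sin\<close> vanishes is 0, a null
    set.\<close>
  have s0: "AE t in lborel. t \<noteq> (0::real)" by (rule AE_lborel_singleton)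
  have sin0: "sin t \<noteq> 0" if "t \<noteq> 0" "t \<in> {0..pi / 2}" for t :: real
    using that sin_gt_zero[of t] pi_gt_zero by (auto simp: less_le)
  have Kmeas [measurable]: "(\<lambda>p. K (fst p) (snd p)) \<in> borel_measurable (borel \<Otimes>\<^sub>M borel)"
    unfolding borel_prod by (rule borel_measurable_continuous_onI[OF continuous_K])
  have int: "integrable (lborel \<Otimes>\<^sub>M lborel) ?k"
  proof (rule lborel_pair.Fubini_integrable)
    show "?k \<in> borel_measurable (lborel \<Otimes>\<^sub>M lborel)" by measurable
    show "AE t in lborel. integrable lborel (\<lambda>z. ?k (t, z))"
      using s0
    proof eventually_elim
      case (elim t)
      show ?case
        using integrable_K(1)[OF sin0, of t] elim by (cases "t \<in> {0..pi / 2}") auto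
    qed
    have "integrable lborel (\<lambda>t. C * ?I t)" by simp
    then show "integrable lborel (\<lambda>t. LINT z|lborel. norm (?k (t, z)))"
    proof (rule Bochner_Integration.integrable_bound)
      show "(\<lambda>t. LINT z|lborel. norm (?k (t, z))) \<in> borel_measurable lborel"
        by measurable
      show "AE t in lborel. norm (LINT z|lborel. norm (?k (t, z))) \<le> norm (C * ?I t)"
        using s0
      proof eventually_elim
        case (elim t)
        show ?case
        proof (cases "t \<in> {0..pi / 2}")
          case True
          have "0 \<le> (LINT z|lborel. \<bar>K t z\<bar>)" by simp
          then show ?thesis using integrable_K(2)[OF sin0[OF elim True]] True by (simp add: C_def)
        qed simp
      qed
    qed
  qed
  define q where "q t = (LINT z|lborel. ?k (t, z)) + 2 * \<tau> * E * (sin t * ?I t)" for t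
  have sin_int: "integrable lborel (\<lambda>t. sin t * ?I t)"
    and sin_eq: "(LINT t|lborel. sin t * ?I t) = 1"
  proof -
    have "((\<lambda>t. - cos t) has_real_derivative sin x) (at x)" for x :: real
      by (auto intro!: derivative_eq_intros)
    from has_bochner_integral_FTC_Icc_real[of 0 "pi / 2" "\<lambda>t. - cos t" sin, OF _ this]
    show "integrable lborel (\<lambda>t. sin t * ?I t)" "(LINT t|lborel. sin t * ?I t) = 1"
      by (simp_all add: has_bochner_integral_iff)
  qed
  have int_fst: "integrable lborel (\<lambda>t. LINT z|lborel. ?k (t, z))"
    using lborel_pair.integrable_fst'[OF int] by simp
  have q_int: "integrable lborel q"
    unfolding q_def by (intro Bochner_Integration.integrable_add int_fst integrable_mult_right sin_int)
  have q_eq: "q t = indicator {0..pi / 2} t * (\<tau> * sin t * B t)" if "t \<noteq> 0" for t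
  proof (cases "t \<in> {0..pi / 2}")
    case True
    then show ?thesis
      using integral_K[OF sin0[of t]] that by (simp add: q_def E_def algebra_simps)
  qed (simp add: q_def)
  have ftc: "(LINT t|lborel. ?k (t, z)) = f (fst z) * f (snd z) * W z - (f (fst z))\<^sup>2 * W z" for z
  proof -
    let ?G = "\<lambda>t. g (fst (rot (cos t) (sin t) z)) \<bullet> snd (rot (cos t) (sin t) z)"
    have cG: "continuous_on UNIV ?G" by (intro continuous_intros)
    have "(LINT t|lborel. ?G t * ?I t) = f (snd z) - f (fst z)"
      using integral_FTC_Icc_real[of 0 "pi / 2" "\<lambda>t. f (fst (rot (cos t) (sin t) z))" ?G] DERIV_f_rot cG
      by (simp add: continuous_on_eq_continuous_at rot_def)
    moreover have "(LINT t|lborel. ?k (t, z)) = (LINT t|lborel. (f (fst z) * W z) * (?G t * ?I t))"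
      by (simp add: K_def mult_ac)
    ultimately have "(LINT t|lborel. ?k (t, z)) = (f (fst z) * W z) * (f (snd z) - f (fst z))"
      by (simp only: integral_mult_right_zero)
    then show ?thesis by (simp add: algebra_simps power2_eq_square)
  qed
  have "(LINT t|lborel. (LINT z|lborel. ?k (t, z))) = (LINT z|lborel. (LINT t|lborel. ?k (t, z)))"
    using lborel_pair.Fubini_integral[of "\<lambda>t z. ?k (t, z)"] int by (simp add: case_prod_beta')
  also have "\<dots> = (LINT z|lborel. f (fst z) * f (snd z) * W z - (f (fst z))\<^sup>2 * W z)"
    by (simp only: ftc)
  also have "\<dots> = (LINT z|lborel. f (fst z) * f (snd z) * W z) - (LINT z|lborel. (f (fst z))\<^sup>2 * W z)"
    using lborel_prod_integrable(1)[OF integrable_f integrable_f] integrable_W(2)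
    by (intro Bochner_Integration.integral_diff) (simp_all add: W_def mult_ac)
  also have "(LINT z|lborel. f (fst z) * f (snd z) * W z) = (LINT x|lborel. f x * gker \<tau> x)\<^sup>2"
    using lborel_prod_integrable(2)[OF integrable_f integrable_f]
    by (simp add: W_def mult_ac power2_eq_square)
  finally have "(LINT t|lborel. q t) = (LINT x|lborel. f x * gker \<tau> x)\<^sup>2 - (LINT z|lborel. (f (fst z))\<^sup>2 * W z) + 2 * \<tau> * E"
    unfolding q_def using int_fst sin_int sin_eq by simp
  then show thesis
    unfolding integrable_W(5) E_def by (intro that[OF q_int q_eq]) (simp_all add: algebra_simps)
qed

lemma B_nonneg: "0 \<le> B t"
  unfolding B_def by (intro integral_nonneg_AE AE_I2 mult_nonneg_nonneg) (auto simp: less_imp_le W_pos)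

lemma gker_integral_pos: "(LINT x|lborel. gker \<tau> (x::'a)) > 0"
proof -
  have "(LINT x|lborel. gker \<tau> (x::'a)) \<noteq> 0"
  proof
    assume "(LINT x|lborel. gker \<tau> (x::'a)) = 0"
    then have "AE x in lborel. gker \<tau> (x::'a) = 0"
      using integral_nonneg_eq_0_iff_AE[OF iw AE_I2[OF less_imp_le[OF gker_pos]]] by simp
    then have "AE x::'a in lborel. False"
      by eventually_elim (metis gker_pos less_irrefl)
    then show False using ae_filter_eq_bot_iff[of "lborel :: 'a measure"] by (simp add: trivial_limit_def)
  qed
  moreover have "(LINT x|lborel. gker \<tau> (x::'a)) \<ge> 0"
    by (intro integral_nonneg_AE AE_I2) (simp add: gker_pos less_imp_le)
  ultimately show ?thesis by simp
qed

text \<open>For mean zero, the mass times the difference of the two sides is the integral of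
  \<open>q\<close>, which is nonnegative almost everywhere because \<open>B\<close> is.\<close>

theorem poincare:
  assumes mean: "(LINT x|lborel. f x * gker \<tau> x) = 0"
  shows "(LINT x|lborel. (f x)\<^sup>2 * gker \<tau> x) \<le> 2 * \<tau> * (LINT x|lborel. (norm (g x))\<^sup>2 * gker \<tau> x)" (is ?le)
    and "(LINT x|lborel. (f x)\<^sup>2 * gker \<tau> x) = 2 * \<tau> * (LINT x|lborel. (norm (g x))\<^sup>2 * gker \<tau> x) \<Longrightarrow> g x = g 0"
proof -
  obtain q where q: "integrable lborel q"
    "\<And>t. t \<noteq> 0 \<Longrightarrow> q t = indicator {0..pi / 2} t * (\<tau> * sin t * B t)"
    and qI': "(LINT t|lborel. q t) =
      (LINT x|lborel. gker \<tau> (x::'a)) * (2 * \<tau> * (LINT x|lborel. (norm (g x))\<^sup>2 * gker \<tau> x) - (LINT x|lborel. (f x)\<^sup>2 * gker \<tau> x))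
      + (LINT x|lborel. f x * gker \<tau> x)\<^sup>2"
    by (rule variance_identity) (rule that)
  have qI: "(LINT t|lborel. q t) =
      (LINT x|lborel. gker \<tau> (x::'a)) * (2 * \<tau> * (LINT x|lborel. (norm (g x))\<^sup>2 * gker \<tau> x) - (LINT x|lborel. (f x)\<^sup>2 * gker \<tau> x))"
    using qI' mean by simp
  have s0: "AE t in lborel. t \<noteq> (0::real)" by (rule AE_lborel_singleton)
  have q_nonneg: "AE t in lborel. 0 \<le> q t"
    using s0
  proof eventually_elim
    case (elim t)
    show ?case
    proof (cases "t \<in> {0..pi / 2}")
      case True
      then have "sin t \<ge> 0" by (intro sin_ge_zero) auto
      then show ?thesis using elim B_nonneg[of t] \<tau> by (simp add: q(2))
    qed (simp add: q(2) elim)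
  qed
  then have "(LINT t|lborel. q t) \<ge> 0" by (rule integral_nonneg_AE)
  then show ?le
    unfolding qI using gker_integral_pos by (simp add: zero_le_mult_iff)
  show "g x = g 0" if eq: "(LINT x|lborel. (f x)\<^sup>2 * gker \<tau> x) = 2 * \<tau> * (LINT x|lborel. (norm (g x))\<^sup>2 * gker \<tau> x)"
  proof -
    have "AE t in lborel. q t = 0"
      using integral_nonneg_eq_0_iff_AE[OF q(1) q_nonneg] qI eq by simp
    then have AE: "AE t in lborel. q t = 0 \<and> t \<noteq> 0" using s0 by eventually_elim simp
    \<comment> \<open>A single interior angle with vanishing remainder suffices; one exists because
      the open interval has positive measure.\<close>
    have "\<exists>t\<in>{0<..<pi / 2}. q t = 0"
    proof (rule ccontr)
      assume "\<not> ?thesis"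
      then have "{0<..<pi / 2} \<subseteq> {t. \<not> (q t = 0 \<and> t \<noteq> 0)}" by auto
      moreover obtain N where N: "{t. \<not> (q t = 0 \<and> t \<noteq> 0)} \<subseteq> N" "N \<in> null_sets lborel"
        using AE unfolding eventually_ae_filter by auto
      ultimately have "emeasure lborel {0<..<pi / 2} \<le> emeasure lborel N"
        by (intro emeasure_mono) auto
      then show False using N(2) pi_gt_zero by auto
    qed
    then obtain t where t: "0 < t" "t < pi / 2" "q t = 0" by auto
    have s: "sin t > 0" using t by (intro sin_gt_zero) auto
    then have B0: "B t = 0" using q(2)[of t] t \<tau> by simp
    let ?b = "\<lambda>z. (norm (g (cos t *\<^sub>R fst z - sin t *\<^sub>R snd z) - g (fst z)))\<^sup>2 * W z"
    have cb: "continuous_on UNIV ?b" by (intro continuous_intros)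
    have ib: "integrable lborel ?b"
    proof (rule Bochner_Integration.integrable_bound)
      have cs: "(cos t)\<^sup>2 + (- sin t)\<^sup>2 = 1" "- sin t \<noteq> 0" using s by auto
      have "continuous_on UNIV (\<lambda>z :: 'a \<times> 'a. (norm (g (fst z)))\<^sup>2)" by (intro continuous_intros)
      from integrable_rot_W(1)[OF cs this]
      have "integrable lborel (\<lambda>z. (norm (g (cos t *\<^sub>R fst z - sin t *\<^sub>R snd z)))\<^sup>2 * W z)"
        using integrable_W(3) by (simp add: rot_def)
      then show "integrable lborel (\<lambda>z. 2 * ((norm (g (cos t *\<^sub>R fst z - sin t *\<^sub>R snd z)))\<^sup>2 * W z) + 2 * ((norm (g (fst z)))\<^sup>2 * W z))"
        using integrable_W(3) by (intro Bochner_Integration.integrable_add integrable_mult_right)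
      show "?b \<in> borel_measurable lborel" by (rule measI[OF cb])
      have "(norm (a - b))\<^sup>2 \<le> 2 * (norm a)\<^sup>2 + 2 * (norm b)\<^sup>2" for a b :: 'a
      proof -
        have "(norm (a - b))\<^sup>2 + (norm (a + b))\<^sup>2 = 2 * (norm a)\<^sup>2 + 2 * (norm b)\<^sup>2"
          by (simp add: power2_norm_eq_inner inner_simps inner_commute)
        then show ?thesis by (metis le_add_same_cancel1 zero_le_power2)
      qed
      from mult_right_mono[OF this less_imp_le[OF W_pos]]
      show "AE z in lborel. norm (?b z) \<le> norm (2 * ((norm (g (cos t *\<^sub>R fst z - sin t *\<^sub>R snd z)))\<^sup>2 * W z) + 2 * ((norm (g (fst z)))\<^sup>2 * W z))"
        using abs_of_pos[OF W_pos] by (intro AE_I2) (simp add: abs_mult distrib_right mult.assoc order_trans[OF _ abs_ge_self])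
    qed
    have "AE z in lborel. ?b z = 0"
      using integral_nonneg_eq_0_iff_AE[OF ib] B0 W_pos by (simp add: B_def less_imp_le)
    \<comment> \<open>The integrand is continuous, so it vanishes everywhere: a nonempty open set is
      not negligible.\<close>
    have b0: "?b z = 0" for z
    proof (rule ccontr)
      assume nz: "?b z \<noteq> 0"
      have op: "open {z. ?b z \<noteq> 0}"
        using open_Collect_neq[OF cb continuous_on_const] .
      obtain N where "{z. \<not> ?b z = 0} \<subseteq> N" "N \<in> null_sets lborel"
        using \<open>AE z in lborel. ?b z = 0\<close> unfolding eventually_ae_filter by auto
      then have "negligible {z. ?b z \<noteq> 0}"
        by (meson negligible_iff_null_sets negligible_subset null_sets_completionI)
      then show False using open_not_negligible[OF op] nz by blast
    qed
    \<comment> \<open>At x = 0 the two points are - y sin t and 0, and the former is arbitrary since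
      \<open>sin t\<close> is not 0.\<close>
    have "g (- (sin t) *\<^sub>R y) = g 0" for y
      using b0[of "(0, y)"] W_pos[of "(0, y)"] by simp
    from this[of "(- 1 / sin t) *\<^sub>R x"] show ?thesis using s by simp
  qed
qed

end

section \<open>Families with dominated moments\<close>

lemma dominated_moments_mono:
  assumes Q: "dominated_moments \<phi>t Q" and \<epsilon>: "\<epsilon> > 0"
    and le: "\<And>t x. \<bar>t\<bar> < \<epsilon> \<Longrightarrow> norm (R t x) \<le> norm (Q t x)"
  shows "dominated_moments \<phi>t R"
  unfolding dominated_moments_def
proof
  fix p
  obtain \<delta> g where g: "\<delta> > 0" "integrable lborel g"
    "\<And>t x. \<bar>t\<bar> < \<delta> \<Longrightarrow> norm (Q t x) ^ p * exp (- \<phi>t t x) \<le> g x"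
    using Q unfolding dominated_moments_def by metis
  have "norm (R t x) ^ p * exp (- \<phi>t t x) \<le> g x" if "\<bar>t\<bar> < min \<delta> \<epsilon>" for t x
  proof -
    have "norm (R t x) ^ p * exp (- \<phi>t t x) \<le> norm (Q t x) ^ p * exp (- \<phi>t t x)"
      using that by (intro mult_right_mono power_mono le) auto
    also have "\<dots> \<le> g x" using g(3)[of t x] that by auto
    finally show ?thesis .
  qed
  then show "\<exists>\<delta>>0. \<exists>g. integrable lborel g \<and> (\<forall>t x. \<bar>t\<bar> < \<delta> \<longrightarrow> norm (R t x) ^ p * exp (- \<phi>t t x) \<le> g x)"
    using g \<epsilon> by (intro exI[of _ "min \<delta> \<epsilon>"] conjI exI[of _ g]) auto
qed

text \<open>The moment of order \<open>p\<close> of a product is bounded by the moments of order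
  \<open>2 * p\<close> of the factors; hence moments of all orders are demanded.\<close>

lemma dominated_moments_mult:
  fixes Q R :: "real \<Rightarrow> real^'n \<Rightarrow> real"
  assumes Q: "dominated_moments \<phi>t Q" and R: "dominated_moments \<phi>t R"
  shows "dominated_moments \<phi>t (\<lambda>t x. Q t x * R t x)"
  unfolding dominated_moments_def
proof
  fix p
  obtain \<delta> g where g: "\<delta> > 0" "integrable lborel g"
    "\<And>t x. \<bar>t\<bar> < \<delta> \<Longrightarrow> norm (Q t x) ^ (2 * p) * exp (- \<phi>t t x) \<le> g x"
    using Q unfolding dominated_moments_def by metis
  obtain \<delta>' g' where g': "\<delta>' > 0" "integrable lborel g'"
    "\<And>t x. \<bar>t\<bar> < \<delta>' \<Longrightarrow> norm (R t x) ^ (2 * p) * exp (- \<phi>t t x) \<le> g' x"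
    using R unfolding dominated_moments_def by metis
  have "norm (Q t x * R t x) ^ p * exp (- \<phi>t t x) \<le> g x + g' x" if "\<bar>t\<bar> < min \<delta> \<delta>'" for t x
  proof -
    have "norm (Q t x * R t x) ^ p = \<bar>Q t x\<bar> ^ p * \<bar>R t x\<bar> ^ p"
      by (simp add: abs_mult power_mult_distrib)
    also have "\<dots> \<le> 2 * \<bar>Q t x\<bar> ^ p * \<bar>R t x\<bar> ^ p" by simp
    also have "\<dots> \<le> (\<bar>Q t x\<bar> ^ p)\<^sup>2 + (\<bar>R t x\<bar> ^ p)\<^sup>2" by (rule sum_squares_bound)
    also have "\<dots> = norm (Q t x) ^ (2 * p) + norm (R t x) ^ (2 * p)"
      by (simp add: power_mult[symmetric] mult.commute)
    finally have "norm (Q t x * R t x) ^ p * exp (- \<phi>t t x)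
        \<le> (norm (Q t x) ^ (2 * p) + norm (R t x) ^ (2 * p)) * exp (- \<phi>t t x)"
      by (intro mult_right_mono) auto
    then show ?thesis using g(3)[of t x] g'(3)[of t x] that by (simp add: distrib_right)
  qed
  then show "\<exists>\<delta>>0. \<exists>g. integrable lborel g \<and> (\<forall>t x. \<bar>t\<bar> < \<delta> \<longrightarrow> norm (Q t x * R t x) ^ p * exp (- \<phi>t t x) \<le> g x)"
    using g g' by (intro exI[of _ "min \<delta> \<delta>'"] conjI exI[of _ "\<lambda>x. g x + g' x"]) auto
qed

lemma dominated_moments_add:
  fixes Q R :: "real \<Rightarrow> real^'n \<Rightarrow> real"
  assumes Q: "dominated_moments \<phi>t Q" and R: "dominated_moments \<phi>t R"
  shows "dominated_moments \<phi>t (\<lambda>t x. Q t x + R t x)"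
  unfolding dominated_moments_def
proof
  fix p
  obtain \<delta> g where g: "\<delta> > 0" "integrable lborel g"
    "\<And>t x. \<bar>t\<bar> < \<delta> \<Longrightarrow> norm (Q t x) ^ p * exp (- \<phi>t t x) \<le> g x"
    using Q unfolding dominated_moments_def by metis
  obtain \<delta>' g' where g': "\<delta>' > 0" "integrable lborel g'"
    "\<And>t x. \<bar>t\<bar> < \<delta>' \<Longrightarrow> norm (R t x) ^ p * exp (- \<phi>t t x) \<le> g' x"
    using R unfolding dominated_moments_def by metis
  have "norm (Q t x + R t x) ^ p * exp (- \<phi>t t x) \<le> 2 ^ p * (g x + g' x)" if "\<bar>t\<bar> < min \<delta> \<delta>'" for t x
  proof -
    let ?m = "max \<bar>Q t x\<bar> \<bar>R t x\<bar>"
    have "norm (Q t x + R t x) ^ p \<le> (2 * ?m) ^ p"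
      by (intro power_mono) auto
    also have "\<dots> \<le> 2 ^ p * (norm (Q t x) ^ p + norm (R t x) ^ p)"
      unfolding power_mult_distrib by (intro mult_left_mono) (auto simp: max_def)
    finally have "norm (Q t x + R t x) ^ p * exp (- \<phi>t t x)
        \<le> 2 ^ p * (norm (Q t x) ^ p + norm (R t x) ^ p) * exp (- \<phi>t t x)"
      by (intro mult_right_mono) auto
    also have "\<dots> \<le> 2 ^ p * (g x + g' x)"
      using g(3)[of t x] g'(3)[of t x] that unfolding mult.assoc distrib_right
      by (intro mult_left_mono) auto
    finally show ?thesis .
  qed
  then show "\<exists>\<delta>>0. \<exists>g. integrable lborel g \<and> (\<forall>t x. \<bar>t\<bar> < \<delta> \<longrightarrow> norm (Q t x + R t x) ^ p * exp (- \<phi>t t x) \<le> g x)"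
    using g g' by (intro exI[of _ "min \<delta> \<delta>'"] conjI exI[of _ "\<lambda>x. 2 ^ p * (g x + g' x)"]) auto
qed

text \<open>The moment of order 0 of \<open>Q\<close> dominates \<open>exp (- \<phi>t t x)\<close>
  itself.\<close>

lemma dominated_moments_bounded:
  fixes Q :: "real \<Rightarrow> real^'n \<Rightarrow> 'b::real_normed_vector" and R :: "real \<Rightarrow> real^'n \<Rightarrow> real"
  assumes Q: "dominated_moments \<phi>t Q" and \<epsilon>: "\<epsilon> > 0"
    and le: "\<And>t x. \<bar>t\<bar> < \<epsilon> \<Longrightarrow> \<bar>R t x\<bar> \<le> C"
  shows "dominated_moments \<phi>t R"
  unfolding dominated_moments_def
proof
  fix p
  obtain \<delta> g where g: "\<delta> > 0" "integrable lborel g"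
    "\<And>t x. \<bar>t\<bar> < \<delta> \<Longrightarrow> norm (Q t x) ^ 0 * exp (- \<phi>t t x) \<le> g x"
    using Q unfolding dominated_moments_def by metis
  have "norm (R t x) ^ p * exp (- \<phi>t t x) \<le> C ^ p * g x" if "\<bar>t\<bar> < min \<delta> \<epsilon>" for t x
    using g(3)[of t x] that le[of t x] by (intro mult_mono power_mono) auto
  then show "\<exists>\<delta>>0. \<exists>g. integrable lborel g \<and> (\<forall>t x. \<bar>t\<bar> < \<delta> \<longrightarrow> norm (R t x) ^ p * exp (- \<phi>t t x) \<le> g x)"
    using g \<epsilon> by (intro exI[of _ "min \<delta> \<epsilon>"] conjI exI[of _ "\<lambda>x. C ^ p * g x"]) auto
qed

lemma dominated_moments_at_0:
  assumes "dominated_moments \<phi>t Q"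
  shows "dominated_moments (\<lambda>_. \<phi>t 0) (\<lambda>_. Q 0)"
  unfolding dominated_moments_def
proof
  fix p
  obtain \<delta> g where g: "\<delta> > 0" "integrable lborel g"
    "\<And>t x. \<bar>t\<bar> < \<delta> \<Longrightarrow> norm (Q t x) ^ p * exp (- \<phi>t t x) \<le> g x"
    using assms unfolding dominated_moments_def by metis
  then have le: "norm (Q 0 x) ^ p * exp (- \<phi>t 0 x) \<le> g x" for x by simp
  show "\<exists>\<delta>>0. \<exists>g. integrable lborel g \<and> (\<forall>(t::real) x. \<bar>t\<bar> < \<delta> \<longrightarrow> norm (Q 0 x) ^ p * exp (- \<phi>t 0 x) \<le> g x)"
    by (intro exI[of _ \<delta>] exI[of _ g] conjI allI impI g(1,2) le)
qed

section \<open>An algebra of integrands that may be differentiated under the integral\<close>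

locale dominated_family =
  fixes \<phi>t \<phi>1 \<phi>2 :: "real \<Rightarrow> real^'n::finite \<Rightarrow> real" and \<epsilon> :: real
  assumes \<epsilon>: "\<epsilon> > 0"
    and dom_\<phi>: "dominated_moments \<phi>t \<phi>t"
begin

text \<open>Continuity in space supplies measurability. The class is closed under sums and products,
  so it contains every polynomial in the derivatives of \<open>\<phi>t\<close>.\<close>

definition tame :: "(real \<Rightarrow> real^'n \<Rightarrow> real) \<Rightarrow> bool" where
  "tame Q \<longleftrightarrow> dominated_moments \<phi>t Q \<and> (\<forall>t. \<bar>t\<bar> < \<epsilon> \<longrightarrow> continuous_on UNIV (Q t))"

lemma tame_mult: "tame Q \<Longrightarrow> tame R \<Longrightarrow> tame (\<lambda>t x. Q t x * R t x)"
  unfolding tame_def by (auto intro!: dominated_moments_mult continuous_on_mult)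

lemma tame_add: "tame Q \<Longrightarrow> tame R \<Longrightarrow> tame (\<lambda>t x. Q t x + R t x)"
  unfolding tame_def by (auto intro!: dominated_moments_add continuous_on_add)

lemma tame_const: "tame (\<lambda>t x. c)"
  unfolding tame_def using dominated_moments_bounded[OF dom_\<phi> \<epsilon>, of "\<lambda>t x. c" "\<bar>c\<bar>"] by auto

lemma tame_minus: "tame Q \<Longrightarrow> tame (\<lambda>t x. - Q t x)"
  using tame_mult[OF tame_const[of "- 1"], of Q] by simp

lemma tame_diff: "tame Q \<Longrightarrow> tame R \<Longrightarrow> tame (\<lambda>t x. Q t x - R t x)"
  using tame_add[of Q "\<lambda>t x. - R t x"] tame_minus[of R] by simp

lemma tame_time:
  assumes "\<delta> > 0" "\<And>t. \<bar>t\<bar> < \<delta> \<Longrightarrow> \<bar>c t\<bar> \<le> C"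
  shows "tame (\<lambda>t x. c t)"
  unfolding tame_def using dominated_moments_bounded[OF dom_\<phi> assms(1), of "\<lambda>t x. c t" C] assms(2) by auto

definition tderiv :: "(real \<Rightarrow> real^'n \<Rightarrow> real) \<Rightarrow> (real \<Rightarrow> real^'n \<Rightarrow> real) \<Rightarrow> bool" where
  "tderiv Q R \<longleftrightarrow> (\<forall>t x. \<bar>t\<bar> < \<epsilon> \<longrightarrow> ((\<lambda>s. Q s x) has_real_derivative R t x) (at t))"

text \<open>A function bundled with its first two \<open>t\<close>-derivatives, all admissible as
  integrands. The Leibniz rule makes jets an algebra, so a composite integrand is differentiated
  twice by assembling it from its factors.\<close>

definition jet where
  "jet Q Q1 Q2 \<longleftrightarrow> tame Q \<and> tame Q1 \<and> tame Q2 \<and> tderiv Q Q1 \<and> tderiv Q1 Q2"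

lemma jet_const: "jet (\<lambda>t x. c) (\<lambda>t x. 0) (\<lambda>t x. 0)"
  unfolding jet_def tderiv_def by (auto intro: tame_const)

lemma jet_add:
  "jet Q Q1 Q2 \<Longrightarrow> jet R R1 R2 \<Longrightarrow>
    jet (\<lambda>t x. Q t x + R t x) (\<lambda>t x. Q1 t x + R1 t x) (\<lambda>t x. Q2 t x + R2 t x)"
  unfolding jet_def tderiv_def by (intro conjI tame_add) (simp_all add: DERIV_add)

lemma jet_mult:
  "jet Q Q1 Q2 \<Longrightarrow> jet R R1 R2 \<Longrightarrow>
    jet (\<lambda>t x. Q t x * R t x) (\<lambda>t x. Q1 t x * R t x + Q t x * R1 t x)
      (\<lambda>t x. Q2 t x * R t x + 2 * (Q1 t x * R1 t x) + Q t x * R2 t x)"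
proof -
  assume Q: "jet Q Q1 Q2" and R: "jet R R1 R2"
  note * = Q[unfolded jet_def] R[unfolded jet_def]
  have "((\<lambda>s. Q s x * R s x) has_real_derivative Q1 t x * R t x + Q t x * R1 t x) (at t) \<and>
    ((\<lambda>s. Q1 s x * R s x + Q s x * R1 s x) has_real_derivative
      Q2 t x * R t x + 2 * (Q1 t x * R1 t x) + Q t x * R2 t x) (at t)" if t: "\<bar>t\<bar> < \<epsilon>" for t x
  proof -
    have d: "((\<lambda>s. Q s x) has_real_derivative Q1 t x) (at t)" "((\<lambda>s. Q1 s x) has_real_derivative Q2 t x) (at t)"
      "((\<lambda>s. R s x) has_real_derivative R1 t x) (at t)" "((\<lambda>s. R1 s x) has_real_derivative R2 t x) (at t)"
      using Q R t by (simp_all add: jet_def tderiv_def)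
    show ?thesis
      by (intro conjI DERIV_cong[OF DERIV_mult[OF d(1,3)]]
          DERIV_cong[OF DERIV_add[OF DERIV_mult[OF d(2,3)] DERIV_mult[OF d(1,4)]]]) simp_all
  qed
  then show ?thesis
    unfolding jet_def tderiv_def using * by (intro conjI tame_add tame_mult tame_const) simp_all
qed

lemma jet_cmult:
  "jet Q Q1 Q2 \<Longrightarrow> jet (\<lambda>t x. c * Q t x) (\<lambda>t x. c * Q1 t x) (\<lambda>t x. c * Q2 t x)"
  using jet_mult[OF jet_const[of c], of Q Q1 Q2] by simp

lemma jet_diff:
  "jet Q Q1 Q2 \<Longrightarrow> jet R R1 R2 \<Longrightarrow>
    jet (\<lambda>t x. Q t x - R t x) (\<lambda>t x. Q1 t x - R1 t x) (\<lambda>t x. Q2 t x - R2 t x)"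
  using jet_add[OF _ jet_cmult[of R R1 R2 "- 1"], of Q Q1 Q2] by simp

lemma jet_sum:
  assumes "finite A" "\<And>i. i \<in> A \<Longrightarrow> jet (Q i) (Q1 i) (Q2 i)"
  shows "jet (\<lambda>t x. \<Sum>i\<in>A. Q i t x) (\<lambda>t x. \<Sum>i\<in>A. Q1 i t x) (\<lambda>t x. \<Sum>i\<in>A. Q2 i t x)"
  using assms by (induction A rule: finite_induct) (auto intro: jet_const jet_add)

lemma tame_integrable:
  assumes "tame Q"
  obtains \<delta> g where "\<delta> > 0" "integrable lborel g"
    "\<And>t x. \<bar>t\<bar> < \<delta> \<Longrightarrow> \<bar>Q t x * exp (- \<phi>t t x)\<bar> \<le> g x"
proof -
  obtain \<delta> g where "\<delta> > 0" "integrable lborel g"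
    "\<And>t x. \<bar>t\<bar> < \<delta> \<Longrightarrow> norm (Q t x) ^ 1 * exp (- \<phi>t t x) \<le> g x"
    using assms unfolding tame_def dominated_moments_def by metis
  then show thesis by (intro that[of \<delta> g]) (auto simp: abs_mult)
qed

lemma integral_tderiv:
  assumes Q: "tame Q" "tame Q1" "tderiv Q Q1" and \<phi>: "tame \<phi>t" "tame \<phi>1" "tderiv \<phi>t \<phi>1"
  obtains \<delta> where "\<delta> > 0" and "\<And>t. \<bar>t\<bar> < \<delta> \<Longrightarrow>
    ((\<lambda>s. LINT x|lborel. Q s x * exp (- \<phi>t s x)) has_real_derivative
      (LINT x|lborel. (Q1 t x - Q t x * \<phi>1 t x) * exp (- \<phi>t t x))) (at t)"
proof -
  obtain \<delta>1 g1 where g1: "\<delta>1 > 0" "integrable lborel g1"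
    "\<And>t x. \<bar>t\<bar> < \<delta>1 \<Longrightarrow> \<bar>Q t x * exp (- \<phi>t t x)\<bar> \<le> g1 x"
    using tame_integrable[OF Q(1)] by metis
  obtain \<delta>2 g2 where g2: "\<delta>2 > 0" "integrable lborel g2"
    "\<And>t x. \<bar>t\<bar> < \<delta>2 \<Longrightarrow> \<bar>(Q1 t x - Q t x * \<phi>1 t x) * exp (- \<phi>t t x)\<bar> \<le> g2 x"
    using tame_integrable[OF tame_diff[OF Q(2) tame_mult[OF Q(1) \<phi>(2)]]] by metis
  define \<delta> where "\<delta> = min \<epsilon> (min \<delta>1 \<delta>2)"
  have meas: "(\<lambda>x. R t x * exp (- \<phi>t t x)) \<in> borel_measurable lborel" if "tame R" "\<bar>t\<bar> < \<epsilon>" for R t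
  proof -
    have "continuous_on UNIV (\<lambda>x. R t x * exp (- \<phi>t t x))"
      using that \<phi>(1) unfolding tame_def by (intro continuous_intros) auto
    then show ?thesis using borel_measurable_continuous_onI by simp
  qed
  show thesis
  proof (rule that[of \<delta>])
    show "\<delta> > 0" using \<epsilon> g1 g2 by (simp add: \<delta>_def)
    fix t assume t: "\<bar>t\<bar> < \<delta>"
    show "((\<lambda>s. LINT x|lborel. Q s x * exp (- \<phi>t s x)) has_real_derivative
      (LINT x|lborel. (Q1 t x - Q t x * \<phi>1 t x) * exp (- \<phi>t t x))) (at t)"
    proof (rule has_real_derivative_integral_dominated[where S = "{- \<delta><..<\<delta>}" and g = g2
          and f' = "\<lambda>t x. (Q1 t x - Q t x * \<phi>1 t x) * exp (- \<phi>t t x)"])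
      fix s assume s: "s \<in> {- \<delta><..<\<delta>}"
      show "integrable lborel (\<lambda>x. Q s x * exp (- \<phi>t s x))"
      proof (rule Bochner_Integration.integrable_bound[OF g1(2) meas[OF Q(1)]])
        show "AE x in lborel. norm (Q s x * exp (- \<phi>t s x)) \<le> norm (g1 x)"
          using g1(3)[of s] s by (intro AE_I2) (auto simp: \<delta>_def intro: order_trans[OF _ abs_ge_self])
      qed (use s in \<open>auto simp: \<delta>_def\<close>)
      fix x
      show "((\<lambda>s. Q s x * exp (- \<phi>t s x)) has_real_derivative (Q1 s x - Q s x * \<phi>1 s x) * exp (- \<phi>t s x)) (at s)"
      proof -
        have "\<bar>s\<bar> < \<epsilon>" using s by (auto simp: \<delta>_def)
        then have "((\<lambda>s. Q s x) has_real_derivative Q1 s x) (at s)" "((\<lambda>s. - \<phi>t s x) has_real_derivative - \<phi>1 s x) (at s)"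
          using Q(3) \<phi>(3) unfolding tderiv_def by (auto intro: DERIV_minus)
        from DERIV_mult[OF this(1) DERIV_fun_exp[OF this(2)]]
        show ?thesis by (rule DERIV_cong) (simp add: algebra_simps)
      qed
      show "\<bar>(Q1 s x - Q s x * \<phi>1 s x) * exp (- \<phi>t s x)\<bar> \<le> g2 x"
        using g2(3)[of s x] s by (auto simp: \<delta>_def)
    next
      show "(\<lambda>x. (Q1 t x - Q t x * \<phi>1 t x) * exp (- \<phi>t t x)) \<in> borel_measurable lborel"
        using t by (intro meas[OF tame_diff[OF Q(2) tame_mult[OF Q(1) \<phi>(2)]]]) (simp add: \<delta>_def)
    qed (use t g2 in auto)
  qed
qed

text \<open>The first derivative must exist near 0 in order to be differentiated again; it stays
  anonymous as \<open>I1\<close>, while the second is the expanded second derivative of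
  \<open>Q\<close> times \<open>exp (- \<phi>t)\<close>.\<close>

lemma integral_jet:
  assumes Q: "jet Q Q1 Q2" and \<phi>: "jet \<phi>t \<phi>1 \<phi>2"
  obtains \<delta> I1 where "\<delta> > 0" and "\<And>t. \<bar>t\<bar> < \<delta> \<Longrightarrow>
      ((\<lambda>s. LINT x|lborel. Q s x * exp (- \<phi>t s x)) has_real_derivative I1 t) (at t)"
    and "\<And>t. \<bar>t\<bar> < \<delta> \<Longrightarrow> (I1 has_real_derivative
      (LINT x|lborel. (Q2 t x - 2 * (Q1 t x * \<phi>1 t x) + Q t x * ((\<phi>1 t x)\<^sup>2 - \<phi>2 t x)) * exp (- \<phi>t t x))) (at t)"
proof -
  let ?I1 = "\<lambda>t. LINT x|lborel. (Q1 t x - Q t x * \<phi>1 t x) * exp (- \<phi>t t x)"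
  have t: "tame Q" "tame Q1" "tame Q2" "tame \<phi>t" "tame \<phi>1" "tame \<phi>2" "tderiv Q Q1" "tderiv \<phi>t \<phi>1"
    using Q \<phi> by (simp_all add: jet_def)
  obtain \<delta>1 where \<delta>1: "\<delta>1 > 0" "\<And>t. \<bar>t\<bar> < \<delta>1 \<Longrightarrow>
      ((\<lambda>s. LINT x|lborel. Q s x * exp (- \<phi>t s x)) has_real_derivative ?I1 t) (at t)"
    by (rule integral_tderiv[OF t(1,2,7,4,5,8)]) (rule that)
  have R: "tame (\<lambda>t x. Q1 t x - Q t x * \<phi>1 t x)" "tame (\<lambda>t x. Q2 t x - (Q1 t x * \<phi>1 t x + Q t x * \<phi>2 t x))"
    by (intro tame_diff tame_add tame_mult t)+
  have "tderiv (\<lambda>t x. Q1 t x - Q t x * \<phi>1 t x) (\<lambda>t x. Q2 t x - (Q1 t x * \<phi>1 t x + Q t x * \<phi>2 t x))"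
  proof -
    have "((\<lambda>s. Q1 s x - Q s x * \<phi>1 s x) has_real_derivative Q2 t x - (Q1 t x * \<phi>1 t x + Q t x * \<phi>2 t x)) (at t)"
      if t: "\<bar>t\<bar> < \<epsilon>" for t x
    proof -
      have d: "((\<lambda>s. Q s x) has_real_derivative Q1 t x) (at t)" "((\<lambda>s. Q1 s x) has_real_derivative Q2 t x) (at t)"
        "((\<lambda>s. \<phi>1 s x) has_real_derivative \<phi>2 t x) (at t)"
        using Q \<phi> t by (simp_all add: jet_def tderiv_def)
      show ?thesis
        by (rule DERIV_cong[OF DERIV_diff[OF d(2) DERIV_mult[OF d(1,3)]]]) simp
    qed
    then show ?thesis unfolding tderiv_def by simp
  qed
  note R' = R this t(4,5,8)
  obtain \<delta>2 where \<delta>2: "\<delta>2 > 0" "\<And>t. \<bar>t\<bar> < \<delta>2 \<Longrightarrow>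
      (?I1 has_real_derivative (LINT x|lborel. (Q2 t x - (Q1 t x * \<phi>1 t x + Q t x * \<phi>2 t x)
        - (Q1 t x - Q t x * \<phi>1 t x) * \<phi>1 t x) * exp (- \<phi>t t x))) (at t)"
    by (rule integral_tderiv[OF R']) (rule that)
  have "(\<lambda>x. (Q2 t x - (Q1 t x * \<phi>1 t x + Q t x * \<phi>2 t x) - (Q1 t x - Q t x * \<phi>1 t x) * \<phi>1 t x) * exp (- \<phi>t t x))
    = (\<lambda>x. (Q2 t x - 2 * (Q1 t x * \<phi>1 t x) + Q t x * ((\<phi>1 t x)\<^sup>2 - \<phi>2 t x)) * exp (- \<phi>t t x))" for t
    by (rule ext) (simp add: algebra_simps power2_eq_square)
  then show thesis
    using \<delta>1 \<delta>2 by (intro that[of "min \<delta>1 \<delta>2" ?I1]) auto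
qed

end

section \<open>Jets of matrix powers and of the weighted symmetric polynomials\<close>

primrec mat_pow1 :: "real^'n^'n \<Rightarrow> real^'n^'n \<Rightarrow> nat \<Rightarrow> real^'n^'n" where
  "mat_pow1 P P1 0 = 0"
| "mat_pow1 P P1 (Suc m) = P1 ** mat_pow P m + P ** mat_pow1 P P1 m"

text \<open>Together with \<open>mat_pow1\<close>, the second and first derivatives of a matrix
  power along a path with derivatives \<open>P1\<close> and \<open>P2\<close>. The order of the
  factors is kept, since these matrices need not commute.\<close>

primrec mat_pow2 :: "real^'n^'n \<Rightarrow> real^'n^'n \<Rightarrow> real^'n^'n \<Rightarrow> nat \<Rightarrow> real^'n^'n" where
  "mat_pow2 P P1 P2 0 = 0"
| "mat_pow2 P P1 P2 (Suc m) =
     P2 ** mat_pow P m + 2 *\<^sub>R (P1 ** mat_pow1 P P1 m) + P ** mat_pow2 P P1 P2 m"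

lemma mat_mult_zero: "(0::real^'n^'n) ** A = 0" "A ** (0::real^'n^'n) = 0"
  by (simp_all add: matrix_matrix_mult_def vec_eq_iff)

lemma mat_pow_zero: "mat_pow 0 m = (if m = 0 then mat 1 else 0)"
  by (cases m) (simp_all add: mat_mult_zero)

lemma mat_pow1_zero: "mat_pow1 0 P1 m = (if m = 1 then P1 else 0)"
  by (cases m) (simp_all add: mat_mult_zero mat_pow_zero)

text \<open>A product of more than two factors that vanish at \<open>t = 0\<close> has no second
  derivative there; this truncation removes all higher functionals.\<close>

lemma mat_pow2_zero: "mat_pow2 0 P1 P2 m = (if m = 1 then P2 else if m = 2 then 2 *\<^sub>R (P1 ** P1) else 0)"
  by (cases m) (auto simp: mat_mult_zero mat_pow_zero mat_pow1_zero)

context dominated_family begin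

definition mat_jet where
  "mat_jet P P1 P2 \<longleftrightarrow> (\<forall>i j. jet (\<lambda>t x. P t x $ i $ j) (\<lambda>t x. P1 t x $ i $ j) (\<lambda>t x. (P2 t x :: real^'m^'m) $ i $ j))"

lemma mat_jet_mult:
  fixes P P1 P2 :: "real \<Rightarrow> real^'n \<Rightarrow> real^'m::finite^'m"
  assumes "mat_jet P P1 P2" "mat_jet R R1 R2"
  shows "mat_jet (\<lambda>t x. P t x ** R t x) (\<lambda>t x. P1 t x ** R t x + P t x ** R1 t x)
    (\<lambda>t x. P2 t x ** R t x + 2 *\<^sub>R (P1 t x ** R1 t x) + P t x ** R2 t x)"
  unfolding mat_jet_def
proof (intro allI)
  fix i j
  have "jet (\<lambda>t x. \<Sum>k\<in>UNIV. P t x $ i $ k * R t x $ k $ j)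
      (\<lambda>t x. \<Sum>k\<in>UNIV. P1 t x $ i $ k * R t x $ k $ j + P t x $ i $ k * R1 t x $ k $ j)
      (\<lambda>t x. \<Sum>k\<in>UNIV. P2 t x $ i $ k * R t x $ k $ j + 2 * (P1 t x $ i $ k * R1 t x $ k $ j) + P t x $ i $ k * R2 t x $ k $ j)"
    using assms unfolding mat_jet_def by (intro jet_sum jet_mult) simp_all
  then show "jet (\<lambda>t x. (P t x ** R t x) $ i $ j) (\<lambda>t x. (P1 t x ** R t x + P t x ** R1 t x) $ i $ j)
      (\<lambda>t x. (P2 t x ** R t x + 2 *\<^sub>R (P1 t x ** R1 t x) + P t x ** R2 t x) $ i $ j)"
    by (simp add: matrix_matrix_mult_def sum.distrib sum_distrib_left)
qed

lemma mat_jet_pow: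
  assumes P: "mat_jet P P1 P2"
  shows "mat_jet (\<lambda>t x. mat_pow (P t x) m) (\<lambda>t x. mat_pow1 (P t x) (P1 t x) m)
    (\<lambda>t x. mat_pow2 (P t x) (P1 t x) (P2 t x) m)"
proof (induction m)
  case 0
  show ?case by (simp add: mat_jet_def jet_const)
next
  case (Suc m)
  show ?case using mat_jet_mult[OF P Suc.IH] by simp
qed

lemma jet_trace:
  assumes "mat_jet P P1 P2"
  shows "jet (\<lambda>t x. trace (P t x)) (\<lambda>t x. trace (P1 t x)) (\<lambda>t x. trace (P2 t x))"
  using assms unfolding mat_jet_def trace_def by (intro jet_sum) simp_all

text \<open>The hypotheses say that \<open>Y\<close> vanishes to first order at \<open>t = 0\<close>
  and the power sum \<open>p r\<close> to order min(r, 3). Through the recursion, the polynomial of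
  index \<open>m\<close> inherits vanishing to order min(m, 3), and its surviving derivatives are
  read off.\<close>

lemma jet_wsigma_ps:
  fixes Y Y1 Y2 :: "real \<Rightarrow> real^'n \<Rightarrow> real" and p p1 p2 :: "nat \<Rightarrow> real \<Rightarrow> real^'n \<Rightarrow> real"
  assumes Y: "jet Y Y1 Y2" and p: "\<And>r. jet (p r) (p1 r) (p2 r)"
    and Y0: "\<And>x. Y 0 x = 0" and p0: "\<And>r x. r \<ge> 1 \<Longrightarrow> p r 0 x = 0"
    and p10: "\<And>r x. r \<ge> 2 \<Longrightarrow> p1 r 0 x = 0" and p20: "\<And>r x. r \<ge> 3 \<Longrightarrow> p2 r 0 x = 0"
  shows "\<exists>S1 S2. jet (\<lambda>t x. wsigma_ps m (Y t x) (\<lambda>r. p r t x)) S1 S2 \<and>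
    (\<forall>x. wsigma_ps m (Y 0 x) (\<lambda>r. p r 0 x) = (if m = 0 then 1 else 0) \<and>
      S1 0 x = (if m = 1 then Y1 0 x + p1 1 0 x else 0) \<and>
      S2 0 x = (if m = 1 then Y2 0 x + p2 1 0 x else if m = 2 then (Y1 0 x + p1 1 0 x)\<^sup>2 - p2 2 0 x / 2 else 0))"
proof (induction m rule: less_induct)
  case (less m)
  let ?S = "\<lambda>m t x. wsigma_ps m (Y t x) (\<lambda>r. p r t x)"
  show ?case
  proof (cases m)
    case 0
    then show ?thesis
      by (intro exI[of _ "\<lambda>t x. 0"]) (simp add: jet_const)
  next
    case (Suc k)
    \<comment> \<open>Both derivatives are packed into one pair so that a single choice yields them
      as functions of the index.\<close>
    have "\<forall>i. \<exists>S. i \<le> k \<longrightarrow> jet (?S i) (fst S) (snd S) \<and>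
       (\<forall>x. ?S i 0 x = (if i = 0 then 1 else 0) \<and>
      fst S 0 x = (if i = 1 then Y1 0 x + p1 1 0 x else 0) \<and>
      snd S 0 x = (if i = 1 then Y2 0 x + p2 1 0 x else if i = 2 then (Y1 0 x + p1 1 0 x)\<^sup>2 - p2 2 0 x / 2 else 0))"
      using less Suc by (auto simp: less_Suc_eq_le)
    then obtain S where S: "\<And>i. i \<le> k \<Longrightarrow> jet (?S i) (fst (S i)) (snd (S i))"
      "\<And>i x. i \<le> k \<Longrightarrow> ?S i 0 x = (if i = 0 then 1 else 0)"
      "\<And>i x. i \<le> k \<Longrightarrow> fst (S i) 0 x = (if i = 1 then Y1 0 x + p1 1 0 x else 0)"
      "\<And>i x. i \<le> k \<Longrightarrow> snd (S i) 0 x = (if i = 1 then Y2 0 x + p2 1 0 x else if i = 2 then (Y1 0 x + p1 1 0 x)\<^sup>2 - p2 2 0 x / 2 else 0)"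
      unfolding choice_iff by blast
    define S1 S2 where "S1 i = fst (S i)" and "S2 i = snd (S i)" for i
    note S = S[folded S1_def S2_def]
    let ?U = "\<lambda>i t x. (-1) ^ i * (?S (k - i) t x * p (i + 1) t x)"
    let ?U1 = "\<lambda>i t x. (-1) ^ i * (S1 (k - i) t x * p (i + 1) t x + ?S (k - i) t x * p1 (i + 1) t x)"
    let ?U2 = "\<lambda>i t x. (-1) ^ i * (S2 (k - i) t x * p (i + 1) t x + 2 * (S1 (k - i) t x * p1 (i + 1) t x) + ?S (k - i) t x * p2 (i + 1) t x)"
    let ?A = "\<lambda>t x. ?S k t x * (Y t x + p 1 t x)"
    let ?A1 = "\<lambda>t x. S1 k t x * (Y t x + p 1 t x) + ?S k t x * (Y1 t x + p1 1 t x)"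
    let ?A2 = "\<lambda>t x. S2 k t x * (Y t x + p 1 t x) + 2 * (S1 k t x * (Y1 t x + p1 1 t x)) + ?S k t x * (Y2 t x + p2 1 t x)"
    let ?c = "1 / real (Suc k)"
    have jU: "jet (\<lambda>t x. \<Sum>i=1..k. ?U i t x) (\<lambda>t x. \<Sum>i=1..k. ?U1 i t x) (\<lambda>t x. \<Sum>i=1..k. ?U2 i t x)"
      by (intro jet_sum jet_cmult jet_mult S p) auto
    have jA: "jet ?A ?A1 ?A2"
      by (intro jet_mult jet_add S Y p) simp
    have "jet (\<lambda>t x. ?c * (?A t x + (\<Sum>i=1..k. ?U i t x))) (\<lambda>t x. ?c * (?A1 t x + (\<Sum>i=1..k. ?U1 i t x)))
       (\<lambda>t x. ?c * (?A2 t x + (\<Sum>i=1..k. ?U2 i t x)))"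
      by (intro jet_cmult jet_add jA jU)
    moreover have "(\<lambda>t x. ?c * (?A t x + (\<Sum>i=1..k. ?U i t x))) = ?S m"
      unfolding Suc wsigma_ps.simps by (simp add: mult.assoc)
    ultimately have j: "jet (?S m) (\<lambda>t x. ?c * (?A1 t x + (\<Sum>i=1..k. ?U1 i t x))) (\<lambda>t x. ?c * (?A2 t x + (\<Sum>i=1..k. ?U2 i t x)))"
      by simp
    have U0: "(\<Sum>i=1..k. ?U i 0 x) = 0" "(\<Sum>i=1..k. ?U1 i 0 x) = 0" for x
      by (intro sum.neutral ballI; simp add: p0 p10)+
    \<comment> \<open>Only the summand \<open>i = 1\<close> with \<open>k = 1\<close> survives:
      there the cofactor is the polynomial of index 0, equal to 1, and it multiplies the second
      derivative of \<open>p 2\<close>.\<close>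
    have U2: "(\<Sum>i=1..k. ?U2 i 0 x) = (if k = 1 then - p2 2 0 x else 0)" for x
    proof (cases "k = 1")
      case True
      then show ?thesis by (simp add: p0 p10 S(2) numeral_2_eq_2)
    next
      case False
      have "?U2 i 0 x = 0" if "i \<in> {1..k}" for i
      proof (cases "i = 1")
        case True
        then show ?thesis using that False by (simp add: p0 p10 S(2))
      next
        case i: False
        then show ?thesis using that by (simp add: p0 p10 p20)
      qed
      then show ?thesis using False by (simp add: sum.neutral)
    qed
    \<comment> \<open>For \<open>k = 1\<close> the cross term of the Leibniz rule is twice the
      square of the first derivative; the 2 cancels against the later division by
      \<open>Suc k\<close>.\<close>
    have A2: "?A2 0 x = (if k = 0 then Y2 0 x + p2 1 0 x else if k = 1 then 2 * (Y1 0 x + p1 1 0 x)\<^sup>2 else 0)" for x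
      using S(2)[of k x] S(3)[of k x] by (simp add: Y0 p0 power2_eq_square)
    have A1: "?A1 0 x = (if k = 0 then Y1 0 x + p1 1 0 x else 0)" for x
      using S(2)[of k x] by (simp add: Y0 p0)
    show ?thesis
    proof (intro exI conjI allI)
      show "jet (?S m) (\<lambda>t x. ?c * (?A1 t x + (\<Sum>i=1..k. ?U1 i t x))) (\<lambda>t x. ?c * (?A2 t x + (\<Sum>i=1..k. ?U2 i t x)))" by (rule j)
      fix x
      show "?S m 0 x = (if m = 0 then 1 else 0)"
      proof -
        have "?S m 0 x = ?c * (?A 0 x + (\<Sum>i=1..k. ?U i 0 x))"
          unfolding Suc wsigma_ps.simps by (simp add: mult.assoc)
        also have "\<dots> = 0" unfolding U0 by (simp add: Y0 p0)
        finally show ?thesis by (simp add: Suc)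
      qed
      show "?c * (?A1 0 x + (\<Sum>i=1..k. ?U1 i 0 x)) = (if m = 1 then Y1 0 x + p1 1 0 x else 0)"
        unfolding U0 A1 by (simp add: Suc)
      show "?c * (?A2 0 x + (\<Sum>i=1..k. ?U2 i 0 x)) = (if m = 1 then Y2 0 x + p2 1 0 x else if m = 2 then (Y1 0 x + p1 1 0 x)\<^sup>2 - p2 2 0 x / 2 else 0)"
        unfolding U2 A2 by (simp add: Suc field_simps)
    qed
  qed
qed

lemma jet_powr:
  assumes \<tau>: "\<And>t. \<bar>t\<bar> < \<epsilon> \<Longrightarrow> \<tau>t t > 0"
    and d1: "\<And>t. \<bar>t\<bar> < \<epsilon> \<Longrightarrow> (\<tau>t has_real_derivative \<tau>1 t) (at t)"
    and d2: "\<And>t. \<bar>t\<bar> < \<epsilon> \<Longrightarrow> (\<tau>1 has_real_derivative \<tau>2 t) (at t)"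
    and c2: "isCont \<tau>2 0"
  shows "jet (\<lambda>t x. \<tau>t t powr a) (\<lambda>t x. a * \<tau>1 t * \<tau>t t powr (a - 1))
    (\<lambda>t x. a * (\<tau>2 t * \<tau>t t powr (a - 1) + (a - 1) * (\<tau>1 t)\<^sup>2 * \<tau>t t powr (a - 2)))"
proof -
  \<comment> \<open>A function of \<open>t\<close> alone is admissible once it is bounded near 0,
    and continuity at 0 gives such a bound.\<close>
  have tame: "tame (\<lambda>t x. c t)" if c: "isCont c 0" for c
  proof -
    have "\<forall>\<^sub>F t in at 0. dist (c t) (c 0) < 1"
      using c unfolding isCont_def by (rule tendstoD) simp
    then obtain \<delta> where \<delta>: "\<delta> > 0" "\<And>t. t \<noteq> 0 \<Longrightarrow> dist t 0 < \<delta> \<Longrightarrow> dist (c t) (c 0) < 1"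
      unfolding eventually_at by auto
    have "\<bar>c t\<bar> \<le> \<bar>c 0\<bar> + 1" if "\<bar>t\<bar> < \<delta>" for t
      using \<delta>(2)[of t] that by (cases "t = 0") (auto simp: dist_real_def)
    then show ?thesis by (rule tame_time[OF \<delta>(1)])
  qed
  have c: "isCont \<tau>t 0" "isCont \<tau>1 0" "\<tau>t 0 > 0"
    using d1[of 0] d2[of 0] \<tau>[of 0] \<epsilon> by (auto intro: DERIV_isCont)
  have D: "((\<lambda>t. \<tau>t t powr b) has_real_derivative b * \<tau>1 t * \<tau>t t powr (b - 1)) (at t)" if t: "\<bar>t\<bar> < \<epsilon>" for b t
    by (rule DERIV_cong[OF DERIV_fun_powr[OF d1[OF t] \<tau>[OF t]]]) simp
  have D2: "((\<lambda>t. a * \<tau>1 t * \<tau>t t powr (a - 1)) has_real_derivative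
      a * (\<tau>2 t * \<tau>t t powr (a - 1) + (a - 1) * (\<tau>1 t)\<^sup>2 * \<tau>t t powr (a - 2))) (at t)" if t: "\<bar>t\<bar> < \<epsilon>" for t
  proof -
    have "((\<lambda>t. a * (\<tau>1 t * \<tau>t t powr (a - 1))) has_real_derivative
      a * (\<tau>2 t * \<tau>t t powr (a - 1) + (a - 1) * (\<tau>1 t)\<^sup>2 * \<tau>t t powr (a - 2))) (at t)"
      by (rule DERIV_cong[OF DERIV_cmult[OF DERIV_mult[OF d2[OF t] D[OF t]]]])
         (simp add: power2_eq_square algebra_simps)
    then show ?thesis by (simp add: mult.assoc)
  qed
  have "isCont (\<lambda>t. \<tau>t t powr b) 0" for b
    using c by (intro continuous_intros) auto
  then show ?thesis
    unfolding jet_def tderiv_def using c c2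
    by (intro conjI tame allI impI D D2) (auto intro!: continuous_intros)
qed

end

section \<open>Integration by parts for the Gaussian weight\<close>

locale gaussian_calculus =
  fixes x0 :: "real^'n::finite" and \<tau> :: real
  assumes \<tau>: "\<tau> > 0"
begin

abbreviation \<phi> :: "real^'n \<Rightarrow> real" where "\<phi> \<equiv> gaussian x0 \<tau>"

definition b :: "'n \<Rightarrow> real^'n \<Rightarrow> real" where "b i x = (x - x0) $ i / (2 * \<tau>)"

text \<open>Integration against the bare exponential: the constant prefactor of
  \<open>weight\<close> is kept out.\<close>

definition E :: "(real^'n \<Rightarrow> real) \<Rightarrow> real" where
  "E f = (LINT x|lborel. f x * exp (- \<phi> x))"

text \<open>A condition at one time, phrased with families constant in \<open>t\<close> so that the
  closure rules of the previous section carry over.\<close>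

definition mom :: "(real^'n \<Rightarrow> real) \<Rightarrow> bool" where
  "mom f \<longleftrightarrow> continuous_on UNIV f \<and> dominated_moments (\<lambda>_. \<phi>) (\<lambda>_. f)"

lemma continuous_gaussian: "continuous_on S \<phi>"
  unfolding gaussian_def by (intro continuous_intros) (use \<tau> in auto)

lemma mom_mult: "mom f \<Longrightarrow> mom g \<Longrightarrow> mom (\<lambda>x. f x * g x)"
  unfolding mom_def by (simp add: continuous_on_mult dominated_moments_mult)

lemma mom_add: "mom f \<Longrightarrow> mom g \<Longrightarrow> mom (\<lambda>x. f x + g x)"
  unfolding mom_def by (simp add: continuous_on_add dominated_moments_add)

lemma mom_integrable: assumes f: "mom f" shows "integrable lborel (\<lambda>x. f x * exp (- \<phi> x))"
proof -
  have "dominated_moments (\<lambda>_. \<phi>) (\<lambda>_. f)" using f by (simp add: mom_def)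
  from this[unfolded dominated_moments_def, THEN spec, of 1]
  obtain \<delta> g where g: "\<delta> > 0" "integrable lborel g"
    "\<forall>(t::real) x. \<bar>t\<bar> < \<delta> \<longrightarrow> norm (f x) ^ 1 * exp (- \<phi> x) \<le> g x"
    by (elim exE conjE) (rule that)
  have le: "\<bar>f x\<bar> * exp (- \<phi> x) \<le> g x" for x using g(3)[rule_format, of 0] g(1) by simp
  have "continuous_on UNIV (\<lambda>x. f x * exp (- \<phi> x))"
    using f unfolding mom_def by (intro continuous_intros continuous_gaussian) simp
  from borel_measurable_continuous_onI[OF this] show ?thesis
    by (intro Bochner_Integration.integrable_bound[OF g(2)])
       (auto simp: abs_mult intro: order_trans[OF le abs_ge_self])
qed

lemma mom_continuous: "mom f \<Longrightarrow> continuous_on UNIV f" by (simp add: mom_def)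

lemma E_add: "mom f \<Longrightarrow> mom g \<Longrightarrow> E (\<lambda>x. f x + g x) = E f + E g"
  unfolding E_def by (simp add: distrib_right mom_integrable)

lemma E_diff: "mom f \<Longrightarrow> mom g \<Longrightarrow> E (\<lambda>x. f x - g x) = E f - E g"
  unfolding E_def by (simp add: left_diff_distrib mom_integrable)

lemma E_cmult: "E (\<lambda>x. c * f x) = c * E f"
  unfolding E_def by (simp add: mult.assoc)

definition pderiv :: "(real^'n \<Rightarrow> real) \<Rightarrow> ('n \<Rightarrow> real^'n \<Rightarrow> real) \<Rightarrow> bool" where
  "pderiv f f1 \<longleftrightarrow> (\<forall>i x. ((\<lambda>s. f (x + s *\<^sub>R axis i 1)) has_real_derivative f1 i x) (at 0))"

lemma pderiv_gaussian: "pderiv \<phi> b"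
  unfolding pderiv_def
proof (intro allI)
  fix i x
  have "\<phi> (x + s *\<^sub>R axis i 1) = ((norm (x - x0))\<^sup>2 + 2 * s * (x - x0) $ i + s\<^sup>2) / (4 * \<tau>)" for s
  proof -
    have "x + s *\<^sub>R axis i 1 - x0 = (x - x0) + s *\<^sub>R axis i 1" by simp
    then show ?thesis
      unfolding gaussian_def power2_norm_eq_inner
      by (simp only: inner_add_left inner_add_right)
         (simp add: inner_axis inner_axis' power2_eq_square algebra_simps)
  qed
  moreover have "((\<lambda>s. ((norm (x - x0))\<^sup>2 + 2 * s * (x - x0) $ i + s\<^sup>2) / (4 * \<tau>)) has_real_derivative b i x) (at 0)"
    using \<tau> by (auto intro!: derivative_eq_intros simp: b_def field_simps)
  ultimately show "((\<lambda>s. \<phi> (x + s *\<^sub>R axis i 1)) has_real_derivative b i x) (at 0)" by simp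
qed

lemma pderiv_b: "pderiv (b j) (\<lambda>i x. if i = j then 1 / (2 * \<tau>) else 0)"
  unfolding pderiv_def b_def using \<tau>
  by (auto intro!: derivative_eq_intros simp: axis_def field_simps)

text \<open>Since \<open>b\<close> is the gradient of \<open>\<phi>\<close>, this is the identity
  that makes \<open>Y_t\<close> vanish on a shrinking Gaussian.\<close>

lemma sum_b_squared: "(\<Sum>i\<in>UNIV. (b i x)\<^sup>2) = \<phi> x / \<tau>"
  using \<tau> unfolding b_def gaussian_def power2_norm_eq_inner inner_vec_def
  by (simp add: power2_eq_square sum_divide_distrib[symmetric] field_simps)

text \<open>The divergence theorem for \<open>V\<close> times the Gaussian weight. Moments are asked
  of the sum of the \<open>d i\<close> only; each single \<open>d i\<close> merely has to be
  continuous.\<close>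

lemma E_divergence:
  assumes V: "\<And>i x. ((\<lambda>s. V i (x + s *\<^sub>R axis i 1)) has_real_derivative d i x) (at 0)"
    and mV: "\<And>i. mom (V i)" and mb: "\<And>i. mom (b i)" and cd: "\<And>i. continuous_on UNIV (d i)"
    and md: "mom (\<lambda>x. \<Sum>i\<in>UNIV. d i x)" and mVb: "mom (\<lambda>x. \<Sum>i\<in>UNIV. V i x * b i x)"
  shows "E (\<lambda>x. \<Sum>i\<in>UNIV. d i x) = E (\<lambda>x. \<Sum>i\<in>UNIV. V i x * b i x)"
proof -
  let ?d = "\<lambda>i x. (d i x - V i x * b i x) * exp (- \<phi> x)"
  have sum: "(\<lambda>x. \<Sum>i\<in>UNIV. ?d i x) = (\<lambda>x. (\<Sum>i\<in>UNIV. d i x) * exp (- \<phi> x) - (\<Sum>i\<in>UNIV. V i x * b i x) * exp (- \<phi> x))"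
    by (rule ext) (simp add: sum_distrib_right[symmetric] sum_subtractf left_diff_distrib)
  have "(LINT x|lborel. (\<Sum>i\<in>UNIV. ?d i x)) = 0"
  proof (rule integral_divergence_eq_0[where e = "\<lambda>i. axis i 1" and V = "\<lambda>i x. V i x * exp (- \<phi> x)"])
    fix i
    show "((\<lambda>s. V i (x + s *\<^sub>R axis i 1) * exp (- \<phi> (x + s *\<^sub>R axis i 1))) has_real_derivative ?d i x) (at 0)" for x
    proof -
      have "((\<lambda>s. - \<phi> (x + s *\<^sub>R axis i 1)) has_real_derivative - b i x) (at 0)"
        using pderiv_gaussian unfolding pderiv_def by (intro DERIV_minus) simp
      from DERIV_mult[OF V DERIV_fun_exp[OF this]]
      show ?thesis by (rule DERIV_cong) (simp add: algebra_simps)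
    qed
    show "continuous_on UNIV (\<lambda>x. V i x * exp (- \<phi> x))"
      by (intro continuous_intros mom_continuous mV continuous_gaussian)
    show "continuous_on UNIV (?d i)"
      by (intro continuous_intros mom_continuous mV mb cd continuous_gaussian)
    show "integrable lborel (\<lambda>x. V i x * exp (- \<phi> x))" by (rule mom_integrable[OF mV])
  next
    show "integrable lborel (\<lambda>x. \<Sum>i\<in>UNIV. ?d i x)"
      unfolding sum by (intro Bochner_Integration.integrable_diff mom_integrable md mVb)
  qed
  then show ?thesis
    unfolding sum E_def using mom_integrable[OF md] mom_integrable[OF mVb] by simp
qed

lemma pderiv_mult:
  "pderiv f f1 \<Longrightarrow> pderiv g g1 \<Longrightarrow> pderiv (\<lambda>x. f x * g x) (\<lambda>i x. f1 i x * g x + f x * g1 i x)"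
proof -
  assume f: "pderiv f f1" and g: "pderiv g g1"
  show ?thesis
    unfolding pderiv_def
  proof (intro allI)
    fix i x
    have d: "((\<lambda>s. f (x + s *\<^sub>R axis i 1)) has_real_derivative f1 i x) (at 0)"
      "((\<lambda>s. g (x + s *\<^sub>R axis i 1)) has_real_derivative g1 i x) (at 0)"
      using f g by (simp_all add: pderiv_def)
    show "((\<lambda>s. f (x + s *\<^sub>R axis i 1) * g (x + s *\<^sub>R axis i 1)) has_real_derivative f1 i x * g x + f x * g1 i x) (at 0)"
      by (rule DERIV_cong[OF DERIV_mult[OF d]]) simp
  qed
qed

lemma pderiv_sum:
  assumes "\<And>j. pderiv (f j) (f1 j)"
  shows "pderiv (\<lambda>x. \<Sum>j\<in>(UNIV::'m::finite set). f j x) (\<lambda>i x. \<Sum>j\<in>UNIV. f1 j i x)"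
  using assms unfolding pderiv_def by (intro allI DERIV_sum) simp

lemma pderiv_diff:
  "pderiv f f1 \<Longrightarrow> pderiv g g1 \<Longrightarrow> pderiv (\<lambda>x. f x - g x) (\<lambda>i x. f1 i x - g1 i x)"
  unfolding pderiv_def by (auto intro: DERIV_diff)

end

section \<open>The drift Laplacian and Gaussian moments\<close>

locale gaussian_moments = gaussian_calculus x0 \<tau> for x0 :: "real^'n::finite" and \<tau> +
  assumes mom_\<phi>: "mom (gaussian x0 \<tau>)" and mom_b: "mom (b i)"
begin

lemma mom_const: "mom (\<lambda>x. c)"
  using mom_\<phi> dominated_moments_bounded[of "\<lambda>_. \<phi>" "\<lambda>_. \<phi>" 1 "\<lambda>_ _. c" "\<bar>c\<bar>"]
  unfolding mom_def by simp

lemmas mom_one = mom_const[of 1]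

lemma mom_cmult: "mom f \<Longrightarrow> mom (\<lambda>x. c * f x)"
  using mom_mult[OF mom_const[of c], of f] by simp

lemma mom_diff: "mom f \<Longrightarrow> mom g \<Longrightarrow> mom (\<lambda>x. f x - g x)"
  using mom_add[OF _ mom_cmult[of g "- 1"], of f] by simp

lemma mom_sum: "finite A \<Longrightarrow> (\<And>i. i \<in> A \<Longrightarrow> mom (f i)) \<Longrightarrow> mom (\<lambda>x. \<Sum>i\<in>A. f i x)"
  by (induction A rule: finite_induct) (simp_all add: mom_const mom_add)

definition nice1 where
  "nice1 u u1 \<longleftrightarrow> mom u \<and> (\<forall>i. mom (u1 i)) \<and> pderiv u u1"

text \<open>In \<open>v2 i j\<close> the outer derivative is in direction \<open>i\<close>, as in
  \<open>hess\<close>. Symmetry in \<open>i\<close> and \<open>j\<close> is not part of the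
  notion.\<close>

definition nice2 where
  "nice2 v v1 v2 \<longleftrightarrow> nice1 v v1 \<and> (\<forall>j. nice1 (v1 j) (\<lambda>i. v2 i j))"

definition drift :: "('n \<Rightarrow> real^'n \<Rightarrow> real) \<Rightarrow> real^'n \<Rightarrow> real" where
  "drift v1 x = (\<Sum>i\<in>UNIV. b i x * v1 i x)"

text \<open>The Ornstein-Uhlenbeck operator, that is the Laplacian minus the gradient of
  \<open>\<phi>\<close> applied as a vector field.\<close>

definition OU :: "('n \<Rightarrow> real^'n \<Rightarrow> real) \<Rightarrow> ('n \<Rightarrow> 'n \<Rightarrow> real^'n \<Rightarrow> real) \<Rightarrow> real^'n \<Rightarrow> real" where
  "OU v1 v2 x = (\<Sum>i\<in>UNIV. v2 i i x) - drift v1 x"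

lemma nice2_gaussian: "nice2 \<phi> b (\<lambda>i j x. if i = j then 1 / (2 * \<tau>) else 0)"
  unfolding nice2_def nice1_def by (intro conjI allI mom_\<phi> mom_b pderiv_gaussian pderiv_b mom_const)

lemma OU_gaussian: "OU b (\<lambda>i j x. if i = j then 1 / (2 * \<tau>) else 0) x = real CARD('n) / (2 * \<tau>) - \<phi> x / \<tau>"
  using sum_b_squared[of x] by (simp add: OU_def drift_def power2_eq_square)

lemma nice1_one: "nice1 (\<lambda>x. 1) (\<lambda>i x. 0)"
  unfolding nice1_def pderiv_def by (simp add: mom_const)

lemma mom_drift: "(\<And>i. mom (v1 i)) \<Longrightarrow> mom (drift v1)"
  unfolding drift_def[abs_def] by (intro mom_sum mom_mult mom_b) simp_all

lemma mom_OU: "nice2 v v1 v2 \<Longrightarrow> mom (OU v1 v2)"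
  unfolding OU_def[abs_def] nice2_def nice1_def by (intro mom_diff mom_drift mom_sum) simp_all

text \<open>The divergence theorem for the field \<open>u\<close> times the gradient of
  \<open>v\<close>: the drift term is exactly what the weight contributes.\<close>

lemma E_by_parts:
  assumes u: "nice1 u u1" and v: "nice2 v v1 v2"
  shows "E (\<lambda>x. u x * OU v1 v2 x) = - E (\<lambda>x. \<Sum>i\<in>UNIV. u1 i x * v1 i x)"
proof -
  have m: "mom u" "mom (u1 i)" "mom (v1 i)" "mom (v2 i j)" for i j
    using u v by (simp_all add: nice1_def nice2_def)
  have p: "pderiv u u1" "pderiv (v1 j) (\<lambda>i. v2 i j)" for j
    using u v by (simp_all add: nice1_def nice2_def)
  let ?d = "\<lambda>i x. u1 i x * v1 i x + u x * v2 i i x"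
  have "E (\<lambda>x. \<Sum>i\<in>UNIV. ?d i x) = E (\<lambda>x. \<Sum>i\<in>UNIV. u x * v1 i x * b i x)"
  proof (rule E_divergence)
    show "((\<lambda>s. u (x + s *\<^sub>R axis i 1) * v1 i (x + s *\<^sub>R axis i 1)) has_real_derivative ?d i x) (at 0)" for i x
      using pderiv_mult[OF p(1) p(2)[of i]] unfolding pderiv_def by blast
  qed (intro mom_mult mom_add mom_sum mom_b mom_continuous m finite)+
  moreover have "(\<lambda>x. \<Sum>i\<in>UNIV. ?d i x) = (\<lambda>x. (\<Sum>i\<in>UNIV. u1 i x * v1 i x) + u x * (\<Sum>i\<in>UNIV. v2 i i x))"
    by (rule ext) (simp add: sum.distrib sum_distrib_left)
  moreover have "(\<lambda>x. \<Sum>i\<in>UNIV. u x * v1 i x * b i x) = (\<lambda>x. u x * drift v1 x)"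
    by (rule ext) (simp add: drift_def sum_distrib_left mult_ac)
  moreover have "E (\<lambda>x. (\<Sum>i\<in>UNIV. u1 i x * v1 i x) + u x * (\<Sum>i\<in>UNIV. v2 i i x))
      = E (\<lambda>x. \<Sum>i\<in>UNIV. u1 i x * v1 i x) + E (\<lambda>x. u x * (\<Sum>i\<in>UNIV. v2 i i x))"
    by (intro E_add mom_mult mom_sum m finite)
  moreover have "E (\<lambda>x. u x * OU v1 v2 x) = E (\<lambda>x. u x * (\<Sum>i\<in>UNIV. v2 i i x)) - E (\<lambda>x. u x * drift v1 x)"
    unfolding OU_def right_diff_distrib by (intro E_diff mom_mult mom_sum mom_drift m finite)
  ultimately show ?thesis by simp
qed

lemma E_OU: "nice2 v v1 v2 \<Longrightarrow> E (OU v1 v2) = 0"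
  using E_by_parts[OF nice1_one, of v v1 v2] by (simp add: E_def)

text \<open>Moments of \<open>\<phi>\<close> come from integrating by parts against
  \<open>\<phi>\<close> itself, relative to the unknown mass \<open>E (\<lambda>x. 1)\<close>; no
  Gaussian integral is evaluated.\<close>

lemma E_gaussian: "E \<phi> = real CARD('n) / 2 * E (\<lambda>x. 1)"
proof -
  have "E (OU b (\<lambda>i j x. if i = j then 1 / (2 * \<tau>) else 0)) = 0"
    by (rule E_OU[OF nice2_gaussian])
  moreover have "OU b (\<lambda>i j x. if i = j then 1 / (2 * \<tau>) else 0)
      = (\<lambda>x. real CARD('n) / (2 * \<tau>) * 1 - (1 / \<tau>) * \<phi> x)"
    by (rule ext) (simp add: OU_gaussian)
  ultimately have "real CARD('n) / (2 * \<tau>) * E (\<lambda>x. 1) - (1 / \<tau>) * E \<phi> = 0"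
    by (simp only: E_diff[OF mom_cmult[OF mom_one] mom_cmult[OF mom_\<phi>]] E_cmult)
  then show ?thesis using \<tau> by (simp add: field_simps)
qed

lemma E_mult_OU_gaussian:
  assumes "nice1 u u1"
  shows "E (drift u1) = E (\<lambda>x. u x * \<phi> x) / \<tau> - real CARD('n) / (2 * \<tau>) * E u"
proof -
  have mu: "mom u" using assms by (simp add: nice1_def)
  have "E (\<lambda>x. u x * OU b (\<lambda>i j x. if i = j then 1 / (2 * \<tau>) else 0) x) = - E (\<lambda>x. \<Sum>i\<in>UNIV. u1 i x * b i x)"
    by (rule E_by_parts[OF assms nice2_gaussian])
  moreover have "(\<lambda>x. u x * OU b (\<lambda>i j x. if i = j then 1 / (2 * \<tau>) else 0) x)
      = (\<lambda>x. real CARD('n) / (2 * \<tau>) * u x - (1 / \<tau>) * (u x * \<phi> x))"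
    by (rule ext) (simp add: OU_gaussian algebra_simps)
  moreover have "(\<lambda>x. \<Sum>i\<in>UNIV. u1 i x * b i x) = drift u1"
    by (rule ext) (simp add: drift_def mult.commute)
  ultimately have "real CARD('n) / (2 * \<tau>) * E u - (1 / \<tau>) * E (\<lambda>x. u x * \<phi> x) = - E (drift u1)"
    by (simp only: E_diff[OF mom_cmult[OF mu] mom_cmult[OF mom_mult[OF mu mom_\<phi>]]] E_cmult)
  then show ?thesis by simp
qed

lemma E_gaussian_squared: "E (\<lambda>x. \<phi> x * \<phi> x) = (real CARD('n) / 2 + 1) * E \<phi>"
proof -
  have "E (drift b) = E (\<lambda>x. \<phi> x * \<phi> x) / \<tau> - real CARD('n) / (2 * \<tau>) * E \<phi>"
    by (rule E_mult_OU_gaussian) (use nice2_gaussian in \<open>simp add: nice2_def\<close>)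
  moreover have "drift b = (\<lambda>x. (1 / \<tau>) * \<phi> x)"
    using sum_b_squared by (simp add: drift_def power2_eq_square fun_eq_iff)
  ultimately have "(1 / \<tau>) * E \<phi> = E (\<lambda>x. \<phi> x * \<phi> x) / \<tau> - real CARD('n) / (2 * \<tau>) * E \<phi>"
    by (simp only: E_cmult)
  then show ?thesis using \<tau> by (simp add: field_simps)
qed

end

context gaussian_moments begin

text \<open>The vector field \<open>V\<^sub>i = \<Sum>\<^sub>j v\<^sub>j v\<^sub>i\<^sub>j - v\<^sub>i \<Delta>v\<close> has a divergence free of third derivatives of \<open>v\<close>, so
  nothing has to be known about the growth of the latter.\<close>

lemma E_bochner:
  assumes v: "nice2 v v1 v2"
    and v3: "\<And>i j. pderiv (v2 i j) (\<lambda>k. v3 k i j)" "\<And>i j k. continuous_on UNIV (v3 i j k)"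
    and sym2: "\<And>i j x. v2 i j x = v2 j i x" and sym3: "\<And>i j x. v3 i i j x = v3 j i i x"
  shows "E (\<lambda>x. (OU v1 v2 x + v x / (2 * \<tau>))\<^sup>2 - (\<Sum>i\<in>UNIV. \<Sum>j\<in>UNIV. (v2 i j x)\<^sup>2))
    = - (1 / (2 * \<tau>)) * (E (\<lambda>x. \<Sum>i\<in>UNIV. (v1 i x)\<^sup>2) - 1 / (2 * \<tau>) * E (\<lambda>x. (v x)\<^sup>2))"
proof -
  define l where "l = 1 / (2 * \<tau>)"
  have m: "mom v" "mom (v1 i)" "mom (v2 i j)" for i j
    using v by (simp_all add: nice1_def nice2_def)
  have p: "pderiv v v1" "pderiv (v1 j) (\<lambda>i. v2 i j)" for j
    using v by (simp_all add: nice1_def nice2_def)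
  note mi = mom_mult mom_add mom_diff mom_sum mom_b m finite mom_cmult
  define D where "D x = (\<Sum>i\<in>UNIV. v2 i i x)" for x
  define X where "X = drift v1"
  define H where "H x = (\<Sum>i\<in>UNIV. \<Sum>j\<in>UNIV. v2 i j x * v2 i j x)" for x
  define B where "B x = (\<Sum>i\<in>UNIV. \<Sum>j\<in>UNIV. b i x * (v1 j x * v2 i j x))" for x
  define G where "G x = (\<Sum>i\<in>UNIV. v1 i x * v1 i x)" for x
  have mD: "mom D" unfolding D_def by (intro mi)
  have mX: "mom X" unfolding X_def by (intro mom_drift m)
  have mH: "mom H" unfolding H_def by (intro mi)
  have mB: "mom B" unfolding B_def by (intro mi)
  have mG: "mom G" unfolding G_def by (intro mi)
  note mm = mD mX mH mB mG m(1)
  have step1: "E (\<lambda>x. H x - D x * D x) = E (\<lambda>x. B x - D x * X x)"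
  proof -
    let ?V = "\<lambda>i x. (\<Sum>j\<in>UNIV. v1 j x * v2 i j x) - v1 i x * (\<Sum>j\<in>UNIV. v2 j j x)"
    let ?d = "\<lambda>i x. (\<Sum>j\<in>UNIV. v2 i j x * v2 i j x + v1 j x * v3 i i j x)
      - (v2 i i x * (\<Sum>j\<in>UNIV. v2 j j x) + v1 i x * (\<Sum>j\<in>UNIV. v3 i j j x))"
    have d_eq: "(\<Sum>i\<in>UNIV. ?d i x) = H x - D x * D x" for x
    proof -
      \<comment> \<open>The two families of third-derivative terms coincide after exchanging the
        sums and using \<open>sym3\<close>, so they cancel in the divergence.\<close>
      have "(\<Sum>i\<in>UNIV. \<Sum>j\<in>UNIV. v1 j x * v3 i i j x) = (\<Sum>j\<in>UNIV. \<Sum>i\<in>UNIV. v1 j x * v3 i i j x)"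
        by (rule sum.swap)
      also have "\<dots> = (\<Sum>i\<in>UNIV. v1 i x * (\<Sum>j\<in>UNIV. v3 i j j x))"
        by (simp add: sum_distrib_left sym3)
      finally show ?thesis
        by (simp add: sum_subtractf sum.distrib H_def D_def sum_distrib_right)
    qed
    have V_eq: "(\<Sum>i\<in>UNIV. ?V i x * b i x) = B x - D x * X x" for x
    proof -
      have "(\<Sum>i\<in>UNIV. ?V i x * b i x) = (\<Sum>i\<in>UNIV. (\<Sum>j\<in>UNIV. v1 j x * v2 i j x) * b i x) - (\<Sum>i\<in>UNIV. v1 i x * D x * b i x)"
        by (simp only: left_diff_distrib sum_subtractf D_def)
      also have "(\<Sum>i\<in>UNIV. (\<Sum>j\<in>UNIV. v1 j x * v2 i j x) * b i x) = B x"
        by (simp add: B_def sum_distrib_left sum_distrib_right mult_ac)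
      also have "(\<Sum>i\<in>UNIV. v1 i x * D x * b i x) = D x * X x"
        by (simp add: X_def drift_def sum_distrib_left mult_ac)
      finally show ?thesis .
    qed
    have "E (\<lambda>x. \<Sum>i\<in>UNIV. ?d i x) = E (\<lambda>x. \<Sum>i\<in>UNIV. ?V i x * b i x)"
    proof (rule E_divergence)
      fix i
      have "pderiv (?V i) (\<lambda>k x. (\<Sum>j\<in>UNIV. v2 k j x * v2 i j x + v1 j x * v3 k i j x)
        - (v2 k i x * (\<Sum>j\<in>UNIV. v2 j j x) + v1 i x * (\<Sum>j\<in>UNIV. v3 k j j x)))"
        by (intro pderiv_diff pderiv_sum pderiv_mult p v3)
      then show "((\<lambda>s. ?V i (x + s *\<^sub>R axis i 1)) has_real_derivative ?d i x) (at 0)" for x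
        unfolding pderiv_def by (elim allE)
      show "mom (?V i)" by (intro mi)
      show "mom (b i)" by (rule mom_b)
      show "continuous_on UNIV (?d i)" by (intro continuous_intros mom_continuous m v3)
    next
      show "mom (\<lambda>x. \<Sum>i\<in>UNIV. ?d i x)" unfolding d_eq by (intro mom_diff mom_mult mm)
      show "mom (\<lambda>x. \<Sum>i\<in>UNIV. ?V i x * b i x)" unfolding V_eq by (intro mom_diff mom_mult mm)
    qed
    then show ?thesis unfolding d_eq V_eq .
  qed
  \<comment> \<open>The Hessian of \<open>\<phi>\<close> is \<open>l\<close> times the identity, so
    the gradient of the drift splits into \<open>l\<close> times the gradient of \<open>v\<close>
    and a Hessian term. The latter produces the same \<open>B\<close> as above, and the two
    cancel.\<close>
  have step2: "E (\<lambda>x. X x * OU v1 v2 x) = - E (\<lambda>x. l * G x + B x)"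
  proof -
    let ?X1 = "\<lambda>i x. \<Sum>j\<in>UNIV. (if i = j then 1 / (2 * \<tau>) else 0) * v1 j x + b j x * v2 i j x"
    have "nice1 X ?X1"
      unfolding nice1_def
    proof (intro conjI allI)
      show "mom X" by (rule mX)
      show "mom (?X1 i)" for i by (intro mi)
      show "pderiv X ?X1" unfolding X_def drift_def[abs_def] by (intro pderiv_sum pderiv_mult pderiv_b p)
    qed
    from E_by_parts[OF this v]
    have "E (\<lambda>x. X x * OU v1 v2 x) = - E (\<lambda>x. \<Sum>i\<in>UNIV. ?X1 i x * v1 i x)" .
    moreover have "(\<Sum>i\<in>UNIV. ?X1 i x * v1 i x) = l * G x + B x" for x
    proof -
      have "?X1 i x = l * v1 i x + (\<Sum>j\<in>UNIV. b j x * v2 i j x)" for i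
        by (simp add: sum.distrib l_def if_distrib[of "\<lambda>c. c * _"] cong: if_cong)
      then have "(\<Sum>i\<in>UNIV. ?X1 i x * v1 i x) = (\<Sum>i\<in>UNIV. (l * v1 i x + (\<Sum>j\<in>UNIV. b j x * v2 i j x)) * v1 i x)"
        by (simp only:)
      also have "\<dots> = l * G x + (\<Sum>i\<in>UNIV. \<Sum>j\<in>UNIV. b j x * (v1 i x * v2 i j x))"
        by (simp only: distrib_right sum.distrib) (simp add: G_def sum_distrib_left sum_distrib_right mult_ac)
      also have "(\<Sum>i\<in>UNIV. \<Sum>j\<in>UNIV. b j x * (v1 i x * v2 i j x)) = B x"
        unfolding B_def by (subst sum.swap) (simp add: sym2)
      finally show ?thesis .
    qed
    ultimately show ?thesis by simp
  qed
  have step3: "E (\<lambda>x. v x * OU v1 v2 x) = - E G"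
    using E_by_parts[OF conjunct1[OF v[unfolded nice2_def]] v] by (simp add: G_def[abs_def])
  have mO: "mom (OU v1 v2)" by (rule mom_OU[OF v])
  have m1: "mom (\<lambda>x. v x * OU v1 v2 x)" and m2: "mom (\<lambda>x. v x * v x)" and m3: "mom (\<lambda>x. H x - D x * D x)"
    and m4: "mom (\<lambda>x. D x * X x)" and m5: "mom (\<lambda>x. X x * OU v1 v2 x)"
    by (intro mom_mult mom_diff mm mO)+
  have s1: "E (\<lambda>x. H x - D x * D x) = E B - E (\<lambda>x. D x * X x)"
    unfolding step1 by (rule E_diff[OF mB m4])
  have s2: "E (\<lambda>x. X x * OU v1 v2 x) = - (l * E G + E B)"
    unfolding step2 E_add[OF mom_cmult[OF mG] mB] by (simp only: E_cmult)
  have alg: "2 * l * (- g) + l\<^sup>2 * w - (c - d + (d + - (l * g + c))) = - l * (g - l * w)" for g w c d :: real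
    by (simp add: power2_eq_square algebra_simps)
  have OU: "OU v1 v2 x = D x - X x" for x by (simp add: OU_def D_def X_def)
  have eq: "(\<lambda>x. (OU v1 v2 x + v x / (2 * \<tau>))\<^sup>2 - (\<Sum>i\<in>UNIV. \<Sum>j\<in>UNIV. (v2 i j x)\<^sup>2))
    = (\<lambda>x. ((2 * l) * (v x * OU v1 v2 x) + l\<^sup>2 * (v x * v x)) - ((H x - D x * D x) + (D x * X x + X x * OU v1 v2 x)))"
    by (rule ext) (simp add: OU H_def l_def power2_eq_square algebra_simps)
  have "E (\<lambda>x. (OU v1 v2 x + v x / (2 * \<tau>))\<^sup>2 - (\<Sum>i\<in>UNIV. \<Sum>j\<in>UNIV. (v2 i j x)\<^sup>2))
      = (2 * l) * E (\<lambda>x. v x * OU v1 v2 x) + l\<^sup>2 * E (\<lambda>x. v x * v x)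
      - (E (\<lambda>x. H x - D x * D x) + (E (\<lambda>x. D x * X x) + E (\<lambda>x. X x * OU v1 v2 x)))"
    unfolding eq
    by (simp only: E_diff[OF mom_add[OF mom_cmult[OF m1] mom_cmult[OF m2]] mom_add[OF m3 mom_add[OF m4 m5]]]
        E_add[OF mom_cmult[OF m1] mom_cmult[OF m2]] E_add[OF m3 mom_add[OF m4 m5]] E_add[OF m4 m5] E_cmult)
  also have "\<dots> = - l * (E G - l * E (\<lambda>x. v x * v x))"
    unfolding s1 s2 step3 by (rule alg)
  finally have "E (\<lambda>x. (OU v1 v2 x + v x / (2 * \<tau>))\<^sup>2 - (\<Sum>i\<in>UNIV. \<Sum>j\<in>UNIV. (v2 i j x)\<^sup>2))
      = - l * (E G - l * E (\<lambda>x. v x * v x))" .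
  then show ?thesis unfolding l_def G_def[abs_def] power2_eq_square .
qed

end

section \<open>The second variation of the first functional\<close>

context gaussian_moments begin

text \<open>\<open>\<psi>\<close> and \<open>h\<close> stand for the first and second variation of
  \<open>\<phi>\<close>, and \<open>k\<close> and \<open>r\<close> for the first two derivatives of
  the scale divided by the scale. As \<open>E\<close> annihilates \<open>OU h1 h2\<close>, only
  \<open>E h\<close> matters, and \<open>Eh\<close> expresses it by first-order data. All terms in
  \<open>k\<close> and \<open>r\<close> then cancel, leaving a quadratic form in
  \<open>v\<close>.\<close>

lemma E_second_variation:
  fixes k r :: real
  assumes v: "nice2 v v1 v2" and h: "nice2 h h1 h2"
    and \<psi>: "\<And>x. \<psi> x = v x - k * \<phi> x" and \<psi>1: "\<And>i x. \<psi>1 i x = v1 i x - k * b i x"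
    and s1: "\<And>x. s1 x = OU v1 v2 x + v x / (2 * \<tau>)"
    and s2: "\<And>x. s2 x = OU h1 h2 x + h x / (2 * \<tau>) - (\<Sum>i\<in>UNIV. (\<psi>1 i x)\<^sup>2) - k / \<tau> * \<psi> x
      + (k\<^sup>2 / \<tau> - r / (2 * \<tau>)) * (\<phi> x - real CARD('n))"
    and Ev: "E v = 0"
    and Eh: "E h = (real CARD('n) / 2 * (real CARD('n) / 2 + 1) * k\<^sup>2 - real CARD('n) / 2 * r) * E (\<lambda>x. 1)
      + real CARD('n) * k * E \<psi> + E (\<lambda>x. (\<psi> x)\<^sup>2)"
  shows "E s1 = 0" and "mom s1" and "mom s2"
    and "E s2 - 2 * E (\<lambda>x. s1 x * \<psi> x) = E (\<lambda>x. \<Sum>i\<in>UNIV. (v1 i x)\<^sup>2) - E (\<lambda>x. (v x)\<^sup>2) / (2 * \<tau>)"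
proof -
  define N where "N = real CARD('n) / 2"
  define l where "l = 1 / (2 * \<tau>)"
  have n1: "nice1 v v1" using v by (simp add: nice2_def)
  have m: "mom v" "mom (v1 i)" "mom h" for i
    using v h by (simp_all add: nice1_def nice2_def)
  have mO: "mom (OU v1 v2)" "mom (OU h1 h2)" by (rule mom_OU[OF v], rule mom_OU[OF h])
  define G where "G x = (\<Sum>i\<in>UNIV. v1 i x * v1 i x)" for x
  have mG: "mom G" unfolding G_def by (intro mom_sum mom_mult m finite)
  define X where "X = E (\<lambda>x. v x * \<phi> x)"
  define e where "e = E (\<lambda>x. 1)"
  have mvp: "mom (\<lambda>x. v x * \<phi> x)" and mvv: "mom (\<lambda>x. v x * v x)" and mpp: "mom (\<lambda>x. \<phi> x * \<phi> x)"
    and mvO: "mom (\<lambda>x. v x * OU v1 v2 x)" and mpO: "mom (\<lambda>x. \<phi> x * OU v1 v2 x)"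
    by (intro mom_mult m mom_\<phi> mO)+
  have mdr: "mom (drift v1)" by (intro mom_drift m)
  have Ep: "E \<phi> = N * e" unfolding N_def e_def by (rule E_gaussian)
  have Epp: "E (\<lambda>x. \<phi> x * \<phi> x) = (N + 1) * (N * e)"
    using E_gaussian_squared unfolding Ep N_def .
  have Edr: "E (drift v1) = X / \<tau>"
    using E_mult_OU_gaussian[OF n1] by (simp add: Ev X_def)
  have EpO: "E (\<lambda>x. \<phi> x * OU v1 v2 x) = - X / \<tau>"
  proof -
    have "nice1 \<phi> b" using nice2_gaussian by (simp add: nice2_def)
    from E_by_parts[OF this v] have "E (\<lambda>x. \<phi> x * OU v1 v2 x) = - E (drift v1)"
      unfolding drift_def[abs_def] .
    then show ?thesis by (simp add: Edr)
  qed
  have EvO: "E (\<lambda>x. v x * OU v1 v2 x) = - E G"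
    using E_by_parts[OF n1 v] unfolding G_def[abs_def] .
  have \<psi>': "\<psi> = (\<lambda>x. v x - k * \<phi> x)" using \<psi> by (rule ext)
  have m\<psi>: "mom \<psi>" unfolding \<psi>' by (intro mom_diff mom_cmult m mom_\<phi>)
  have E\<psi>: "E \<psi> = - k * (N * e)"
    unfolding \<psi>' E_diff[OF m(1) mom_cmult[OF mom_\<phi>]] E_cmult Ev Ep by simp
  have E\<psi>2: "E (\<lambda>x. (\<psi> x)\<^sup>2) = E (\<lambda>x. v x * v x) - 2 * k * X + k\<^sup>2 * ((N + 1) * (N * e))"
  proof -
    have "(\<lambda>x. (\<psi> x)\<^sup>2) = (\<lambda>x. (v x * v x - (2 * k) * (v x * \<phi> x)) + k\<^sup>2 * (\<phi> x * \<phi> x))"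
      by (rule ext) (simp add: \<psi> power2_eq_square algebra_simps)
    then show ?thesis
      by (simp only: E_add[OF mom_diff[OF mvv mom_cmult[OF mvp]] mom_cmult[OF mpp]]
          E_diff[OF mvv mom_cmult[OF mvp]] E_cmult Epp X_def)
  qed
  have s1': "s1 = (\<lambda>x. OU v1 v2 x + l * v x)" using s1 by (intro ext) (simp add: l_def)
  show ms1: "mom s1" unfolding s1' by (intro mom_add mom_cmult mO m)
  show Es1: "E s1 = 0"
    unfolding s1' E_add[OF mO(1) mom_cmult[OF m(1)]] E_cmult E_OU[OF v] Ev by simp
  have Es1\<psi>: "E (\<lambda>x. s1 x * \<psi> x) = - E G + l * E (\<lambda>x. v x * v x) + k * X * l"
  proof -
    have "(\<lambda>x. s1 x * \<psi> x) = (\<lambda>x. (v x * OU v1 v2 x + l * (v x * v x)) - (k * (\<phi> x * OU v1 v2 x) + (k * l) * (v x * \<phi> x)))"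
      by (rule ext) (simp add: \<psi> s1' algebra_simps)
    then have "E (\<lambda>x. s1 x * \<psi> x) = E (\<lambda>x. v x * OU v1 v2 x) + l * E (\<lambda>x. v x * v x)
        - (k * E (\<lambda>x. \<phi> x * OU v1 v2 x) + (k * l) * X)"
      by (simp only: E_diff[OF mom_add[OF mvO mom_cmult[OF mvv]] mom_add[OF mom_cmult[OF mpO] mom_cmult[OF mvp]]]
          E_add[OF mvO mom_cmult[OF mvv]] E_add[OF mom_cmult[OF mpO] mom_cmult[OF mvp]] E_cmult X_def)
    then show ?thesis unfolding EvO EpO using \<tau> by (simp add: l_def field_simps)
  qed
  define G\<psi> where "G\<psi> x = (\<Sum>i\<in>UNIV. (\<psi>1 i x)\<^sup>2)" for x
  have G\<psi>: "G\<psi> = (\<lambda>x. (G x - (2 * k) * drift v1 x) + (k\<^sup>2 / \<tau>) * \<phi> x)"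
  proof
    fix x
    have "G\<psi> x = (\<Sum>i\<in>UNIV. v1 i x * v1 i x - (2 * k) * (b i x * v1 i x) + k\<^sup>2 * (b i x)\<^sup>2)"
      unfolding G\<psi>_def \<psi>1 by (intro sum.cong refl) (simp add: power2_eq_square algebra_simps)
    also have "\<dots> = (G x - (2 * k) * drift v1 x) + k\<^sup>2 * (\<Sum>i\<in>UNIV. (b i x)\<^sup>2)"
      by (simp only: sum.distrib sum_subtractf sum_distrib_left G_def drift_def)
    finally show "G\<psi> x = (G x - (2 * k) * drift v1 x) + (k\<^sup>2 / \<tau>) * \<phi> x"
      by (simp add: sum_b_squared)
  qed
  have mG\<psi>: "mom G\<psi>" unfolding G\<psi> by (intro mom_add mom_diff mom_cmult mG mdr mom_\<phi>)
  have EG\<psi>: "E G\<psi> = E G - 2 * k * (X / \<tau>) + k\<^sup>2 / \<tau> * (N * e)"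
    unfolding G\<psi> by (simp only: E_add[OF mom_diff[OF mG mom_cmult[OF mdr]] mom_cmult[OF mom_\<phi>]]
        E_diff[OF mG mom_cmult[OF mdr]] E_cmult Edr Ep)
  define c where "c = k\<^sup>2 / \<tau> - r / (2 * \<tau>)"
  have s2': "s2 = (\<lambda>x. ((OU h1 h2 x + l * h x) - G\<psi> x) - (k / \<tau>) * \<psi> x + (c * \<phi> x - (c * (2 * N)) * 1))"
    by (rule ext) (simp add: s2 l_def N_def c_def G\<psi>_def algebra_simps)
  have mh: "mom (\<lambda>x. OU h1 h2 x + l * h x)" by (intro mom_add mom_cmult mO m)
  have mh': "mom (\<lambda>x. (OU h1 h2 x + l * h x) - G\<psi> x)" by (intro mom_diff mh mG\<psi>)
  have mh'': "mom (\<lambda>x. ((OU h1 h2 x + l * h x) - G\<psi> x) - (k / \<tau>) * \<psi> x)" by (intro mom_diff mh' mom_cmult m\<psi>)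
  have mc: "mom (\<lambda>x. c * \<phi> x - (c * (2 * N)) * 1)" by (intro mom_diff mom_cmult mom_\<phi> mom_one)
  show "mom s2" unfolding s2' by (intro mom_add mh'' mc)
  \<comment> \<open>The summand 0 is the mean of \<open>OU h1 h2\<close>.\<close>
  have "E s2 = (((0 + l * E h) - E G\<psi>) - (k / \<tau>) * E \<psi>) + (c * E \<phi> - (c * (2 * N)) * e)"
    unfolding s2' E_add[OF mh'' mc] E_diff[OF mh' mom_cmult[OF m\<psi>]] E_diff[OF mh mG\<psi>]
      E_add[OF mO(2) mom_cmult[OF m(3)]] E_diff[OF mom_cmult[OF mom_\<phi>] mom_cmult[OF mom_one]] E_OU[OF h] e_def
    by (simp only: E_cmult)
  moreover have Eh': "E h = (N * (N + 1) * k\<^sup>2 - N * r) * e + 2 * N * k * E \<psi> + E (\<lambda>x. (\<psi> x)\<^sup>2)"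
    unfolding Eh e_def N_def by simp
  moreover have d: "a / \<tau> = 2 * l * a" for a using \<tau> by (simp add: l_def)
  moreover have c: "c = 2 * l * k\<^sup>2 - l * r" using \<tau> by (simp add: c_def l_def)
  ultimately have "E s2 = l * E (\<lambda>x. v x * v x) - E G + k / \<tau> * X"
    unfolding Eh' EG\<psi> E\<psi>2 E\<psi> Ep c d by (simp add: power2_eq_square algebra_simps)
  then have "E s2 - 2 * E (\<lambda>x. s1 x * \<psi> x) = E G - l * E (\<lambda>x. v x * v x)"
    unfolding Es1\<psi> using \<tau> by (simp add: l_def field_simps)
  then show "E s2 - 2 * E (\<lambda>x. s1 x * \<psi> x) = E (\<lambda>x. \<Sum>i\<in>UNIV. (v1 i x)\<^sup>2) - E (\<lambda>x. (v x)\<^sup>2) / (2 * \<tau>)"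
    unfolding G_def[abs_def] power2_eq_square l_def by simp
qed

end

section \<open>Variations of the shrinking Gaussian\<close>

locale gaussian_variation =
  fixes x0 :: "real^'n::finite" and \<tau> \<epsilon> :: real
    and \<phi>t :: "real \<Rightarrow> real^'n \<Rightarrow> real" and \<tau>t :: "real \<Rightarrow> real"
  assumes \<tau>_pos: "\<tau> > 0" and \<epsilon>_pos: "\<epsilon> > 0"
    and variation: "smooth_variation (gaussian x0 \<tau>) \<tau> \<epsilon> \<phi>t \<tau>t"
    and dominated: "dominated_variation \<phi>t"

sublocale gaussian_variation \<subseteq> smooth_family \<phi>t \<epsilon>
proof
  show "0 < \<epsilon>" by (rule \<epsilon>_pos)
  show "smooth_on ({-\<epsilon><..<\<epsilon>} \<times> UNIV) (\<lambda>(t, x). \<phi>t t x)"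
    using variation unfolding smooth_variation_def by (elim conjE)
qed

sublocale gaussian_variation \<subseteq> dominated_family \<phi>t "\<lambda>t x. \<Phi> 1 (t, x)" "\<lambda>t x. \<Phi> 2 (t, x)" \<epsilon>
proof
  show "0 < \<epsilon>" by (rule \<epsilon>_pos)
  show "dominated_moments \<phi>t \<phi>t"
    using dominated unfolding dominated_variation_def by (metis t_deriv_0 le0)
qed

section \<open>The integrands along the variation as jets\<close>

context gaussian_variation begin

definition pd :: "nat \<Rightarrow> 'n \<Rightarrow> real \<Rightarrow> real^'n \<Rightarrow> real" where
  "pd m i t x = dx i (\<Phi> m) (t, x)"

definition hs :: "nat \<Rightarrow> 'n \<Rightarrow> 'n \<Rightarrow> real \<Rightarrow> real^'n \<Rightarrow> real" where
  "hs m i j t x = dx i (dx j (\<Phi> m)) (t, x)"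

lemma tame_slice:
  assumes \<Psi>: "smooth_on S \<Psi>" and Q: "dominated_moments \<phi>t Q"
    and le: "\<And>t x. \<bar>t\<bar> < \<epsilon> \<Longrightarrow> \<bar>\<Psi> (t, x)\<bar> \<le> norm (Q t x)"
  shows "tame (\<lambda>t x. \<Psi> (t, x))"
proof -
  have "dominated_moments \<phi>t (\<lambda>t x. \<Psi> (t, x))"
    by (rule dominated_moments_mono[OF Q \<epsilon>_pos]) (simp add: le)
  then show ?thesis
    unfolding tame_def using continuous_slice[OF \<Psi>] by simp
qed

lemma tame_\<Phi>: "m \<le> 2 \<Longrightarrow> tame (\<lambda>t x. \<Phi> m (t, x))"
  by (rule tame_slice[OF smooth_\<Phi>, of "t_deriv m \<phi>t"])
     (use dominated in \<open>simp_all add: dominated_variation_def t_deriv_eq\<close>)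

lemma tame_pd: assumes "m \<le> 2" shows "tame (pd m i)"
  unfolding pd_def[abs_def]
proof (rule tame_slice[OF smooth_on_fdrv[OF smooth_\<Phi>]])
  show "dominated_moments \<phi>t (\<lambda>t. grad (t_deriv m \<phi>t t))"
    using dominated assms by (simp add: dominated_variation_def)
  fix t x assume t: "\<bar>t\<bar> < \<epsilon>"
  show "\<bar>dx i (\<Phi> m) (t, x)\<bar> \<le> norm (grad (t_deriv m \<phi>t t) x)"
    unfolding grad_slice[OF t, symmetric] real_norm_def[symmetric] by (rule Finite_Cartesian_Product.norm_nth_le)
qed

lemma tame_hs: assumes "m \<le> 2" shows "tame (hs m i j)"
  unfolding hs_def[abs_def]
proof (rule tame_slice[OF smooth_on_fdrv[OF smooth_on_fdrv[OF smooth_\<Phi>]]])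
  show "dominated_moments \<phi>t (\<lambda>t. hess (t_deriv m \<phi>t t))"
    using dominated assms by (simp add: dominated_variation_def)
  fix t x assume t: "\<bar>t\<bar> < \<epsilon>"
  show "\<bar>dx i (dx j (\<Phi> m)) (t, x)\<bar> \<le> norm (hess (t_deriv m \<phi>t t) x)"
    unfolding hess_slice[OF t, symmetric] real_norm_def[symmetric]
    by (rule order_trans[OF Finite_Cartesian_Product.norm_nth_le Finite_Cartesian_Product.norm_nth_le])
qed

lemma tderiv_slice:
  assumes "smooth_on S \<Psi>" shows "tderiv (\<lambda>t x. \<Psi> (t, x)) (\<lambda>t x. dt \<Psi> (t, x))"
  unfolding tderiv_def using DERIV_dt[OF assms] by simp

lemma tderiv_cong:
  assumes "tderiv Q R" "\<And>t x. \<bar>t\<bar> < \<epsilon> \<Longrightarrow> R t x = R' t x" shows "tderiv Q R'"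
  using assms unfolding tderiv_def by simp

lemma jet_\<Phi>: "jet (\<lambda>t x. \<Phi> 0 (t, x)) (\<lambda>t x. \<Phi> 1 (t, x)) (\<lambda>t x. \<Phi> 2 (t, x))"
proof -
  have "tderiv (\<lambda>t x. \<Phi> m (t, x)) (\<lambda>t x. \<Phi> (Suc m) (t, x))" for m
    unfolding \<Phi>_Suc by (rule tderiv_slice[OF smooth_\<Phi>])
  from this[of 0] this[of "Suc 0"] show ?thesis
    unfolding jet_def One_nat_def numeral_2_eq_2 by (intro conjI tame_\<Phi>) simp_all
qed

lemma dt_dx: "\<bar>t\<bar> < \<epsilon> \<Longrightarrow> dt (dx i (\<Phi> m)) (t, x) = dx i (\<Phi> (Suc m)) (t, x)"
  unfolding \<Phi>_Suc by (rule commute[OF smooth_\<Phi>])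

lemma jet_pd: "jet (pd 0 i) (pd 1 i) (pd 2 i)"
proof -
  have "tderiv (pd m i) (pd (Suc m) i)" for m
    unfolding pd_def[abs_def]
    by (rule tderiv_cong[OF tderiv_slice[OF smooth_on_fdrv[OF smooth_\<Phi>]] dt_dx])
  then show ?thesis
    unfolding jet_def One_nat_def numeral_2_eq_2 by (intro conjI tame_pd) simp_all
qed

text \<open>The inner exchange of \<open>t\<close> and \<open>x\<close> has to be differentiated
  once more in \<open>x\<close>. Passing to \<open>partial\<close> on the slice at fixed
  \<open>t\<close> makes it an equality of functions, which may be substituted.\<close>

lemma jet_hs: "jet (hs 0 i j) (hs 1 i j) (hs 2 i j)"
proof -
  have "dt (dx i (dx j (\<Phi> m))) (t, x) = dx i (dx j (\<Phi> (Suc m))) (t, x)" if t: "\<bar>t\<bar> < \<epsilon>" for m t x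
  proof -
    have "dt (dx i (dx j (\<Phi> m))) (t, x) = dx i (dt (dx j (\<Phi> m))) (t, x)"
      by (rule commute[OF smooth_on_fdrv[OF smooth_\<Phi>] t])
    also have "\<dots> = partial i (\<lambda>y. dt (dx j (\<Phi> m)) (t, y)) x"
      by (simp only: partial_slice[OF smooth_on_fdrv[OF smooth_on_fdrv[OF smooth_\<Phi>]] t])
    also have "(\<lambda>y. dt (dx j (\<Phi> m)) (t, y)) = (\<lambda>y. dx j (\<Phi> (Suc m)) (t, y))"
      by (simp only: dt_dx[OF t])
    also have "partial i \<dots> x = dx i (dx j (\<Phi> (Suc m))) (t, x)"
      by (simp only: partial_slice[OF smooth_on_fdrv[OF smooth_\<Phi>] t])
    finally show ?thesis .
  qed
  then have "tderiv (hs m i j) (hs (Suc m) i j)" for m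
    unfolding hs_def[abs_def]
    by (intro tderiv_cong[OF tderiv_slice[OF smooth_on_fdrv[OF smooth_on_fdrv[OF smooth_\<Phi>]]]]) simp
  then show ?thesis
    unfolding jet_def One_nat_def numeral_2_eq_2 by (intro conjI tame_hs) simp_all
qed

definition \<tau>1 where "\<tau>1 = fdrv \<tau>t 1"
definition \<tau>2 where "\<tau>2 = fdrv \<tau>1 1"

lemma smooth_\<tau>: "smooth_on {-\<epsilon><..<\<epsilon>} \<tau>t" "smooth_on {-\<epsilon><..<\<epsilon>} \<tau>1" "smooth_on {-\<epsilon><..<\<epsilon>} \<tau>2"
proof -
  show 1: "smooth_on {-\<epsilon><..<\<epsilon>} \<tau>t" using variation unfolding smooth_variation_def by (elim conjE)
  show 2: "smooth_on {-\<epsilon><..<\<epsilon>} \<tau>1" unfolding \<tau>1_def by (rule smooth_on_fdrv[OF 1])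
  show "smooth_on {-\<epsilon><..<\<epsilon>} \<tau>2" unfolding \<tau>2_def by (rule smooth_on_fdrv[OF 2])
qed

lemma DERIV_fdrv_real:
  fixes f :: "real \<Rightarrow> real"
  assumes "smooth_on {-\<epsilon><..<\<epsilon>} f" "\<bar>t\<bar> < \<epsilon>"
  shows "(f has_real_derivative fdrv f 1 t) (at t)"
proof -
  have eq: "0 + s *\<^sub>R 1 = s" for s :: real by simp
  have "f differentiable (at (0 + t *\<^sub>R 1))"
    unfolding eq by (rule smooth_on_differentiable[OF assms(1)]) (use assms(2) in \<open>simp add: abs_less_iff\<close>)
  from DERIV_fdrv_line[OF this] show ?thesis unfolding eq .
qed

lemma DERIV_\<tau>:
  "\<bar>t\<bar> < \<epsilon> \<Longrightarrow> (\<tau>t has_real_derivative \<tau>1 t) (at t)"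
  "\<bar>t\<bar> < \<epsilon> \<Longrightarrow> (\<tau>1 has_real_derivative \<tau>2 t) (at t)"
proof -
  show "\<bar>t\<bar> < \<epsilon> \<Longrightarrow> (\<tau>t has_real_derivative \<tau>1 t) (at t)"
    unfolding \<tau>1_def by (rule DERIV_fdrv_real[OF smooth_\<tau>(1)])
  show "\<bar>t\<bar> < \<epsilon> \<Longrightarrow> (\<tau>1 has_real_derivative \<tau>2 t) (at t)"
    unfolding \<tau>2_def by (rule DERIV_fdrv_real[OF smooth_\<tau>(2)])
qed

lemma in_C1: "\<bar>t\<bar> < \<epsilon> \<Longrightarrow> \<tau>t t > 0 \<and> (LINT x|lborel. weight (\<phi>t t) (\<tau>t t) x) = 1"
  using variation unfolding smooth_variation_def C1_def by (simp add: abs_less_iff)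

lemma at_0: "\<phi>t 0 = gaussian x0 \<tau>" "\<tau>t 0 = \<tau>" "\<bar>0::real\<bar> < \<epsilon>"
  using variation \<epsilon>_pos unfolding smooth_variation_def by simp_all

text \<open>One form for all powers of the scale: the exponent -1 occurs in \<open>Y_t\<close> and
  \<open>Ric_t\<close>, and \<open>j\<close> minus half the dimension in the prefactor of
  \<open>W_fun\<close>.\<close>

definition u where "u a t = \<tau>t t powr a"
definition u1 where "u1 a t = a * \<tau>1 t * \<tau>t t powr (a - 1)"
definition u2 where "u2 a t = a * (\<tau>2 t * \<tau>t t powr (a - 1) + (a - 1) * (\<tau>1 t)\<^sup>2 * \<tau>t t powr (a - 2))"

lemma jet_u: "jet (\<lambda>t x. u a t) (\<lambda>t x. u1 a t) (\<lambda>t x. u2 a t)"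
  unfolding u_def u1_def u2_def
proof (rule jet_powr)
  show "isCont \<tau>2 0"
    using smooth_on_continuous[OF smooth_\<tau>(3)] \<epsilon>_pos by (simp add: continuous_on_eq_continuous_at)
qed (use in_C1 DERIV_\<tau> in simp_all)

text \<open>With \<open>k\<close> and \<open>r\<close>, the first two derivatives of
  \<open>u a\<close> at 0 are multiples of \<open>u a 0\<close>, so the common prefactor can be
  divided out.\<close>

definition k where "k = \<tau>1 0 / \<tau>"
definition r where "r = \<tau>2 0 / \<tau>"

lemma u_0: "u a 0 = \<tau> powr a" "u1 a 0 = a * k * u a 0" "u2 a 0 = (a * r + a * (a - 1) * k\<^sup>2) * u a 0"
proof -
  have p: "\<tau> powr (a - 1) = \<tau> powr a / \<tau>" "\<tau> powr (a - 2) = \<tau> powr a / \<tau>\<^sup>2"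
    using \<tau>_pos by (simp_all add: powr_diff powr_numeral)
  show "u a 0 = \<tau> powr a" by (simp add: u_def at_0)
  show "u1 a 0 = a * k * u a 0" by (simp add: u1_def u_def at_0 p k_def)
  show "u2 a 0 = (a * r + a * (a - 1) * k\<^sup>2) * u a 0"
    using \<tau>_pos by (simp add: u2_def u_def at_0 p k_def r_def field_simps power2_eq_square)
qed

lemma u_minus_1: "\<bar>t\<bar> < \<epsilon> \<Longrightarrow> u (- 1) t = 1 / \<tau>t t"
  using in_C1[of t] by (simp add: u_def powr_minus_divide)

text \<open>Written as sums of products, with \<open>Y1\<close> and \<open>Y2\<close> left
  unsimplified: this is the literal output of the rules for \<open>jet\<close>.\<close>

definition Yj where
  "Yj t x = - (1 / 2) * (\<Sum>i\<in>UNIV. pd 0 i t x * pd 0 i t x) + 1 / 2 * (u (- 1) t * \<Phi> 0 (t, x))"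
definition Y1 where
  "Y1 t x = - (1 / 2) * (\<Sum>i\<in>UNIV. pd 1 i t x * pd 0 i t x + pd 0 i t x * pd 1 i t x)
    + 1 / 2 * (u1 (- 1) t * \<Phi> 0 (t, x) + u (- 1) t * \<Phi> 1 (t, x))"
definition Y2 where
  "Y2 t x = - (1 / 2) * (\<Sum>i\<in>UNIV. pd 2 i t x * pd 0 i t x + 2 * (pd 1 i t x * pd 1 i t x) + pd 0 i t x * pd 2 i t x)
    + 1 / 2 * (u2 (- 1) t * \<Phi> 0 (t, x) + 2 * (u1 (- 1) t * \<Phi> 1 (t, x)) + u (- 1) t * \<Phi> 2 (t, x))"

lemma jet_Y: "jet Yj Y1 Y2"
  unfolding Yj_def[abs_def] Y1_def[abs_def] Y2_def[abs_def]
  by (intro jet_add jet_cmult jet_sum jet_mult jet_pd jet_u jet_\<Phi> finite)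

definition Pj :: "real \<Rightarrow> real^'n \<Rightarrow> real^'n^'n" where
  "Pj t x = (\<chi> i j. hs 0 i j t x - (if i = j then 1 / 2 else 0) * u (- 1) t)"
definition P1 :: "real \<Rightarrow> real^'n \<Rightarrow> real^'n^'n" where
  "P1 t x = (\<chi> i j. hs 1 i j t x - (if i = j then 1 / 2 else 0) * u1 (- 1) t)"
definition P2 :: "real \<Rightarrow> real^'n \<Rightarrow> real^'n^'n" where
  "P2 t x = (\<chi> i j. hs 2 i j t x - (if i = j then 1 / 2 else 0) * u2 (- 1) t)"

lemma mat_jet_P: "mat_jet Pj P1 P2"
  unfolding mat_jet_def Pj_def P1_def P2_def vec_lambda_beta
  by (intro allI jet_diff jet_cmult jet_hs jet_u)

lemma Y_t_eq: assumes t: "\<bar>t\<bar> < \<epsilon>" shows "Y_t (\<phi>t t) (\<tau>t t) x = Yj t x"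
proof -
  have "grad (\<phi>t t) x $ i = pd 0 i t x" for i
    using grad_slice[OF t, of 0 x i] by (simp add: t_deriv_0 pd_def)
  then have "(norm (grad (\<phi>t t) x))\<^sup>2 = (\<Sum>i\<in>UNIV. pd 0 i t x * pd 0 i t x)"
    by (simp add: power2_norm_eq_inner inner_vec_def)
  then show ?thesis by (simp add: Y_t_def Yj_def u_minus_1[OF t] algebra_simps)
qed

lemma Ric_t_eq: assumes t: "\<bar>t\<bar> < \<epsilon>" shows "Ric_t (\<phi>t t) (\<tau>t t) x = Pj t x"
proof -
  have "hess (\<phi>t t) x $ i $ j = hs 0 i j t x" for i j
    using hess_slice[OF t, of 0 x i j] by (simp add: t_deriv_0 hs_def)
  then show ?thesis by (simp add: Ric_t_def Pj_def u_minus_1[OF t] vec_eq_iff mat_def)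
qed

lemma hs_sym: "\<bar>t\<bar> < \<epsilon> \<Longrightarrow> hs m i j t x = hs m j i t x"
  unfolding hs_def by (rule commute[OF smooth_\<Phi>])

lemma sigma_t_eq:
  assumes t: "\<bar>t\<bar> < \<epsilon>"
  shows "sigma_t j (\<phi>t t) (\<tau>t t) x = wsigma_ps j (Yj t x) (\<lambda>r. trace (mat_pow (Pj t x) r))"
proof -
  have "transpose (Pj t x) = Pj t x"
    using hs_sym[OF t] by (simp add: Pj_def transpose_def vec_eq_iff)
  then show ?thesis
    unfolding sigma_t_def Y_t_eq[OF t] Ric_t_eq[OF t] by (rule wsigma_endo_eq_wsigma_ps)
qed

definition cn where "cn = (4 * pi) powr (- real CARD('n) / 2)"

lemma weight_eq: "\<bar>t\<bar> < \<epsilon> \<Longrightarrow> weight (\<phi>t t) (\<tau>t t) x = cn * u (- real CARD('n) / 2) t * exp (- \<phi>t t x)"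
  using in_C1[of t] by (simp add: weight_def cn_def u_def powr_mult)

lemma W_fun_eq:
  assumes t: "\<bar>t\<bar> < \<epsilon>"
  shows "W_fun j (\<phi>t t) (\<tau>t t) = (LINT x|lborel. (cn * u (real j - real CARD('n) / 2) t) *
    wsigma_ps j (Yj t x) (\<lambda>r. trace (mat_pow (Pj t x) r)) * exp (- \<phi>t t x))"
proof -
  have "\<tau>t t ^ j * u (- real CARD('n) / 2) t = u (real j - real CARD('n) / 2) t"
    using in_C1[OF t] by (simp add: u_def powr_realpow[symmetric] powr_add[symmetric])
  then show ?thesis
    unfolding W_fun_def weight_eq[OF t] sigma_t_eq[OF t]
    by (intro Bochner_Integration.integral_cong refl) (simp add: mult_ac)
qed

end

sublocale gaussian_variation \<subseteq> gaussian_calculus x0 \<tau>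
  by standard (rule \<tau>_pos)

section \<open>Values at time 0 and the mass constraint\<close>

context gaussian_variation begin

lemma \<Phi>_0_at_0: "\<Phi> 0 (0, x) = \<phi> x" by (simp add: at_0)

lemma tame_mom: "tame Q \<Longrightarrow> mom (Q 0)"
  using dominated_moments_at_0[of \<phi>t Q] at_0 unfolding tame_def mom_def by simp

lemma pd_0_at_0: "pd 0 i 0 x = b i x"
proof -
  have "((\<lambda>s. \<Phi> 0 (0, x + s *\<^sub>R axis i 1)) has_real_derivative pd 0 i 0 x) (at 0)"
    unfolding pd_def by (rule DERIV_dx[OF smooth_\<Phi> at_0(3)])
  then have "((\<lambda>s. \<phi> (x + s *\<^sub>R axis i 1)) has_real_derivative pd 0 i 0 x) (at 0)"
    by (simp only: \<Phi>_0_at_0)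
  moreover have "((\<lambda>s. \<phi> (x + s *\<^sub>R axis i 1)) has_real_derivative b i x) (at 0)"
    using pderiv_gaussian unfolding pderiv_def by simp
  ultimately show ?thesis by (rule DERIV_unique)
qed

lemma hs_0_at_0: "hs 0 i j 0 x = (if i = j then 1 / (2 * \<tau>) else 0)"
proof -
  have "((\<lambda>s. dx j (\<Phi> 0) (0, x + s *\<^sub>R axis i 1)) has_real_derivative hs 0 i j 0 x) (at 0)"
    unfolding hs_def by (rule DERIV_dx[OF smooth_on_fdrv[OF smooth_\<Phi>] at_0(3)])
  then have "((\<lambda>s. b j (x + s *\<^sub>R axis i 1)) has_real_derivative hs 0 i j 0 x) (at 0)"
    by (simp only: pd_def[symmetric] pd_0_at_0)
  moreover have "((\<lambda>s. b j (x + s *\<^sub>R axis i 1)) has_real_derivative (if i = j then 1 / (2 * \<tau>) else 0)) (at 0)"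
    using pderiv_b unfolding pderiv_def by simp
  ultimately show ?thesis by (rule DERIV_unique)
qed

end

sublocale gaussian_variation \<subseteq> gaussian_moments x0 \<tau>
proof
  show "mom \<phi>" using tame_mom[OF tame_\<Phi>[of 0]] by (simp only: \<Phi>_0_at_0)
  show "mom (b i)" for i
  proof -
    have "pd 0 i 0 = b i" by (rule ext) (rule pd_0_at_0)
    then show ?thesis using tame_mom[OF tame_pd[of 0 i]] by simp
  qed
qed

context gaussian_moments begin

lemma nice1_add_scaled:
  assumes "nice1 v v1" "nice1 w w1"
  shows "nice1 (\<lambda>x. v x + c * w x) (\<lambda>i x. v1 i x + c * w1 i x)"
  unfolding nice1_def
proof (intro conjI allI mom_add mom_cmult)
  show "pderiv (\<lambda>x. v x + c * w x) (\<lambda>i x. v1 i x + c * w1 i x)"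
    using assms unfolding nice1_def pderiv_def by (intro allI DERIV_add DERIV_cmult) simp_all
qed (use assms in \<open>simp_all add: nice1_def\<close>)

lemma nice2_add_scaled:
  assumes "nice2 v v1 v2" "nice2 w w1 w2"
  shows "nice2 (\<lambda>x. v x + c * w x) (\<lambda>i x. v1 i x + c * w1 i x) (\<lambda>i j x. v2 i j x + c * w2 i j x)"
  unfolding nice2_def
  by (intro conjI allI nice1_add_scaled) (use assms in \<open>simp_all add: nice2_def\<close>)

end

context gaussian_variation begin

lemma nice2_\<Phi>:
  assumes m: "m \<le> 2"
  shows "nice2 (\<lambda>x. \<Phi> m (0, x)) (\<lambda>i. pd m i 0) (\<lambda>i j. hs m i j 0)"
  unfolding nice2_def nice1_def
proof (intro conjI allI)
  show "mom (\<lambda>x. \<Phi> m (0, x))" by (rule tame_mom[OF tame_\<Phi>[OF m]])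
  show "mom (pd m i 0)" "mom (pd m i 0)" for i by (rule tame_mom[OF tame_pd[OF m]])+
  show "mom (hs m i j 0)" for i j by (rule tame_mom[OF tame_hs[OF m]])
  show "pderiv (\<lambda>x. \<Phi> m (0, x)) (\<lambda>i. pd m i 0)"
    unfolding pderiv_def pd_def by (intro allI DERIV_dx[OF smooth_\<Phi> at_0(3)])
  show "pderiv (pd m j 0) (\<lambda>i. hs m i j 0)" for j
    unfolding pderiv_def pd_def hs_def by (intro allI DERIV_dx[OF smooth_on_fdrv[OF smooth_\<Phi>] at_0(3)])
qed

text \<open>\<open>v\<close> is the first variation of \<open>\<phi>\<close> relative to that of the Gaussian with fixed centre and scale
  \<open>\<tau>\<^sub>t\<close>, which is \<open>- k \<phi>\<close>.\<close>

definition v where "v x = \<Phi> 1 (0, x) + k * \<phi> x"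
definition v1 where "v1 i x = pd 1 i 0 x + k * b i x"
definition v2 where "v2 i j x = hs 1 i j 0 x + k * (if i = j then 1 / (2 * \<tau>) else 0)"
definition v3 where "v3 l i j x = dx l (dx i (dx j (\<Phi> 1))) (0, x)"

lemma nice2_v: "nice2 v v1 v2"
  using nice2_add_scaled[OF nice2_\<Phi>[of 1] nice2_gaussian, of k]
  unfolding v_def[abs_def] v1_def[abs_def] v2_def[abs_def] by simp

lemma v2_sym: "v2 i j x = v2 j i x"
  using hs_sym[OF at_0(3)] by (simp add: v2_def)

lemma pderiv_v2: "pderiv (v2 i j) (\<lambda>l. v3 l i j)"
  unfolding pderiv_def
proof (intro allI)
  fix l x
  have "((\<lambda>s. dx i (dx j (\<Phi> 1)) (0, x + s *\<^sub>R axis l 1)) has_real_derivative v3 l i j x) (at 0)"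
    unfolding v3_def by (rule DERIV_dx[OF smooth_on_fdrv[OF smooth_on_fdrv[OF smooth_\<Phi>]] at_0(3)])
  from DERIV_add[OF this DERIV_const[of "k * (if i = j then 1 / (2 * \<tau>) else 0)"]]
  show "((\<lambda>s. v2 i j (x + s *\<^sub>R axis l 1)) has_real_derivative v3 l i j x) (at 0)"
    unfolding v2_def hs_def by simp
qed

lemma continuous_v3: "continuous_on UNIV (v3 l i j)"
  unfolding v3_def[abs_def]
  by (rule continuous_slice[OF smooth_on_fdrv[OF smooth_on_fdrv[OF smooth_on_fdrv[OF smooth_\<Phi>]]] at_0(3)])

text \<open>Two exchanges of neighbouring derivatives. The first sits under an outer
  \<open>x\<close>-derivative and is carried out on the slice at time 0.\<close>

lemma v3_sym: "v3 i i j x = v3 j i i x"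
proof -
  have s: "smooth_on S (dx i (\<Phi> 1))" "smooth_on S (dx i (dx j (\<Phi> 1)))" "smooth_on S (dx j (dx i (\<Phi> 1)))"
    by (intro smooth_on_fdrv smooth_\<Phi>)+
  have "v3 i i j x = partial i (\<lambda>y. dx i (dx j (\<Phi> 1)) (0, y)) x"
    unfolding v3_def by (simp only: partial_slice[OF s(2) at_0(3)])
  also have "(\<lambda>y. dx i (dx j (\<Phi> 1)) (0, y)) = (\<lambda>y. dx j (dx i (\<Phi> 1)) (0, y))"
    by (rule ext) (rule commute[OF smooth_\<Phi> at_0(3)])
  also have "partial i \<dots> x = dx i (dx j (dx i (\<Phi> 1))) (0, x)"
    by (simp only: partial_slice[OF s(3) at_0(3)])
  also have "\<dots> = v3 j i i x"
    unfolding v3_def by (rule commute[OF s(1) at_0(3)])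
  finally show ?thesis .
qed

text \<open>First derivative at time 0 of the polynomial of index 1, which is \<open>Y\<close> plus
  the trace of the matrix; \<open>s2\<close> is the second derivative.\<close>

definition s1 where "s1 x = Y1 0 x + trace (P1 0 x)"
definition s2 where "s2 x = Y2 0 x + trace (P2 0 x)"

lemma u_minus_1_at_0: "u (- 1) 0 = 1 / \<tau>" "u1 (- 1) 0 = - k / \<tau>" "u2 (- 1) 0 = (2 * k\<^sup>2 - r) / \<tau>"
  using u_minus_1[OF at_0(3)] by (simp_all add: u_0(2,3) at_0 field_simps)

lemma Yj_at_0: "Yj 0 x = 0"
proof -
  have "(\<Sum>i\<in>UNIV. pd 0 i 0 x * pd 0 i 0 x) = \<phi> x / \<tau>"
    using sum_b_squared by (simp add: pd_0_at_0 power2_eq_square)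
  then show ?thesis unfolding Yj_def u_minus_1_at_0 \<Phi>_0_at_0 by simp
qed

lemma Pj_at_0: "Pj 0 x = 0"
  unfolding Pj_def u_minus_1_at_0 hs_0_at_0 by (simp add: vec_eq_iff)

lemma P1_at_0: "P1 0 x = (\<chi> i j. v2 i j x)"
  unfolding P1_def v2_def u_minus_1_at_0 by (simp add: vec_eq_iff)

text \<open>The expression is linear in the first variation of the pair. Along Gaussians of fixed
  centre and scale \<open>\<tau>t\<close> both \<open>Y\<close> and the matrix stay zero, so that
  part contributes nothing and only \<open>v\<close> remains.\<close>

lemma s1_eq: "s1 x = OU v1 v2 x + v x / (2 * \<tau>)"
proof -
  have "(\<Sum>i\<in>UNIV. b i x * v1 i x) = (\<Sum>i\<in>UNIV. b i x * pd 1 i 0 x) + k * (\<phi> x / \<tau>)"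
    unfolding v1_def sum_b_squared[symmetric]
    by (simp add: distrib_left sum.distrib sum_distrib_left power2_eq_square mult_ac)
  moreover have "(\<Sum>i\<in>UNIV. pd 1 i 0 x * pd 0 i 0 x + pd 0 i 0 x * pd 1 i 0 x) = 2 * (\<Sum>i\<in>UNIV. b i x * pd 1 i 0 x)"
    by (simp add: pd_0_at_0 sum_distrib_left mult_ac)
  moreover have "trace (P1 0 x) = (\<Sum>i\<in>UNIV. v2 i i x)"
    by (simp add: P1_at_0 trace_def)
  ultimately show ?thesis
    unfolding s1_def Y1_def OU_def drift_def v_def u_minus_1_at_0 \<Phi>_0_at_0
    using \<tau>_pos by (simp add: field_simps)
qed

lemma s2_eq: "s2 x = OU (\<lambda>i. pd 2 i 0) (\<lambda>i j. hs 2 i j 0) x + \<Phi> 2 (0, x) / (2 * \<tau>)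
   - (\<Sum>i\<in>UNIV. (pd 1 i 0 x)\<^sup>2) - k / \<tau> * \<Phi> 1 (0, x) + (k\<^sup>2 / \<tau> - r / (2 * \<tau>)) * (\<phi> x - real CARD('n))"
proof -
  have "(\<Sum>i\<in>UNIV. pd 2 i 0 x * pd 0 i 0 x + 2 * (pd 1 i 0 x * pd 1 i 0 x) + pd 0 i 0 x * pd 2 i 0 x)
      = 2 * ((\<Sum>i\<in>UNIV. b i x * pd 2 i 0 x) + (\<Sum>i\<in>UNIV. (pd 1 i 0 x)\<^sup>2))"
    by (simp add: pd_0_at_0 sum.distrib sum_distrib_left power2_eq_square mult_ac)
  moreover have "trace (P2 0 x) = (\<Sum>i\<in>UNIV. hs 2 i i 0 x) - real CARD('n) * ((2 * k\<^sup>2 - r) / (2 * \<tau>))"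
    unfolding P2_def u_minus_1_at_0 trace_def by (simp add: sum_subtractf)
  ultimately show ?thesis
    unfolding s2_def Y2_def OU_def drift_def u_minus_1_at_0 \<Phi>_0_at_0
    by (simp add: algebra_simps diff_divide_distrib add_divide_distrib)
qed

lemma jet_\<phi>: "jet \<phi>t (\<lambda>t x. \<Phi> 1 (t, x)) (\<lambda>t x. \<Phi> 2 (t, x))"
  using jet_\<Phi> by simp

lemma E_eq: "(LINT x|lborel. f x * exp (- \<phi>t 0 x)) = E f"
  by (simp add: E_def at_0)

text \<open>The total mass is constantly 1, so its first two derivatives vanish; the positive factor
  \<open>cn * u a 0\<close> is divided out.\<close>

lemma mass_variations:
  defines "a \<equiv> - real CARD('n) / 2"
  shows "E (\<lambda>x. a * k - \<Phi> 1 (0, x)) = 0"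
    and "E (\<lambda>x. (a * r + a * (a - 1) * k\<^sup>2) - 2 * (a * k * \<Phi> 1 (0, x)) + ((\<Phi> 1 (0, x))\<^sup>2 - \<Phi> 2 (0, x))) = 0"
proof -
  let ?c = "cn * u a 0"
  have c: "?c \<noteq> 0" using \<tau>_pos by (simp add: u_0 cn_def)
  have jQ: "jet (\<lambda>t x. cn * u a t) (\<lambda>t x. cn * u1 a t) (\<lambda>t x. cn * u2 a t)"
    by (intro jet_cmult jet_u)
  have mass: "(LINT x|lborel. cn * u a t * exp (- \<phi>t t x)) = 1" if "\<bar>t\<bar> < \<epsilon>" for t
    using in_C1[OF that] unfolding weight_eq[OF that] a_def by simp
  have tq: "tame (\<lambda>t x. cn * u a t)" "tame (\<lambda>t x. cn * u1 a t)" "tderiv (\<lambda>t x. cn * u a t) (\<lambda>t x. cn * u1 a t)"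
    using jQ by (simp_all add: jet_def)
  have tp: "tame \<phi>t" "tame (\<lambda>t x. \<Phi> 1 (t, x))" "tderiv \<phi>t (\<lambda>t x. \<Phi> 1 (t, x))"
    using jet_\<phi> by (simp_all add: jet_def)
  have one: "\<forall>\<^sub>F t in nhds 0. (LINT x|lborel. cn * u a t * exp (- \<phi>t t x)) = 1"
  proof (rule eventually_mono)
    show "\<forall>\<^sub>F t in nhds 0. t \<in> {-\<epsilon><..<\<epsilon>}" using \<epsilon>_pos by (intro eventually_nhds_in_open) auto
  qed (rule mass, auto)
  obtain \<delta> I1 where d: "\<delta> > 0" "\<And>t. \<bar>t\<bar> < \<delta> \<Longrightarrow>
      ((\<lambda>s. LINT x|lborel. cn * u a s * exp (- \<phi>t s x)) has_real_derivative I1 t) (at t)"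
    "\<And>t. \<bar>t\<bar> < \<delta> \<Longrightarrow> (I1 has_real_derivative
      (LINT x|lborel. (cn * u2 a t - 2 * (cn * u1 a t * \<Phi> 1 (t, x)) + cn * u a t * ((\<Phi> 1 (t, x))\<^sup>2 - \<Phi> 2 (t, x))) * exp (- \<phi>t t x))) (at t)"
    by (rule integral_jet[OF jQ jet_\<phi>]) (rule that)
  \<comment> \<open>The first derivative must vanish on a whole neighbourhood of 0, since it is
    differentiated again.\<close>
  have I1: "I1 t = 0" if t: "\<bar>t\<bar> < min \<delta> \<epsilon>" for t
  proof -
    have "\<forall>\<^sub>F s in nhds t. (LINT x|lborel. cn * u a s * exp (- \<phi>t s x)) = 1"
    proof (rule eventually_mono)
      show "\<forall>\<^sub>F s in nhds t. s \<in> {-\<epsilon><..<\<epsilon>}" using t by (intro eventually_nhds_in_open) auto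
    qed (rule mass, auto)
    then have "((\<lambda>s. LINT x|lborel. cn * u a s * exp (- \<phi>t s x)) has_real_derivative 0) (at t)"
      by (subst DERIV_cong_ev[OF refl _ refl, where g = "\<lambda>_. 1"]) simp_all
    moreover have "((\<lambda>s. LINT x|lborel. cn * u a s * exp (- \<phi>t s x)) has_real_derivative I1 t) (at t)"
      using t by (intro d(2)) simp
    ultimately show ?thesis by (rule DERIV_unique[symmetric])
  qed
  have "\<forall>\<^sub>F s in nhds 0. s \<in> {- min \<delta> \<epsilon><..<min \<delta> \<epsilon>}"
    using d(1) \<epsilon>_pos by (intro eventually_nhds_in_open) auto
  then have "\<forall>\<^sub>F s in nhds 0. I1 s = 0"
    by (rule eventually_mono) (rule I1, auto simp: abs_less_iff)
  then have "(I1 has_real_derivative 0) (at 0)"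
    by (subst DERIV_cong_ev[OF refl _ refl, where g = "\<lambda>_. 0"]) simp_all
  from DERIV_unique[OF this d(3)[of 0]] d(1)
  have "E (\<lambda>x. cn * u2 a 0 - 2 * (cn * u1 a 0 * \<Phi> 1 (0, x)) + ?c * ((\<Phi> 1 (0, x))\<^sup>2 - \<Phi> 2 (0, x))) = 0"
    unfolding E_eq by simp
  moreover have "(\<lambda>x. cn * u2 a 0 - 2 * (cn * u1 a 0 * \<Phi> 1 (0, x)) + ?c * ((\<Phi> 1 (0, x))\<^sup>2 - \<Phi> 2 (0, x)))
    = (\<lambda>x. ?c * ((a * r + a * (a - 1) * k\<^sup>2) - 2 * (a * k * \<Phi> 1 (0, x)) + ((\<Phi> 1 (0, x))\<^sup>2 - \<Phi> 2 (0, x))))"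
    unfolding u_0(2,3) by (rule ext) (simp add: algebra_simps)
  ultimately show "E (\<lambda>x. (a * r + a * (a - 1) * k\<^sup>2) - 2 * (a * k * \<Phi> 1 (0, x)) + ((\<Phi> 1 (0, x))\<^sup>2 - \<Phi> 2 (0, x))) = 0"
    using c by (simp only: E_cmult) simp
  \<comment> \<open>\<open>integral_jet\<close> hides the formula for the first derivative, so it is
    computed separately here.\<close>
  obtain \<delta>' where d': "\<delta>' > 0" "\<And>t. \<bar>t\<bar> < \<delta>' \<Longrightarrow>
    ((\<lambda>s. LINT x|lborel. cn * u a s * exp (- \<phi>t s x)) has_real_derivative
      (LINT x|lborel. (cn * u1 a t - cn * u a t * \<Phi> 1 (t, x)) * exp (- \<phi>t t x))) (at t)"
    by (rule integral_tderiv[OF tq tp]) (rule that)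
  have "((\<lambda>s. LINT x|lborel. cn * u a s * exp (- \<phi>t s x)) has_real_derivative 0) (at 0)"
    using one by (subst DERIV_cong_ev[OF refl _ refl, where g = "\<lambda>_. 1"]) simp_all
  from DERIV_unique[OF this d'(2)[of 0]] d'(1)
  have "E (\<lambda>x. cn * u1 a 0 - ?c * \<Phi> 1 (0, x)) = 0" unfolding E_eq by simp
  moreover have "(\<lambda>x. cn * u1 a 0 - ?c * \<Phi> 1 (0, x)) = (\<lambda>x. ?c * (a * k - \<Phi> 1 (0, x)))"
    unfolding u_0(2) by (rule ext) (simp add: algebra_simps)
  ultimately show "E (\<lambda>x. a * k - \<Phi> 1 (0, x)) = 0"
    using c by (simp only: E_cmult) simp
qed

end

text \<open>Only \<open>i = m\<close> and \<open>i = m - 1\<close> contribute. Both carry the power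
  \<open>(1 / 2) ^ m\<close> once the factor -1/2 is absorbed, and their partial sums differ by the
  single term \<open>(-1) ^ m / fact m\<close>.\<close>

lemma W_hat_coefficient:
  "(\<Sum>i<Suc m. ((1 / 2) ^ i * (\<Sum>l\<le>i. (-1) ^ l / fact l)) *
      (if Suc m - i = 1 then 1 else if Suc m - i = 2 then - 1 / 2 else 0 :: real))
    = (- 1 / 2) ^ m / fact m"
proof (cases m)
  case (Suc n)
  define c where "c i = ((1 / 2) ^ i * (\<Sum>l\<le>i. (-1) ^ l / fact l) :: real)" for i
  define d where "d i = (if Suc m - i = 1 then 1 else if Suc m - i = 2 then - 1 / 2 else 0 :: real)" for i
  have "(\<Sum>i<n. c i * d i) = 0"
    by (intro sum.neutral) (auto simp: d_def Suc)
  then have "(\<Sum>i<Suc m. c i * d i) = c n * (- 1 / 2) + c (Suc n)"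
    unfolding Suc sum.lessThan_Suc by (simp add: d_def Suc)
  also have "\<dots> = (1 / 2) ^ Suc n * ((-1) ^ Suc n / fact (Suc n))"
    unfolding c_def sum.atMost_Suc power_Suc[of "1 / 2"] by (simp only: algebra_simps)
  also have "\<dots> = (- 1 / 2) ^ m / fact m"
    unfolding Suc times_divide_eq_right power_mult_distrib[symmetric] by simp
  finally show ?thesis unfolding c_def d_def .
qed simp

section \<open>Second derivatives of the functionals\<close>

context gaussian_variation begin

definition deficit :: real where
  "deficit = E (\<lambda>x. \<Sum>i\<in>UNIV. (v1 i x)\<^sup>2) - E (\<lambda>x. (v x)\<^sup>2) / (2 * \<tau>)"

lemma mom_\<Phi>: "m \<le> 2 \<Longrightarrow> mom (\<lambda>x. \<Phi> m (0, x))"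
  by (rule tame_mom[OF tame_\<Phi>])

lemma mom_\<Phi>1: "mom (\<lambda>x. \<Phi> 1 (0, x))"
  by (rule mom_\<Phi>) simp

lemma E_\<Phi>1: "E (\<lambda>x. \<Phi> 1 (0, x)) = - real CARD('n) / 2 * k * E (\<lambda>x. 1)"
proof -
  have "E (\<lambda>x. (- real CARD('n) / 2 * k) * 1 - \<Phi> 1 (0, x)) = 0"
    using mass_variations(1) by simp
  then have "(- real CARD('n) / 2 * k) * E (\<lambda>x. 1) - E (\<lambda>x. \<Phi> 1 (0, x)) = 0"
    by (simp only: E_diff[OF mom_cmult[OF mom_one] mom_\<Phi>1] E_cmult)
  then show ?thesis by simp
qed

lemma E_v: "E v = 0"
proof -
  have "E v = E (\<lambda>x. \<Phi> 1 (0, x)) + k * E \<phi>"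
    unfolding v_def[abs_def] by (simp only: E_add[OF mom_\<Phi>1 mom_cmult[OF mom_\<phi>]] E_cmult)
  then show ?thesis unfolding E_\<Phi>1 E_gaussian by simp
qed

lemma E_\<Phi>2: "E (\<lambda>x. \<Phi> 2 (0, x)) = (real CARD('n) / 2 * (real CARD('n) / 2 + 1) * k\<^sup>2 - real CARD('n) / 2 * r) * E (\<lambda>x. 1)
      + real CARD('n) * k * E (\<lambda>x. \<Phi> 1 (0, x)) + E (\<lambda>x. (\<Phi> 1 (0, x))\<^sup>2)"
proof -
  define a where "a = - real CARD('n) / 2"
  have m: "mom (\<lambda>x. \<Phi> 1 (0, x))" "mom (\<lambda>x. \<Phi> 2 (0, x))" by (rule mom_\<Phi>, simp)+
  have m2: "mom (\<lambda>x. (\<Phi> 1 (0, x))\<^sup>2)" unfolding power2_eq_square by (intro mom_mult m)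
  have "E (\<lambda>x. ((a * r + a * (a - 1) * k\<^sup>2) * 1 - (2 * a * k) * \<Phi> 1 (0, x)) + ((\<Phi> 1 (0, x))\<^sup>2 - \<Phi> 2 (0, x))) = 0"
    using mass_variations(2) by (simp add: a_def mult.assoc)
  then have "((a * r + a * (a - 1) * k\<^sup>2) * E (\<lambda>x. 1) - (2 * a * k) * E (\<lambda>x. \<Phi> 1 (0, x)))
      + (E (\<lambda>x. (\<Phi> 1 (0, x))\<^sup>2) - E (\<lambda>x. \<Phi> 2 (0, x))) = 0"
    by (simp only: E_add[OF mom_diff[OF mom_cmult[OF mom_one] mom_cmult[OF m(1)]] mom_diff[OF m2 m(2)]]
        E_diff[OF mom_cmult[OF mom_one] mom_cmult[OF m(1)]] E_diff[OF m2 m(2)] E_cmult)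
  then show ?thesis by (simp add: a_def algebra_simps)
qed

lemma first_functional:
  "E s1 = 0" "mom s1" "mom s2"
  "E s2 - 2 * E (\<lambda>x. s1 x * \<Phi> 1 (0, x)) = deficit"
proof -
  have \<psi>: "\<Phi> 1 (0, x) = v x - k * \<phi> x" for x by (simp add: v_def)
  have \<psi>1: "pd 1 i 0 x = v1 i x - k * b i x" for i x by (simp add: v1_def)
  have two: "(2::nat) \<le> 2" by simp
  note * = E_second_variation[where v = v and ?v1.0 = v1 and ?v2.0 = v2 and h = "\<lambda>x. \<Phi> 2 (0, x)"
      and ?h1.0 = "\<lambda>i. pd 2 i 0" and ?h2.0 = "\<lambda>i j. hs 2 i j 0" and \<psi> = "\<lambda>x. \<Phi> 1 (0, x)"
      and ?\<psi>1.0 = "\<lambda>i. pd 1 i 0" and ?s1.0 = s1 and ?s2.0 = s2 and k = k and r = r,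
      OF nice2_v nice2_\<Phi>[OF two] \<psi> \<psi>1 s1_eq s2_eq E_v E_\<Phi>2]
  show "E s1 = 0" "mom s1" "mom s2" "E s2 - 2 * E (\<lambda>x. s1 x * \<Phi> 1 (0, x)) = deficit"
    unfolding deficit_def by (rule *)+
qed

lemma second_functional:
  "E (\<lambda>x. (s1 x)\<^sup>2 - trace (P1 0 x ** P1 0 x)) = - (1 / (2 * \<tau>)) * deficit"
proof -
  have "trace (P1 0 x ** P1 0 x) = (\<Sum>i\<in>UNIV. \<Sum>j\<in>UNIV. (v2 i j x)\<^sup>2)" for x
  proof -
    have "v2 i j x * v2 j i x = (v2 i j x)\<^sup>2" for i j
      using v2_sym[of i j x] by (simp add: power2_eq_square)
    then show ?thesis by (simp add: P1_at_0 trace_def matrix_matrix_mult_def)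
  qed
  then show ?thesis
    using E_bochner[OF nice2_v pderiv_v2 continuous_v3 v2_sym v3_sym]
    by (simp add: s1_eq deficit_def)
qed

text \<open>For \<open>j \<ge> 1\<close> the polynomial vanishes at \<open>t = 0\<close>, so every
  term in which both derivatives fall on the weight or prefactor drops out. The term with one
  derivative on the prefactor is a multiple of \<open>E s1\<close> for \<open>j = 1\<close>, hence
  zero, and absent for larger \<open>j\<close>.\<close>

lemma W_fun_second_derivative:
  assumes j: "j \<ge> 1"
  shows "\<exists>I1. (\<forall>\<^sub>F t in nhds 0. ((\<lambda>s. W_fun j (\<phi>t s) (\<tau>t s)) has_real_derivative I1 t) (at t)) \<and>
    (I1 has_real_derivative (cn * u (1 - real CARD('n) / 2) 0 * deficit) *
      (if j = 1 then 1 else if j = 2 then - 1 / 2 else 0)) (at 0)"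
proof -
  define a where "a = real j - real CARD('n) / 2"
  let ?p = "\<lambda>m t x. trace (mat_pow (Pj t x) m)"
  have jp: "jet (?p m) (\<lambda>t x. trace (mat_pow1 (Pj t x) (P1 t x) m)) (\<lambda>t x. trace (mat_pow2 (Pj t x) (P1 t x) (P2 t x) m))" for m
    by (rule jet_trace[OF mat_jet_pow[OF mat_jet_P]])
  have p0: "?p m 0 x = 0" if "m \<ge> 1" for m x
    using that by (simp add: Pj_at_0 mat_pow_zero trace_def)
  have p1: "trace (mat_pow1 (Pj 0 x) (P1 0 x) m) = 0" if "m \<ge> 2" for m x
    using that by (simp add: Pj_at_0 mat_pow1_zero trace_def)
  have p2: "trace (mat_pow2 (Pj 0 x) (P1 0 x) (P2 0 x) m) = 0" if "m \<ge> 3" for m x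
    using that by (simp add: Pj_at_0 mat_pow2_zero trace_def)
  from jet_wsigma_ps[where m = j and p = "\<lambda>m t x. ?p m t x" and ?p1.0 = "\<lambda>m t x. trace (mat_pow1 (Pj t x) (P1 t x) m)"
      and ?p2.0 = "\<lambda>m t x. trace (mat_pow2 (Pj t x) (P1 t x) (P2 t x) m)", OF jet_Y jp Yj_at_0 p0 p1 p2]
  obtain S1 S2 where S: "jet (\<lambda>t x. wsigma_ps j (Yj t x) (\<lambda>r. ?p r t x)) S1 S2"
    "\<And>x. wsigma_ps j (Yj 0 x) (\<lambda>r. ?p r 0 x) = (if j = 0 then 1 else 0)"
    "\<And>x. S1 0 x = (if j = 1 then Y1 0 x + trace (mat_pow1 (Pj 0 x) (P1 0 x) 1) else 0)"
    "\<And>x. S2 0 x = (if j = 1 then Y2 0 x + trace (mat_pow2 (Pj 0 x) (P1 0 x) (P2 0 x) 1)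
        else if j = 2 then (Y1 0 x + trace (mat_pow1 (Pj 0 x) (P1 0 x) 1))\<^sup>2 - trace (mat_pow2 (Pj 0 x) (P1 0 x) (P2 0 x) 2) / 2 else 0)"
    by blast
  have S1: "S1 0 x = (if j = 1 then s1 x else 0)" for x
    unfolding S(3) Pj_at_0 by (simp add: mat_pow1_zero s1_def)
  have S2: "S2 0 x = (if j = 1 then s2 x else if j = 2 then (s1 x)\<^sup>2 - trace (P1 0 x ** P1 0 x) else 0)" for x
    unfolding S(4) Pj_at_0 by (simp add: mat_pow1_zero mat_pow2_zero s1_def s2_def trace_def sum_distrib_left[symmetric])
  let ?Q = "\<lambda>t x. (cn * u a t) * wsigma_ps j (Yj t x) (\<lambda>r. ?p r t x)"
  let ?Q1 = "\<lambda>t x. (cn * u1 a t) * wsigma_ps j (Yj t x) (\<lambda>r. ?p r t x) + (cn * u a t) * S1 t x"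
  let ?Q2 = "\<lambda>t x. (cn * u2 a t) * wsigma_ps j (Yj t x) (\<lambda>r. ?p r t x) + 2 * ((cn * u1 a t) * S1 t x) + (cn * u a t) * S2 t x"
  have jQ: "jet ?Q ?Q1 ?Q2" by (intro jet_mult jet_cmult jet_u S(1))
  let ?D = "\<lambda>t. LINT x|lborel. (?Q2 t x - 2 * (?Q1 t x * \<Phi> 1 (t, x)) + ?Q t x * ((\<Phi> 1 (t, x))\<^sup>2 - \<Phi> 2 (t, x))) * exp (- \<phi>t t x)"
  obtain \<delta> I1 where d: "\<delta> > 0"
    "\<And>t. \<bar>t\<bar> < \<delta> \<Longrightarrow> ((\<lambda>s. LINT x|lborel. ?Q s x * exp (- \<phi>t s x)) has_real_derivative I1 t) (at t)"
    "\<And>t. \<bar>t\<bar> < \<delta> \<Longrightarrow> (I1 has_real_derivative ?D t) (at t)"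
    by (rule integral_jet[OF jQ jet_\<phi>]) (rule that)
  have W: "((\<lambda>s. W_fun j (\<phi>t s) (\<tau>t s)) has_real_derivative I1 t) (at t)" if t: "\<bar>t\<bar> < min \<delta> \<epsilon>" for t
  proof (rule has_field_derivative_transform_within_open)
    show "((\<lambda>s. LINT x|lborel. ?Q s x * exp (- \<phi>t s x)) has_real_derivative I1 t) (at t)"
      using t by (intro d(2)) simp
    show "open {-\<epsilon><..<\<epsilon>}" by simp
    show "t \<in> {-\<epsilon><..<\<epsilon>}" using t by auto
    show "(LINT x|lborel. ?Q s x * exp (- \<phi>t s x)) = W_fun j (\<phi>t s) (\<tau>t s)" if "s \<in> {-\<epsilon><..<\<epsilon>}" for s
      using that W_fun_eq[of s j] unfolding a_def by (simp add: abs_less_iff)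
  qed
  have "\<forall>\<^sub>F t in nhds 0. t \<in> {- min \<delta> \<epsilon><..<min \<delta> \<epsilon>}"
    using d(1) \<epsilon>_pos by (intro eventually_nhds_in_open) auto
  then have ev: "\<forall>\<^sub>F t in nhds 0. ((\<lambda>s. W_fun j (\<phi>t s) (\<tau>t s)) has_real_derivative I1 t) (at t)"
    by (rule eventually_mono) (rule W, auto simp: abs_less_iff)
  have Q0: "?Q2 0 x - 2 * (?Q1 0 x * \<Phi> 1 (0, x)) + ?Q 0 x * ((\<Phi> 1 (0, x))\<^sup>2 - \<Phi> 2 (0, x))
      = (cn * u a 0) * ((S2 0 x + (2 * a * k) * S1 0 x) - 2 * (S1 0 x * \<Phi> 1 (0, x)))" for x
    using j unfolding S(2) u_0(2) by (simp add: algebra_simps)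
  have "?D 0 = (cn * u a 0) * E (\<lambda>x. (S2 0 x + (2 * a * k) * S1 0 x) - 2 * (S1 0 x * \<Phi> 1 (0, x)))"
    unfolding Q0 E_eq by (rule E_cmult)
  also have "\<dots> = (cn * u (1 - real CARD('n) / 2) 0 * deficit) * (if j = 1 then 1 else if j = 2 then - 1 / 2 else 0)"
  proof -
    consider "j = 1" | "j = 2" | "j \<noteq> 1" "j \<noteq> 2" by blast
    then show ?thesis
    proof cases
      case 1
      have m: "mom (\<lambda>x. s1 x * \<Phi> 1 (0, x))" by (intro mom_mult first_functional mom_\<Phi>1)
      have "E (\<lambda>x. (s2 x + (2 * a * k) * s1 x) - 2 * (s1 x * \<Phi> 1 (0, x)))
          = (E s2 + (2 * a * k) * E s1) - 2 * E (\<lambda>x. s1 x * \<Phi> 1 (0, x))"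
        by (simp only: E_diff[OF mom_add[OF first_functional(3) mom_cmult[OF first_functional(2)]] mom_cmult[OF m]]
            E_add[OF first_functional(3) mom_cmult[OF first_functional(2)]] E_cmult)
      also have "\<dots> = deficit" using first_functional(1,4) by simp
      finally show ?thesis unfolding S1 S2 using 1 by (simp add: a_def)
    next
      case 2
      \<comment> \<open>The prefactor of the second functional has one more power of
        \<open>\<tau>\<close>, which cancels the denominator in
        \<open>second_functional\<close>.\<close>
      have "u a 0 = \<tau> * u (1 - real CARD('n) / 2) 0"
        unfolding u_0(1) a_def 2 using \<tau>_pos
        by (simp add: powr_mult_base algebra_simps)
      then show ?thesis unfolding S1 S2 using 2 second_functional \<tau>_pos by simp
    next
      case 3
      then show ?thesis unfolding S1 S2 by (simp add: E_def)
    qed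
  qed
  finally show ?thesis
    using ev d(3)[of 0] d(1) by (intro exI[of _ I1]) simp
qed

definition w_coeff :: "nat \<Rightarrow> real" where
  "w_coeff i = (1 / 2) ^ i * (\<Sum>l\<le>i. (-1) ^ l / fact l)"

text \<open>The index is \<open>Suc m\<close> so that the coefficient has exponent \<open>m\<close>.
  The sum \<open>J\<close> equals \<open>deriv F\<close> near 0 only, which suffices to
  differentiate it at 0.\<close>

lemma W_hat_second_derivative:
  fixes m :: nat
  defines "F \<equiv> \<lambda>t. W_hat (Suc m) (\<phi>t t) (\<tau>t t)"
  shows "\<forall>\<^sub>F t in nhds 0. F differentiable (at t)"
    and "(deriv F has_real_derivative cn * u (1 - real CARD('n) / 2) 0 * deficit * ((- 1 / 2) ^ m / fact m)) (at 0)"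
proof -
  let ?c = "cn * u (1 - real CARD('n) / 2) 0 * deficit"
  let ?d = "\<lambda>j. if j = 1 then 1 else if j = 2 then - 1 / 2 else 0 :: real"
  have "\<forall>j. \<exists>I1. j \<ge> 1 \<longrightarrow> (\<forall>\<^sub>F t in nhds 0. ((\<lambda>s. W_fun j (\<phi>t s) (\<tau>t s)) has_real_derivative I1 t) (at t)) \<and>
    (I1 has_real_derivative ?c * ?d j) (at 0)"
    using W_fun_second_derivative by blast
  then obtain I1 where I1: "\<And>j. j \<ge> 1 \<Longrightarrow> \<forall>\<^sub>F t in nhds 0. ((\<lambda>s. W_fun j (\<phi>t s) (\<tau>t s)) has_real_derivative I1 j t) (at t)"
    "\<And>j. j \<ge> 1 \<Longrightarrow> (I1 j has_real_derivative ?c * ?d j) (at 0)"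
    unfolding choice_iff by blast
  define J where "J t = (\<Sum>i<Suc m. w_coeff i * I1 (Suc m - i) t)" for t
  have "\<forall>\<^sub>F t in nhds 0. \<forall>i\<in>{..<Suc m}. ((\<lambda>s. W_fun (Suc m - i) (\<phi>t s) (\<tau>t s)) has_real_derivative I1 (Suc m - i) t) (at t)"
    by (intro eventually_ball_finite ballI I1(1)) auto
  then have ev: "\<forall>\<^sub>F t in nhds 0. (F has_real_derivative J t) (at t)"
  proof (rule eventually_mono)
    fix t assume t: "\<forall>i\<in>{..<Suc m}. ((\<lambda>s. W_fun (Suc m - i) (\<phi>t s) (\<tau>t s)) has_real_derivative I1 (Suc m - i) t) (at t)"
    show "(F has_real_derivative J t) (at t)"
      unfolding F_def W_hat_def J_def w_coeff_def[symmetric]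
      by (intro DERIV_sum DERIV_cmult) (rule bspec[OF t])
  qed
  then show "\<forall>\<^sub>F t in nhds 0. F differentiable (at t)"
    by (rule eventually_mono) (rule differentiableI, erule has_field_derivative_imp_has_derivative)
  have "(J has_real_derivative (\<Sum>i<Suc m. w_coeff i * (?c * ?d (Suc m - i)))) (at 0)"
    unfolding J_def by (intro DERIV_sum DERIV_cmult I1(2)) auto
  moreover have "(\<Sum>i<Suc m. w_coeff i * (?c * ?d (Suc m - i))) = ?c * ((- 1 / 2) ^ m / fact m)"
    unfolding W_hat_coefficient[symmetric] w_coeff_def sum_distrib_left by (simp only: mult_ac)
  ultimately have "(J has_real_derivative ?c * ((- 1 / 2) ^ m / fact m)) (at 0)" by simp
  moreover have "\<forall>\<^sub>F t in nhds 0. deriv F t = J t"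
    using ev by (rule eventually_mono) (rule DERIV_imp_deriv)
  ultimately show "(deriv F has_real_derivative ?c * ((- 1 / 2) ^ m / fact m)) (at 0)"
    by (subst DERIV_cong_ev[OF refl _ refl])
qed

end

section \<open>Shrinking Gaussians are smooth and of unit mass\<close>

lemma Cm_on_const: "Cm_on m S (\<lambda>x. c)"
  by (induction m arbitrary: c) simp_all

lemma Cm_on_SucI:
  assumes "\<And>x. (f has_derivative f' x) (at x)" "\<And>v. Cm_on m S (\<lambda>x. f' x v)"
  shows "Cm_on (Suc m) S f"
proof -
  have "frechet_derivative f (at x) v = f' x v" for x v
    using frechet_derivative_at[OF assms(1)[of x]] by simp
  then show ?thesis
    using assms by (auto intro: differentiableI)
qed

lemma smooth_on_affine:
  assumes "\<And>x. (f has_derivative L) (at x)"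
  shows "smooth_on S f"
  unfolding smooth_on_def
proof
  fix m show "Cm_on m S f"
  proof (cases m)
    case 0
    have "isCont f x" for x by (rule has_derivative_continuous[OF assms])
    then show ?thesis unfolding 0 Cm_on.simps by (intro continuous_at_imp_continuous_on ballI)
  next
    case (Suc n)
    show ?thesis unfolding Suc by (rule Cm_on_SucI[OF assms Cm_on_const])
  qed
qed

lemma has_derivative_gaussian:
  fixes y :: "real^'n"
  assumes "s \<noteq> 0"
  shows "(gaussian y s has_derivative (\<lambda>h. ((x - y) \<bullet> h) / (2 * s))) (at x)"
  unfolding gaussian_def[abs_def] power2_norm_eq_inner
  using assms by (auto intro!: derivative_eq_intros simp: inner_commute field_simps)

lemma smooth_on_gaussian:
  fixes y :: "real^'n"
  assumes s: "s \<noteq> 0"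
  shows "smooth_on S (gaussian y s)"
  unfolding smooth_on_def
proof
  fix m show "Cm_on m S (gaussian y s)"
  proof (cases m)
    case 0
    have "isCont (gaussian y s) x" for x by (rule has_derivative_continuous[OF has_derivative_gaussian[OF s]])
    then show ?thesis unfolding 0 Cm_on.simps by (intro continuous_at_imp_continuous_on ballI)
  next
    case (Suc n)
    have "Cm_on n S (\<lambda>x. ((x - y) \<bullet> v) / (2 * s))" for v
    proof -
      have "((\<lambda>x. ((x - y) \<bullet> v) / (2 * s)) has_derivative (\<lambda>h. (h \<bullet> v) / (2 * s))) (at x)" for x
        using s by (auto intro!: derivative_eq_intros)
      then have "smooth_on S (\<lambda>x. ((x - y) \<bullet> v) / (2 * s))" by (rule smooth_on_affine)
      then show ?thesis by (simp add: smooth_on_def)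
    qed
    then show ?thesis unfolding Suc by (intro Cm_on_SucI[OF has_derivative_gaussian[OF s]])
  qed
qed

text \<open>All shrinking Gaussians are affine images of one another with matching prefactors, so
  unit mass transfers from the given one without evaluating a Gaussian integral.\<close>

lemma gaussian_in_C1:
  fixes x0 y :: "real^'n"
  assumes one: "(gaussian x0 \<tau>, \<tau>) \<in> C1" and s: "s > 0"
  shows "(gaussian y s, s) \<in> C1"
proof -
  let ?n = "real CARD('n)"
  have \<tau>: "\<tau> > 0" and int: "(LINT x|lborel. weight (gaussian x0 \<tau>) \<tau> x) = 1"
    using one by (simp_all add: C1_def)
  \<comment> \<open>Gaussian widths scale like the square root of the scale; its
    \<open>CARD('n)\<close>-th power, the Jacobian, turns one normalising factor into the
    other.\<close>
  define c where "c = sqrt (s / \<tau>)"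
  have c: "c > 0" "c\<^sup>2 = s / \<tau>" using s \<tau> by (simp_all add: c_def)
  define t where "t = y - c *\<^sub>R x0"
  have g: "gaussian y s (t + c *\<^sub>R x) = gaussian x0 \<tau> x" for x
  proof -
    have "t + c *\<^sub>R x - y = c *\<^sub>R (x - x0)" by (simp add: t_def algebra_simps)
    then show ?thesis
      using s \<tau> c by (simp add: gaussian_def power_mult_distrib)
  qed
  have meas: "(\<lambda>x. weight (gaussian y s) s x) \<in> borel_measurable borel"
  proof (rule borel_measurable_continuous_onI)
    have "continuous_on UNIV (gaussian y s)"
      by (rule smooth_on_continuous[OF smooth_on_gaussian]) (use s in simp)
    then show "continuous_on UNIV (\<lambda>x. weight (gaussian y s) s x)"
      unfolding weight_def by (intro continuous_intros)
  qed
  have cn: "c ^ CARD('n) = (s / \<tau>) powr (?n / 2)"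
    using s \<tau> by (simp add: c_def powr_realpow[symmetric] powr_half_sqrt[symmetric] powr_powr)
  have "(LINT x|lborel. weight (gaussian y s) s x)
    = (LINT x|density (distr lborel borel (\<lambda>x. t + c *\<^sub>R x)) (\<lambda>_. \<bar>c\<bar> ^ DIM(real^'n)). weight (gaussian y s) s x)"
    using c by (subst lborel_affine[of c t]) simp_all
  also have "\<dots> = (LINT x|lborel. c ^ CARD('n) * weight (gaussian y s) s (t + c *\<^sub>R x))"
    using meas c by (subst integral_density) (auto simp: integral_distr)
  also have "\<dots> = (LINT x|lborel. weight (gaussian x0 \<tau>) \<tau> x)"
  proof (intro Bochner_Integration.integral_cong refl)
    fix x
    have "c ^ CARD('n) * (4 * pi * s) powr (- ?n / 2) = (4 * pi * \<tau>) powr (- ?n / 2)"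
      using s \<tau> unfolding cn by (simp add: powr_mult powr_divide powr_minus field_simps)
    then show "c ^ CARD('n) * weight (gaussian y s) s (t + c *\<^sub>R x) = weight (gaussian x0 \<tau>) \<tau> x"
      by (simp add: weight_def g mult.assoc[symmetric])
  qed
  finally show ?thesis
    using int s smooth_on_gaussian[of s UNIV y] by (simp add: C1_def)
qed

section \<open>Sign and vanishing of the deficit\<close>

context gaussian_variation begin

lemma has_derivative_v: "(v has_derivative (\<lambda>h. (\<chi> i. v1 i x) \<bullet> h)) (at x)"
proof -
  have 1: "((\<lambda>x. \<Phi> 1 (0, x)) has_derivative (\<lambda>h. (\<chi> i. pd 1 i 0 x) \<bullet> h)) (at x)"
    unfolding pd_def by (rule has_derivative_slice[OF smooth_\<Phi> at_0(3)])
  have 2: "((\<lambda>x. \<Phi> 0 (0, x)) has_derivative (\<lambda>h. (\<chi> i. pd 0 i 0 x) \<bullet> h)) (at x)"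
    unfolding pd_def by (rule has_derivative_slice[OF smooth_\<Phi> at_0(3)])
  have 3: "(\<phi> has_derivative (\<lambda>h. (\<chi> i. b i x) \<bullet> h)) (at x)"
    using 2 by (simp only: \<Phi>_0_at_0 pd_0_at_0)
  have "((\<lambda>x. \<Phi> 1 (0, x) + k * \<phi> x) has_derivative (\<lambda>h. (\<chi> i. pd 1 i 0 x) \<bullet> h + k * ((\<chi> i. b i x) \<bullet> h))) (at x)"
    by (intro has_derivative_add has_derivative_mult_right 1 3)
  moreover have "(\<chi> i. pd 1 i 0 x) \<bullet> h + k * ((\<chi> i. b i x) \<bullet> h) = (\<chi> i. v1 i x) \<bullet> h" for h
    by (simp add: inner_vec_def v1_def sum_distrib_left sum.distrib[symmetric] algebra_simps)
  ultimately show ?thesis by (simp add: v_def[abs_def])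
qed

lemma exp_gaussian: "exp (- \<phi> (x + x0)) = gker \<tau> x"
  by (simp add: gaussian_def gker_def power2_norm_eq_inner)

lemma E_translate:
  assumes "mom f"
  shows "(LINT x|lborel. f (x + x0) * gker \<tau> x) = E f" "integrable lborel (\<lambda>x. f (x + x0) * gker \<tau> x)"
proof -
  have "continuous_on UNIV (\<lambda>x. f x * exp (- \<phi> x))"
    by (intro continuous_intros mom_continuous assms continuous_gaussian)
  from integral_lborel_translate[OF borel_measurable_continuous_onI[OF this], of x0]
  show "(LINT x|lborel. f (x + x0) * gker \<tau> x) = E f" by (simp add: E_def exp_gaussian)
  show "integrable lborel (\<lambda>x. f (x + x0) * gker \<tau> x)"
    using integrable_lborel_translate[OF mom_integrable[OF assms], of x0] by (simp add: exp_gaussian)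
qed

lemma norm_v1: "(norm (\<chi> i. v1 i x))\<^sup>2 = (\<Sum>i\<in>UNIV. (v1 i x)\<^sup>2)"
  unfolding power2_norm_eq_inner inner_vec_def by (simp add: power2_eq_square)

lemma mom_v: "mom v" "mom (v1 i)" "mom (\<lambda>x. (v x)\<^sup>2)" "mom (\<lambda>x. \<Sum>i\<in>UNIV. (v1 i x)\<^sup>2)"
proof -
  show 1: "mom v" and 2: "mom (v1 i)" for i using nice2_v by (simp_all add: nice2_def nice1_def)
  show "mom (\<lambda>x. (v x)\<^sup>2)" "mom (\<lambda>x. \<Sum>i\<in>UNIV. (v1 i x)\<^sup>2)"
    unfolding power2_eq_square by (intro mom_sum mom_mult 1 2 finite)+
qed

text \<open>The Poincare inequality is stated for a weight centred at the origin, hence the shift by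
  \<open>x0\<close>. The second moment of the weight comes from the moments of
  \<open>\<phi>\<close>.\<close>

lemma poincare_locale: "gaussian_poincare (\<lambda>x. v (x + x0)) (\<lambda>x. \<chi> i. v1 i (x + x0)) \<tau>"
proof
  show "\<tau> > 0" by (rule \<tau>_pos)
  show "((\<lambda>x. v (x + x0)) has_derivative (\<lambda>h. (\<chi> i. v1 i (x + x0)) \<bullet> h)) (at x)" for x
    by (rule has_derivative_compose[where f = "\<lambda>x. x + x0" and g = v, OF _ has_derivative_v])
       (auto intro!: derivative_eq_intros)
  show "continuous_on UNIV (\<lambda>x. \<chi> i. v1 i (x + x0))"
  proof (intro continuous_on_vec_lambda)
    fix i show "continuous_on UNIV (\<lambda>x. v1 i (x + x0))"
      by (rule continuous_on_compose2[OF mom_continuous[OF mom_v(2)]]) (auto intro!: continuous_intros)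
  qed
  show "integrable lborel (gker \<tau> :: real^'n \<Rightarrow> real)"
    using E_translate(2)[OF mom_one] by simp
  show "integrable lborel (\<lambda>x. (v (x + x0))\<^sup>2 * gker \<tau> x)"
    by (rule E_translate(2)[OF mom_v(3)])
  show "integrable lborel (\<lambda>x. (norm (\<chi> i. v1 i (x + x0)))\<^sup>2 * gker \<tau> x)"
    unfolding norm_v1 by (rule E_translate(2)[OF mom_v(4)])
  have "4 * \<tau> * \<phi> (x + x0) = (norm x)\<^sup>2" for x
    using \<tau>_pos by (simp add: gaussian_def)
  then show "integrable lborel (\<lambda>x :: real^'n. (norm x)\<^sup>2 * gker \<tau> x)"
    using E_translate(2)[OF mom_cmult[OF mom_\<phi>, of "4 * \<tau>"]] by simp
qed

lemma deficit_nonneg: "deficit \<ge> 0"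
  and deficit_eq_0: "deficit = 0 \<Longrightarrow> v1 i x = v1 i x0"
proof -
  interpret P: gaussian_poincare "\<lambda>x. v (x + x0)" "\<lambda>x. \<chi> i. v1 i (x + x0)" \<tau> by (rule poincare_locale)
  have m: "(LINT x|lborel. v (x + x0) * gker \<tau> x) = 0"
    using E_translate(1)[OF mom_v(1)] E_v by simp
  show "deficit \<ge> 0"
    using P.poincare(1)[OF m] \<tau>_pos unfolding norm_v1 E_translate(1)[OF mom_v(3)] E_translate(1)[OF mom_v(4)] deficit_def
    by (simp add: field_simps)
  assume "deficit = 0"
  then have "E (\<lambda>x. (v x)\<^sup>2) = 2 * \<tau> * E (\<lambda>x. \<Sum>i\<in>UNIV. (v1 i x)\<^sup>2)"
    using \<tau>_pos unfolding deficit_def by (simp add: field_simps)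
  from P.poincare(2)[OF m, unfolded norm_v1 E_translate(1)[OF mom_v(3)] E_translate(1)[OF mom_v(4)], OF this, of "x - x0"]
  show "v1 i x = v1 i x0" by (simp add: vec_eq_iff)
qed

lemma deriv_\<phi>t: "deriv (\<lambda>t. \<phi>t t x) 0 = \<Phi> 1 (0, x)"
  using t_deriv_eq[OF at_0(3), of 1 x] by (simp add: t_deriv_def)

lemma deriv_\<tau>t: "deriv \<tau>t 0 = k * \<tau>"
  using DERIV_imp_deriv[OF DERIV_\<tau>(1)[OF at_0(3)]] \<tau>_pos by (simp add: k_def)

lemma deriv_gaussian_curve:
  fixes xt :: "real \<Rightarrow> real^'n" and st :: "real \<Rightarrow> real"
  assumes x: "(xt has_derivative (\<lambda>h. h *\<^sub>R x')) (at 0)" "xt 0 = x0"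
    and s: "(st has_real_derivative s') (at 0)" "st 0 = \<tau>"
  shows "deriv (\<lambda>t. gaussian (xt t) (st t) x) 0 = - ((x - x0) \<bullet> x') / (2 * \<tau>) - s' / \<tau> * \<phi> x"
proof -
  have s0: "(st has_derivative (\<lambda>h. s' * h)) (at 0)" using s(1) by (simp add: has_field_derivative_def)
  have "((\<lambda>t. ((x - xt t) \<bullet> (x - xt t))) has_derivative (\<lambda>h. h * (- 2 * ((x - x0) \<bullet> x')))) (at 0)"
    using x(2) by (auto intro!: derivative_eq_intros x(1) simp: inner_commute algebra_simps)
  then have n: "((\<lambda>t. ((x - xt t) \<bullet> (x - xt t))) has_real_derivative (- 2 * ((x - x0) \<bullet> x'))) (at 0)"
    by (rule has_derivative_imp_has_field_derivative) simp
  have "((\<lambda>t. ((x - xt t) \<bullet> (x - xt t)) / (4 * st t)) has_real_derivative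
      ((- 2 * ((x - x0) \<bullet> x')) * (4 * st 0) - ((x - xt 0) \<bullet> (x - xt 0)) * (4 * s')) / ((4 * st 0) * (4 * st 0))) (at 0)"
    by (rule DERIV_divide[OF n DERIV_cmult[OF s(1)]]) (use s \<tau>_pos in simp)
  moreover have "((- 2 * ((x - x0) \<bullet> x')) * (4 * st 0) - ((x - xt 0) \<bullet> (x - xt 0)) * (4 * s')) / ((4 * st 0) * (4 * st 0))
      = - ((x - x0) \<bullet> x') / (2 * \<tau>) - s' / \<tau> * \<phi> x"
    unfolding s(2) x(2) gaussian_def power2_norm_eq_inner using \<tau>_pos by (simp add: field_simps)
  ultimately show ?thesis
    unfolding gaussian_def power2_norm_eq_inner by (intro DERIV_imp_deriv) simp
qed

text \<open>A linear \<open>v\<close> is an eigenfunction of \<open>OU\<close> with eigenvalue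
  \<open>- 1 / (2 * \<tau>)\<close>, so integration by parts against \<open>v\<close> itself is the
  equality case.\<close>

lemma deficit_linear:
  assumes lin: "\<And>x. v x = (x - x0) \<bullet> w"
  shows "deficit = 0"
proof -
  have v1: "v1 i x = w $ i" for i x
  proof -
    have "((\<lambda>s. v (x + s *\<^sub>R axis i 1)) has_real_derivative v1 i x) (at 0)"
      using nice2_v unfolding nice2_def nice1_def pderiv_def by simp
    moreover have "((\<lambda>s. v (x + s *\<^sub>R axis i 1)) has_real_derivative w $ i) (at 0)"
    proof -
      have "v (x + s *\<^sub>R axis i 1) = (x - x0) \<bullet> w + s * w $ i" for s
        unfolding lin by (simp add: inner_diff_left inner_add_left inner_axis')
      then show ?thesis by (auto intro!: derivative_eq_intros)
    qed
    ultimately show ?thesis by (rule DERIV_unique)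
  qed
  have v2: "v2 i j x = 0" for i j x
  proof -
    have "((\<lambda>s. v1 j (x + s *\<^sub>R axis i 1)) has_real_derivative v2 i j x) (at 0)"
      using nice2_v unfolding nice2_def nice1_def pderiv_def by simp
    then show ?thesis unfolding v1 using DERIV_unique[OF _ DERIV_const] by blast
  qed
  have "OU v1 v2 x = (- 1 / (2 * \<tau>)) * v x" for x
    by (simp add: OU_def drift_def v1 v2 b_def lin inner_vec_def sum_distrib_left sum_divide_distrib sum_negf)
  then have "(\<lambda>x. v x * OU v1 v2 x) = (\<lambda>x. (- 1 / (2 * \<tau>)) * (v x)\<^sup>2)"
    by (intro ext) (simp add: power2_eq_square)
  moreover have "E (\<lambda>x. v x * OU v1 v2 x) = - E (\<lambda>x. \<Sum>i\<in>UNIV. v1 i x * v1 i x)"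
    by (rule E_by_parts[OF conjunct1[OF nice2_v[unfolded nice2_def]] nice2_v])
  ultimately have "(- 1 / (2 * \<tau>)) * E (\<lambda>x. (v x)\<^sup>2) = - E (\<lambda>x. \<Sum>i\<in>UNIV. (v1 i x)\<^sup>2)"
    by (simp only: E_cmult power2_eq_square)
  then show ?thesis by (simp add: deficit_def)
qed

text \<open>Equality in the Poincare inequality makes the gradient of \<open>v\<close> constant, so
  \<open>v\<close> is affine; the zero mean removes the constant, because linear functions about
  \<open>x0\<close> have zero mean.\<close>

lemma deficit_eq_0_imp_linear:
  assumes "deficit = 0"
  shows "\<exists>w. \<forall>x. v x = (x - x0) \<bullet> w"
proof -
  define w where "w = (\<chi> i. v1 i x0)"
  have "(v has_derivative (\<lambda>h. w \<bullet> h)) (at x)" for x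
  proof -
    have "(\<chi> i. v1 i x) = w" unfolding w_def using deficit_eq_0[OF assms] by (simp add: vec_eq_iff)
    then show ?thesis using has_derivative_v[of x] by simp
  qed
  then have "((\<lambda>x. v x - (x - x0) \<bullet> w) has_derivative (\<lambda>h. w \<bullet> h - h \<bullet> w)) (at x within UNIV)" for x
    by (auto intro!: derivative_eq_intros)
  then have "((\<lambda>x. v x - (x - x0) \<bullet> w) has_derivative (\<lambda>h. 0)) (at x within UNIV)" for x
    by (simp add: inner_commute)
  from has_derivative_zero_unique[OF convex_UNIV this, of _ x0]
  have const: "v x = v x0 + (x - x0) \<bullet> w" for x by (simp add: algebra_simps)
  \<comment> \<open>Each \<open>b i\<close> is an eigenfunction of \<open>OU\<close> with nonzero
    eigenvalue, and everything in the range of \<open>OU\<close> has zero mean.\<close>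
  have Eb: "E (b i) = 0" for i
  proof -
    have "nice2 (b i) (\<lambda>j x. if j = i then 1 / (2 * \<tau>) else 0) (\<lambda>j l x. 0)"
      unfolding nice2_def nice1_def
      by (intro conjI allI mom_b mom_const pderiv_b) (simp add: pderiv_def)
    from E_OU[OF this]
    have "E (\<lambda>x. (- 1 / (2 * \<tau>)) * b i x) = 0"
      by (simp add: OU_def[abs_def] drift_def[abs_def] if_distrib[of "\<lambda>c. _ * c"] cong: if_cong)
    then show ?thesis using \<tau>_pos unfolding E_cmult by simp
  qed
  have lin: "(x - x0) \<bullet> w = (\<Sum>i\<in>UNIV. (2 * \<tau> * w $ i) * b i x)" for x
    using \<tau>_pos by (simp add: inner_vec_def b_def mult.commute)
  have v_eq: "v = (\<lambda>x. v x0 * 1 + (\<Sum>i\<in>UNIV. (2 * \<tau> * w $ i) * b i x))"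
    by (rule ext) (simp only: lin[symmetric] mult_1_right const[symmetric])
  have mb: "mom (\<lambda>x. (2 * \<tau> * w $ i) * b i x)" for i by (intro mom_cmult mom_b)
  have "E (\<lambda>x. \<Sum>i\<in>UNIV. (2 * \<tau> * w $ i) * b i x) = (\<Sum>i\<in>UNIV. E (\<lambda>x. (2 * \<tau> * w $ i) * b i x))"
    unfolding E_def sum_distrib_right by (rule Bochner_Integration.integral_sum) (rule mom_integrable[OF mb])
  then have "E (\<lambda>x. \<Sum>i\<in>UNIV. (2 * \<tau> * w $ i) * b i x) = 0"
    by (simp only: E_cmult Eb) simp
  moreover have "E v = v x0 * E (\<lambda>x. 1) + E (\<lambda>x. \<Sum>i\<in>UNIV. (2 * \<tau> * w $ i) * b i x)"
    by (subst v_eq) (simp only: E_add[OF mom_cmult[OF mom_one] mom_sum[OF finite mb]] E_cmult)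
  moreover have "E (\<lambda>x. 1) \<noteq> 0"
  proof -
    interpret P: gaussian_poincare "\<lambda>x. v (x + x0)" "\<lambda>x. \<chi> i. v1 i (x + x0)" \<tau> by (rule poincare_locale)
    show ?thesis using P.gker_integral_pos E_translate(1)[OF mom_one] by simp
  qed
  ultimately have v0: "v x0 = 0" using E_v by simp
  have "v x = (x - x0) \<bullet> w" for x using const[of x] unfolding v0 by simp
  then show ?thesis by blast
qed

end

context gaussian_variation begin

text \<open>To first order, a curve of Gaussians changes \<open>\<phi>\<close> by a linear function,
  from moving the centre, and a multiple of \<open>\<phi>\<close>, from changing the scale.
  Subtracting the latter, tangency says precisely that \<open>v\<close> is linear about
  \<open>x0\<close>.\<close>

lemma tangent_iff_deficit: "tangent_to_gaussians \<phi> \<tau> \<phi>t \<tau>t \<longleftrightarrow> deficit = 0"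
proof
  assume "tangent_to_gaussians \<phi> \<tau> \<phi>t \<tau>t"
  then obtain \<delta> and xt :: "real \<Rightarrow> real^'n" and st where \<delta>: "\<delta> > 0"
    and smooth: "smooth_on {-\<delta><..<\<delta>} xt" "smooth_on {-\<delta><..<\<delta>} st"
    and init: "gaussian (xt 0) (st 0) = \<phi>" "st 0 = \<tau>"
    and d: "\<And>x. deriv (\<lambda>t. \<phi>t t x) 0 = deriv (\<lambda>t. gaussian (xt t) (st t) x) 0" "deriv \<tau>t 0 = deriv st 0"
    unfolding tangent_to_gaussians_def by blast
  have mem: "0 \<in> {-\<delta><..<\<delta>}" using \<delta> by simp
  \<comment> \<open>A Gaussian potential vanishes only at its centre, so evaluating both potentials
    at \<open>x0\<close> identifies the centres.\<close>
  have xt0: "xt 0 = x0"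
  proof -
    have "gaussian (xt 0) \<tau> x0 = \<phi> x0" using init by simp
    then show ?thesis using \<tau>_pos by (simp add: gaussian_def)
  qed
  define x' where "x' = fdrv xt 1 0"
  define s' where "s' = fdrv st 1 0"
  have dx: "(xt has_derivative (\<lambda>h. h *\<^sub>R x')) (at 0)"
  proof -
    have D: "(xt has_derivative (\<lambda>h. fdrv xt h 0)) (at 0)"
      by (rule has_derivative_fdrv[OF smooth_on_differentiable[OF smooth(1) mem]])
    interpret linear "\<lambda>h. fdrv xt h 0" by (rule has_derivative_linear[OF D])
    have "fdrv xt h 0 = h *\<^sub>R x'" for h
      using scale[of h 1] by (simp add: x'_def)
    from has_derivative_eq_rhs[OF D ext[OF this]] show ?thesis .
  qed
  have ds: "(st has_real_derivative s') (at 0)"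
  proof -
    have eq: "0 + s *\<^sub>R 1 = s" for s :: real by simp
    have "st differentiable (at (0 + 0 *\<^sub>R 1))"
      unfolding eq by (rule smooth_on_differentiable[OF smooth(2) mem])
    from DERIV_fdrv_line[OF this] show ?thesis unfolding eq s'_def .
  qed
  have "s' = k * \<tau>" using d(2) DERIV_imp_deriv[OF ds] deriv_\<tau>t by simp
  then have "\<Phi> 1 (0, x) = - ((x - x0) \<bullet> x') / (2 * \<tau>) - k * \<phi> x" for x
    using d(1)[of x] deriv_gaussian_curve[OF dx xt0 ds init(2), of x] \<tau>_pos unfolding deriv_\<phi>t by simp
  then have "v x = (x - x0) \<bullet> ((- 1 / (2 * \<tau>)) *\<^sub>R x')" for x
    by (simp add: v_def)
  then show "deficit = 0" by (rule deficit_linear)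
next
  assume "deficit = 0"
  then obtain w where w: "\<And>x. v x = (x - x0) \<bullet> w" using deficit_eq_0_imp_linear by blast
  \<comment> \<open>Moving the centre with velocity \<open>x'\<close> contributes
    \<open>- ((x - x0) \<bullet> x') / (2 * \<tau>)\<close>; this solves for the velocity that
    produces \<open>w\<close>.\<close>
  define x' where "x' = (- 2 * \<tau>) *\<^sub>R w"
  define s' where "s' = k * \<tau>"
  define xt where "xt t = x0 + t *\<^sub>R x'" for t :: real
  define st where "st t = \<tau> + t * s'" for t :: real
  \<comment> \<open>Short enough for the affine scale \<open>st\<close> to stay positive.\<close>
  define \<delta> where "\<delta> = \<tau> / (\<bar>s'\<bar> + 1)"
  have \<delta>: "\<delta> > 0" using \<tau>_pos by (simp add: \<delta>_def)
  have dx: "(xt has_derivative (\<lambda>h. h *\<^sub>R x')) (at t)" for t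
    unfolding xt_def[abs_def] by (auto intro!: derivative_eq_intros)
  have ds: "(st has_derivative (\<lambda>h. h * s')) (at t)" for t
    unfolding st_def[abs_def] by (auto intro!: derivative_eq_intros)
  then have ds0: "(st has_real_derivative s') (at 0)"
    by (rule has_derivative_imp_has_field_derivative) simp
  have at0: "xt 0 = x0" "st 0 = \<tau>" by (simp_all add: xt_def st_def)
  have st_pos: "st t > 0" if "t \<in> {-\<delta><..<\<delta>}" for t
  proof -
    have "\<bar>t * s'\<bar> \<le> \<delta> * \<bar>s'\<bar>"
      unfolding abs_mult using that by (intro mult_right_mono) auto
    also have "\<dots> < \<tau>"
      using \<tau>_pos by (simp add: \<delta>_def divide_less_eq)
    finally show ?thesis by (simp add: st_def)
  qed
  have C1: "(\<phi>, \<tau>) \<in> C1"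
    using in_C1[OF at_0(3)] smooth_on_gaussian[of \<tau> UNIV x0] \<tau>_pos by (simp add: C1_def at_0)
  show "tangent_to_gaussians \<phi> \<tau> \<phi>t \<tau>t"
    unfolding tangent_to_gaussians_def
  proof (intro exI conjI ballI allI)
    show "\<delta> > 0" by (rule \<delta>)
    show "smooth_on {-\<delta><..<\<delta>} xt" by (rule smooth_on_affine[OF dx])
    show "smooth_on {-\<delta><..<\<delta>} st" by (rule smooth_on_affine[OF ds])
    show "st t > 0" if "t \<in> {-\<delta><..<\<delta>}" for t by (rule st_pos[OF that])
    show "(gaussian (xt t) (st t), st t) \<in> C1" if "t \<in> {-\<delta><..<\<delta>}" for t
      by (rule gaussian_in_C1[OF C1 st_pos[OF that]])
    show "gaussian (xt 0) (st 0) = \<phi>" "st 0 = \<tau>" by (simp_all add: at0)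
    show "deriv \<tau>t 0 = deriv st 0"
      unfolding deriv_\<tau>t DERIV_imp_deriv[OF ds0] s'_def by (rule refl)
    fix x
    have "\<Phi> 1 (0, x) = (x - x0) \<bullet> w - k * \<phi> x" using w[of x] by (simp add: v_def)
    also have "\<dots> = - ((x - x0) \<bullet> x') / (2 * \<tau>) - s' / \<tau> * \<phi> x"
      using \<tau>_pos by (simp add: x'_def s'_def)
    finally show "deriv (\<lambda>t. \<phi>t t x) 0 = deriv (\<lambda>t. gaussian (xt t) (st t) x) 0"
      unfolding deriv_\<phi>t deriv_gaussian_curve[OF dx at0(1) ds0 at0(2)] .
  qed
qed

end

text \<open>Existence of both derivatives is part of the conclusion, since \<open>deriv\<close>
  carries information only where a derivative exists.\<close>

theorem theorem9p5:
  fixes k :: nat and x0 :: "real^'n::finite" and \<phi> :: "real^'n \<Rightarrow> real" and \<tau> \<epsilon> :: real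
    and \<phi>t :: "real \<Rightarrow> real^'n \<Rightarrow> real" and \<tau>t :: "real \<Rightarrow> real"
  defines "F \<equiv> \<lambda>t. W_hat k (\<phi>t t) (\<tau>t t)"
  assumes "k \<ge> 1" and "\<tau> > 0" and "\<phi> = gaussian x0 \<tau>"
    and "\<epsilon> > 0" and "smooth_variation \<phi> \<tau> \<epsilon> \<phi>t \<tau>t"
    and "dominated_variation \<phi>t"
  shows "(\<forall>\<^sub>F t in nhds 0. F differentiable (at t)) \<and> deriv F differentiable (at 0) \<and>
    (-1) ^ k * deriv (deriv F) 0 \<le> 0 \<and>
    ((-1) ^ k * deriv (deriv F) 0 = 0 \<longleftrightarrow> tangent_to_gaussians \<phi> \<tau> \<phi>t \<tau>t)"
proof -
  interpret V: gaussian_variation x0 \<tau> \<epsilon> \<phi>t \<tau>t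
    by standard (use assms in simp_all)
  obtain m where m: "k = Suc m" using assms(2) by (cases k) auto
  \<comment> \<open>The absolute value of the coefficient of the deficit; the sign is split off so
    that \<open>(- 1) ^ k\<close> can absorb it.\<close>
  define c where "c = V.cn * V.u (1 - real CARD('n) / 2) 0 * ((1 / 2) ^ m / fact m)"
  have c: "c > 0"
    using assms(3) by (simp add: c_def V.cn_def V.u_0(1))
  have F: "F = (\<lambda>t. W_hat (Suc m) (\<phi>t t) (\<tau>t t))" by (simp add: F_def m)
  have dd: "(deriv F has_real_derivative V.cn * V.u (1 - real CARD('n) / 2) 0 * V.deficit * ((- 1 / 2) ^ m / fact m)) (at 0)"
    unfolding F by (rule V.W_hat_second_derivative(2))
  \<comment> \<open>The exponents \<open>k = Suc m\<close> and \<open>m\<close> differ by one, which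
    leaves a single minus sign for every \<open>k\<close>.\<close>
  have "(- 1) ^ Suc m * (- 1 / 2 :: real) ^ m = - ((1 / 2) ^ m)"
    by (simp add: power_mult_distrib[symmetric])
  then have sign: "(- 1) ^ k * deriv (deriv F) 0 = - (c * V.deficit)"
    unfolding DERIV_imp_deriv[OF dd] c_def m by (simp add: field_simps)
  show ?thesis
  proof (intro conjI)
    show "\<forall>\<^sub>F t in nhds 0. F differentiable (at t)"
      unfolding F by (rule V.W_hat_second_derivative(1))
    show "deriv F differentiable (at 0)"
      by (rule differentiableI[OF has_field_derivative_imp_has_derivative[OF dd]])
    show "(- 1) ^ k * deriv (deriv F) 0 \<le> 0"
      unfolding sign using c V.deficit_nonneg by simp
    show "(- 1) ^ k * deriv (deriv F) 0 = 0 \<longleftrightarrow> tangent_to_gaussians \<phi> \<tau> \<phi>t \<tau>t"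
      unfolding sign assms(4) V.tangent_iff_deficit using c by simp
  qed
qed

end
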